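(* For any ring $R$, the inclusion functor $\iota:\mathbf{K}(\mathrm{Prj}\,\mathbf{C}(R))\to\mathbf{K}(\mathbf{C}(R))$ has a right adjoint.
   Context: Rings are associative with identity; modules are left modules. $\mathbf{C}(R)$ is the abelian category of complexes of $R$-modules and chain maps. For an additive category $\mathcal{X}$, $\mathbf{K}(\mathcal{X})$ is the homotopy category of complexes in $\mathcal{X}$. $\mathrm{Prj}\,\mathbf{C}(R)$ is the class of projective objects of the abelian category $\mathbf{C}(R)$ (equivalently, exact complexes all of whose cycle modules are projective). *)

theory Defs
  imports "HOL-Algebra.Module" "HOL-Library.FuncSet"
begin

unbundle cardinal_syntax


section \<open>Categories, functors and adjunctions\<close>

text \<open>
  Arrows do not carry their domain and codomain, so composition and identities are indexed by
  objects: \<open>Comp C X Y Z g f\<close> is the composite of \<open>f : X \<rightarrow> Y\<close> followed by \<open>g : Y \<rightarrow> Z\<close>.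
  Different hom-sets may share elements.
\<close>

record ('o, 'm) category =
  Ob :: "'o set"
  Hom :: "'o \<Rightarrow> 'o \<Rightarrow> 'm set"
  Comp :: "'o \<Rightarrow> 'o \<Rightarrow> 'o \<Rightarrow> 'm \<Rightarrow> 'm \<Rightarrow> 'm"
  Idn :: "'o \<Rightarrow> 'm"

definition is_category :: "('o, 'm, 'x) category_scheme \<Rightarrow> bool" where
  "is_category C \<longleftrightarrow>
     (\<forall>X\<in>Ob C. Idn C X \<in> Hom C X X) \<and>
     (\<forall>X\<in>Ob C. \<forall>Y\<in>Ob C. \<forall>Z\<in>Ob C. \<forall>f\<in>Hom C X Y. \<forall>g\<in>Hom C Y Z.
        Comp C X Y Z g f \<in> Hom C X Z) \<and>
     (\<forall>X\<in>Ob C. \<forall>Y\<in>Ob C. \<forall>f\<in>Hom C X Y.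
        Comp C X X Y f (Idn C X) = f \<and> Comp C X Y Y (Idn C Y) f = f) \<and>
     (\<forall>W\<in>Ob C. \<forall>X\<in>Ob C. \<forall>Y\<in>Ob C. \<forall>Z\<in>Ob C.
        \<forall>f\<in>Hom C W X. \<forall>g\<in>Hom C X Y. \<forall>h\<in>Hom C Y Z.
        Comp C W X Z (Comp C X Y Z h g) f = Comp C W Y Z h (Comp C W X Y g f))"

definition is_epi :: "('o, 'm, 'x) category_scheme \<Rightarrow> 'o \<Rightarrow> 'o \<Rightarrow> 'm \<Rightarrow> bool" where
  "is_epi C X Y e \<longleftrightarrow> e \<in> Hom C X Y \<and>
     (\<forall>Z\<in>Ob C. \<forall>g\<in>Hom C Y Z. \<forall>h\<in>Hom C Y Z. Comp C X Y Z g e = Comp C X Y Z h e \<longrightarrow> g = h)"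

definition projective_object :: "('o, 'm, 'x) category_scheme \<Rightarrow> 'o \<Rightarrow> bool" where
  "projective_object C P \<longleftrightarrow> P \<in> Ob C \<and>
     (\<forall>X\<in>Ob C. \<forall>Y\<in>Ob C. \<forall>e. is_epi C X Y e \<longrightarrow>
        (\<forall>f\<in>Hom C P Y. \<exists>g\<in>Hom C P X. Comp C P X Y e g = f))"

definition Prj :: "('o, 'm, 'x) category_scheme \<Rightarrow> ('o, 'm, 'x) category_scheme" where
  "Prj C = C\<lparr>Ob := {P. projective_object C P}\<rparr>"

record ('o, 'm, 'p, 'n) cfunctor =
  on_Ob :: "'o \<Rightarrow> 'p"
  on_Hom :: "'o \<Rightarrow> 'o \<Rightarrow> 'm \<Rightarrow> 'n"

definition is_functor ::
  "('o, 'm, 'x) category_scheme \<Rightarrow> ('p, 'n, 'y) category_scheme \<Rightarrow> ('o, 'm, 'p, 'n) cfunctor \<Rightarrow> bool"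
where
  "is_functor C D F \<longleftrightarrow> is_category C \<and> is_category D \<and>
     (\<forall>X\<in>Ob C. on_Ob F X \<in> Ob D) \<and>
     (\<forall>X\<in>Ob C. \<forall>Y\<in>Ob C. \<forall>f\<in>Hom C X Y. on_Hom F X Y f \<in> Hom D (on_Ob F X) (on_Ob F Y)) \<and>
     (\<forall>X\<in>Ob C. on_Hom F X X (Idn C X) = Idn D (on_Ob F X)) \<and>
     (\<forall>X\<in>Ob C. \<forall>Y\<in>Ob C. \<forall>Z\<in>Ob C. \<forall>f\<in>Hom C X Y. \<forall>g\<in>Hom C Y Z.
        on_Hom F X Z (Comp C X Y Z g f) =
        Comp D (on_Ob F X) (on_Ob F Y) (on_Ob F Z) (on_Hom F Y Z g) (on_Hom F X Y f))"

text \<open>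
  For a subcategory whose hom-sets are literally subsets of the ambient ones. This applies to
  \<open>homotopy_cat (Prj A)\<close> and \<open>homotopy_cat A\<close>: \<open>Prj A\<close> is a full subcategory, so complexes in it have
  the same chain maps and the same homotopy classes as in \<open>A\<close>.
\<close>

definition inclusion_functor :: "('o, 'm, 'o, 'm) cfunctor" where
  "inclusion_functor = \<lparr>on_Ob = (\<lambda>X. X), on_Hom = (\<lambda>X Y f. f)\<rparr>"

definition is_adjunction ::
  "('o, 'm, 'x) category_scheme \<Rightarrow> ('p, 'n, 'y) category_scheme \<Rightarrow>
   ('o, 'm, 'p, 'n) cfunctor \<Rightarrow> ('p, 'n, 'o, 'm) cfunctor \<Rightarrow> ('o \<Rightarrow> 'p \<Rightarrow> 'n \<Rightarrow> 'm) \<Rightarrow> bool"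
where
  "is_adjunction C D F G \<phi> \<longleftrightarrow> is_functor C D F \<and> is_functor D C G \<and>
     (\<forall>X\<in>Ob C. \<forall>Y\<in>Ob D. bij_betw (\<phi> X Y) (Hom D (on_Ob F X) Y) (Hom C X (on_Ob G Y))) \<and>
     (\<forall>X\<in>Ob C. \<forall>X'\<in>Ob C. \<forall>Y\<in>Ob D. \<forall>u\<in>Hom C X' X. \<forall>h\<in>Hom D (on_Ob F X) Y.
        \<phi> X' Y (Comp D (on_Ob F X') (on_Ob F X) Y h (on_Hom F X' X u)) =
        Comp C X' X (on_Ob G Y) (\<phi> X Y h) u) \<and>
     (\<forall>X\<in>Ob C. \<forall>Y\<in>Ob D. \<forall>Y'\<in>Ob D. \<forall>v\<in>Hom D Y Y'. \<forall>h\<in>Hom D (on_Ob F X) Y.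
        \<phi> X Y' (Comp D (on_Ob F X) Y Y' v h) =
        Comp C X (on_Ob G Y) (on_Ob G Y') (on_Hom G Y Y' v) (\<phi> X Y h))"

definition has_right_adjoint ::
  "('o, 'm, 'x) category_scheme \<Rightarrow> ('p, 'n, 'y) category_scheme \<Rightarrow> ('o, 'm, 'p, 'n) cfunctor \<Rightarrow> bool"
where
  "has_right_adjoint C D F \<longleftrightarrow> (\<exists>G \<phi>. is_adjunction C D F G \<phi>)"


section \<open>Complexes and the homotopy category of an additive category\<close>

record ('o, 'm) additive_category = "('o, 'm) category" +
  Add :: "'o \<Rightarrow> 'o \<Rightarrow> 'm \<Rightarrow> 'm \<Rightarrow> 'm"
  Zero :: "'o \<Rightarrow> 'o \<Rightarrow> 'm"

text \<open>The record carries only the operations; no axioms are attached to it.\<close>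

text \<open>Complexes are graded homologically and indexed by all integers.\<close>

record ('o, 'm) cplx =
  obj :: "int \<Rightarrow> 'o"
  diff :: "int \<Rightarrow> 'm"

definition complexes :: "('o, 'm, 'x) additive_category_scheme \<Rightarrow> ('o, 'm) cplx set" where
  "complexes A = {X.
     (\<forall>n. obj X n \<in> Ob A) \<and>
     (\<forall>n. diff X n \<in> Hom A (obj X n) (obj X (n - 1))) \<and>
     (\<forall>n. Comp A (obj X n) (obj X (n - 1)) (obj X (n - 2)) (diff X (n - 1)) (diff X n)
          = Zero A (obj X n) (obj X (n - 2)))}"

definition chain_maps ::
  "('o, 'm, 'x) additive_category_scheme \<Rightarrow> ('o, 'm) cplx \<Rightarrow> ('o, 'm) cplx \<Rightarrow> (int \<Rightarrow> 'm) set"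
where
  "chain_maps A X Y = {f.
     (\<forall>n. f n \<in> Hom A (obj X n) (obj Y n)) \<and>
     (\<forall>n. Comp A (obj X n) (obj Y n) (obj Y (n - 1)) (diff Y n) (f n)
          = Comp A (obj X n) (obj X (n - 1)) (obj Y (n - 1)) (f (n - 1)) (diff X n))}"

definition comp_chain ::
  "('o, 'm, 'x) additive_category_scheme \<Rightarrow> ('o, 'm) cplx \<Rightarrow> ('o, 'm) cplx \<Rightarrow> ('o, 'm) cplx \<Rightarrow>
   (int \<Rightarrow> 'm) \<Rightarrow> (int \<Rightarrow> 'm) \<Rightarrow> (int \<Rightarrow> 'm)"
where
  "comp_chain A X Y Z g f = (\<lambda>n. Comp A (obj X n) (obj Y n) (obj Z n) (g n) (f n))"

definition complex_cat ::
  "('o, 'm, 'x) additive_category_scheme \<Rightarrow> (('o, 'm) cplx, int \<Rightarrow> 'm) additive_category"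
where
  "complex_cat A =
     \<lparr>Ob = complexes A,
      Hom = chain_maps A,
      Comp = comp_chain A,
      Idn = (\<lambda>X n. Idn A (obj X n)),
      Add = (\<lambda>X Y f g n. Add A (obj X n) (obj Y n) (f n) (g n)),
      Zero = (\<lambda>X Y n. Zero A (obj X n) (obj Y n))\<rparr>"

text \<open>
  \<open>f\<close> and \<open>g\<close> are homotopic if \<open>f\<^sub>n - g\<^sub>n = d\<^sub>n\<^sub>+\<^sub>1 s\<^sub>n + s\<^sub>n\<^sub>-\<^sub>1 d\<^sub>n\<close> for some \<open>s\<^sub>n : X\<^sub>n \<rightarrow> Y\<^sub>n\<^sub>+\<^sub>1\<close>; the
  condition is written with \<open>g\<^sub>n\<close> on the right-hand side.
\<close>

definition homotopy_rel ::
  "('o, 'm, 'x) additive_category_scheme \<Rightarrow> ('o, 'm) cplx \<Rightarrow> ('o, 'm) cplx \<Rightarrow> (int \<Rightarrow> 'm) rel"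
where
  "homotopy_rel A X Y = {(f, g). f \<in> chain_maps A X Y \<and> g \<in> chain_maps A X Y \<and>
     (\<exists>s. (\<forall>n. s n \<in> Hom A (obj X n) (obj Y (n + 1))) \<and>
          (\<forall>n. f n = Add A (obj X n) (obj Y n) (g n)
             (Add A (obj X n) (obj Y n)
               (Comp A (obj X n) (obj Y (n + 1)) (obj Y n) (diff Y (n + 1)) (s n))
               (Comp A (obj X n) (obj X (n - 1)) (obj Y n) (s (n - 1)) (diff X n)))))}"

definition homotopy_cat ::
  "('o, 'm, 'x) additive_category_scheme \<Rightarrow> (('o, 'm) cplx, (int \<Rightarrow> 'm) set) category"
where
  "homotopy_cat A =
     \<lparr>Ob = complexes A,
      Hom = (\<lambda>X Y. chain_maps A X Y // homotopy_rel A X Y),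
      Comp = (\<lambda>X Y Z G F. \<Union>g\<in>G. \<Union>f\<in>F. homotopy_rel A X Z `` {comp_chain A X Y Z g f}),
      Idn = (\<lambda>X. homotopy_rel A X X `` {\<lambda>n. Idn A (obj X n)})\<rparr>"


section \<open>Modules over a possibly noncommutative ring\<close>

text \<open>
  The library locale \<open>module\<close> assumes a commutative ring; here its record type is reused, with the
  same axioms over an arbitrary ring. The fields \<open>mult\<close> and \<open>one\<close> of the record are irrelevant.
\<close>

locale left_module = R?: ring R + M?: abelian_group M
  for R (structure) and M (structure) +
  assumes smult_closed:
      "\<lbrakk>a \<in> carrier R; x \<in> carrier M\<rbrakk> \<Longrightarrow> a \<odot>\<^bsub>M\<^esub> x \<in> carrier M"
    and smult_l_distr:
      "\<lbrakk>a \<in> carrier R; b \<in> carrier R; x \<in> carrier M\<rbrakk> \<Longrightarrow>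
       (a \<oplus>\<^bsub>R\<^esub> b) \<odot>\<^bsub>M\<^esub> x = a \<odot>\<^bsub>M\<^esub> x \<oplus>\<^bsub>M\<^esub> b \<odot>\<^bsub>M\<^esub> x"
    and smult_r_distr:
      "\<lbrakk>a \<in> carrier R; x \<in> carrier M; y \<in> carrier M\<rbrakk> \<Longrightarrow>
       a \<odot>\<^bsub>M\<^esub> (x \<oplus>\<^bsub>M\<^esub> y) = a \<odot>\<^bsub>M\<^esub> x \<oplus>\<^bsub>M\<^esub> a \<odot>\<^bsub>M\<^esub> y"
    and smult_assoc1:
      "\<lbrakk>a \<in> carrier R; b \<in> carrier R; x \<in> carrier M\<rbrakk> \<Longrightarrow>
       (a \<otimes>\<^bsub>R\<^esub> b) \<odot>\<^bsub>M\<^esub> x = a \<odot>\<^bsub>M\<^esub> (b \<odot>\<^bsub>M\<^esub> x)"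
    and smult_one:
      "x \<in> carrier M \<Longrightarrow> \<one>\<^bsub>R\<^esub> \<odot>\<^bsub>M\<^esub> x = x"

text \<open>Module homomorphisms are undefined outside the carrier, so that equality is extensional.\<close>

definition module_homs ::
  "('r, 'z) ring_scheme \<Rightarrow> ('r, 'u) module \<Rightarrow> ('r, 'u) module \<Rightarrow> ('u \<Rightarrow> 'u) set"
where
  "module_homs R M N = {f \<in> carrier M \<rightarrow>\<^sub>E carrier N.
     (\<forall>x\<in>carrier M. \<forall>y\<in>carrier M. f (x \<oplus>\<^bsub>M\<^esub> y) = f x \<oplus>\<^bsub>N\<^esub> f y) \<and>
     (\<forall>a\<in>carrier R. \<forall>x\<in>carrier M. f (a \<odot>\<^bsub>M\<^esub> x) = a \<odot>\<^bsub>N\<^esub> f x)}"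

text \<open>
  HOL has no type of all sets, so the large category of all modules is formed relative to a
  universe: the modules are those whose carrier is a subset of the type \<open>'u\<close> of cardinality
  below \<open>\<kappa>\<close>. A cardinal \<open>\<kappa>\<close> of a type \<open>'u\<close> has at most as many elements as \<open>'u\<close>, hence every set
  smaller than \<open>\<kappa>\<close> has a copy in \<open>'u\<close>. The universe is required to contain an infinite set and to
  be closed under unions indexed by its members and under countable powers. Strongly
  inaccessible \<open>\<kappa>\<close>, i.e. Grothendieck universes, are a special case (\<open>universe_if_inaccessible\<close>
  below); the weaker closure conditions make universes containing any given set provably exist
  in HOL (\<open>universe_exists\<close> below).
\<close>

definition universe_cardinal :: "'u rel \<Rightarrow> bool" where
  "universe_cardinal \<kappa> \<longleftrightarrow> Card_order \<kappa> \<and> natLeq <o \<kappa> \<and> regularCard \<kappa> \<and>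
     (\<forall>A :: 'u set. |A| <o \<kappa> \<longrightarrow> |A| ^c natLeq <o \<kappa>)"

definition module_cat ::
  "'u rel \<Rightarrow> ('r, 'z) ring_scheme \<Rightarrow> (('r, 'u) module, 'u \<Rightarrow> 'u) additive_category"
where
  "module_cat \<kappa> R =
     \<lparr>Ob = {M. left_module R M \<and> |carrier M| <o \<kappa>},
      Hom = module_homs R,
      Comp = (\<lambda>L M N g f. compose (carrier L) g f),
      Idn = (\<lambda>M. \<lambda>x\<in>carrier M. x),
      Add = (\<lambda>M N f g. \<lambda>x\<in>carrier M. f x \<oplus>\<^bsub>N\<^esub> g x),
      Zero = (\<lambda>M N. \<lambda>x\<in>carrier M. \<zero>\<^bsub>N\<^esub>)\<rparr>"

lemma universe_if_inaccessible:
  fixes \<kappa> :: "'u rel"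
  assumes \<kappa>: "Card_order \<kappa>" "natLeq <o \<kappa>" "regularCard \<kappa>"
    and pow: "\<And>A :: 'u set. |A| <o \<kappa> \<Longrightarrow> |Pow A| <o \<kappa>"
  shows "universe_cardinal \<kappa>"
proof -
  have "|A| ^c natLeq <o \<kappa>" if A: "|A| <o \<kappa>" for A :: "'u set"
  proof -
    have "|Field natLeq| \<le>o |Field \<kappa>|"
      using card_of_mono2 ordLess_imp_ordLeq[OF \<kappa>(2)] by blast
    then obtain f :: "nat \<Rightarrow> 'u" where f: "inj f"
      unfolding Field_natLeq card_of_ordLeq[symmetric] by auto
    define C where "C = A \<union> range f"
    have N: "|range f| \<le>o natLeq"
      by (rule ordLeq_ordIso_trans[OF card_of_image card_of_nat])
    have inf: "\<not> finite (Field \<kappa>)"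
      using \<kappa>(2) cinfinite_def cinfinite_mono natLeq_cinfinite ordLess_imp_ordLeq by blast
    have C: "|C| <o \<kappa>"
      unfolding C_def
      by (rule card_of_Un_ordLess_infinite_Field[OF inf \<kappa>(1) A ordLeq_ordLess_trans[OF N \<kappa>(2)]])
    have Cinf: "Cinfinite |C|"
      using f by (auto simp: C_def cinfinite_def Field_card_of card_of_card_order_on
          dest: finite_imageD)
    have "|A| \<le>o |Pow C|"
      using card_of_Pow card_of_mono1[of A C] ordLeq_ordLess_trans ordLess_imp_ordLeq
      unfolding C_def by blast
    also have P: "|Pow C| =o ctwo ^c |C|"
      using card_of_Pow_Func[of C] by (simp add: ctwo_def cexp_def Field_card_of)
    finally have "|A| ^c natLeq \<le>o (ctwo ^c |C| ) ^c natLeq"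
      by (rule cexp_mono1[OF _ natLeq_Card_order])
    also have "(ctwo ^c |C| ) ^c natLeq =o ctwo ^c |C|"
      by (rule cexp_cprod_ordLeq[OF Card_order_ctwo Cinf])
        (simp_all add: Cinfinite_Cnotzero natLeq_Cinfinite natLeq_ordLeq_cinfinite[OF Cinf])
    also have "ctwo ^c |C| =o |Pow C|"
      by (rule ordIso_symmetric[OF P])
    finally show ?thesis
      using pow[OF C] ordLeq_ordLess_trans by blast
  qed
  then show ?thesis
    using \<kappa> by (simp add: universe_cardinal_def)
qed

lemma universe_exists:
  "\<exists>\<kappa> :: (nat \<Rightarrow> 'v set) set rel. universe_cardinal \<kappa> \<and> |UNIV :: 'v set| <o \<kappa>"
proof -
  let ?k = "|UNIV :: (nat \<Rightarrow> 'v set) set|"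
  let ?p = "|UNIV :: 'v set set|"
  have k: "?p ^c natLeq = ?k"
    by (simp add: cexp_def Field_card_of Field_natLeq Func_def)
  have "ctwo \<le>o ?p"
    unfolding ctwo_def card_of_ordLeq[symmetric]
    by (rule exI[of _ "\<lambda>b. if b then UNIV else {}"]) (auto simp: inj_on_def split: if_splits)
  then have inf: "Cinfinite ?k"
    using Cinfinite_cexp[OF _ natLeq_Cinfinite] k by metis
  have pow: "?k ^c natLeq =o ?k"
    using cexp_cprod_ordLeq[OF card_of_Card_order natLeq_Cinfinite
        Cinfinite_Cnotzero[OF natLeq_Cinfinite] ordLeq_refl[OF natLeq_Card_order],
        of "UNIV :: 'v set set"]
    by (simp only: k)
  have less: "r <o cardSuc ?k \<longleftrightarrow> r \<le>o ?k" if "Card_order r" for r :: "'b rel"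
    by (rule cardSuc_ordLeq_ordLess[OF card_of_Card_order that])
  have "|A| ^c natLeq <o cardSuc ?k" if "|A| <o cardSuc ?k" for A :: "(nat \<Rightarrow> 'v set) set set"
  proof -
    have "|A| \<le>o ?k"
      using that less card_of_Card_order by blast
    then have "|A| ^c natLeq \<le>o ?k ^c natLeq"
      by (rule cexp_mono1[OF _ natLeq_Card_order])
    also note pow
    finally show ?thesis
      using less Card_order_cexp by blast
  qed
  moreover have "natLeq <o cardSuc ?k"
    using less natLeq_Card_order natLeq_ordLeq_cinfinite[OF inf] by blast
  moreover have "|UNIV :: 'v set| <o cardSuc ?k"
  proof -
    have "|UNIV :: 'v set| \<le>o ?k"
      unfolding card_of_ordLeq[symmetric]
      by (rule exI[of _ "\<lambda>x _. {x}"]) (auto simp: inj_on_def fun_eq_iff)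
    then show ?thesis
      using less card_of_Card_order by blast
  qed
  ultimately show ?thesis
    unfolding universe_cardinal_def
    using regularCard_cardSuc[OF inf] cardSuc_Card_order[OF card_of_Card_order] by blast
qed

end

theory Submission
  imports Defs "HOL-Library.Countable_Set"
begin

text \<open>
  For a complex \<open>X\<close> over \<open>C(R)\<close> we construct a complex \<open>P\<close> of projectives and a chain map
  \<open>p : P \<rightarrow> X\<close> such that, for every complex \<open>F\<close> of projectives, every chain map \<open>h : F \<rightarrow> P[1]\<close> and
  every null homotopy \<open>u\<close> of \<open>p h\<close>, there is a null homotopy \<open>T\<close> of \<open>h\<close> with \<open>p T = u\<close>. For
  \<open>h = 0\<close> this says that chain maps \<open>F[-1] \<rightarrow> X\<close> factor through \<open>p\<close>; for \<open>h = f - f'\<close> it says that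
  composition with \<open>p\<close> is injective on homotopy classes. So \<open>P\<close> is the value at \<open>X\<close> of the adjoint.

  \<open>P\<close> is obtained by freely adjoining \<open>T\<close> for all countably generated free \<open>F\<close>. Its generators are
  well-founded trees, a node carrying the data \<open>(F, h, u)\<close> and the countably many earlier generators
  that occur in \<open>h\<close>. This replaces a transfinite iteration, and as such a tree is determined by the
  labels along its finite paths, there are at most countable-power many of them. For an arbitrary free
  \<open>F\<close>, each basis element lies in a countable set of basis elements closed under the differential, so
  Zorn's lemma yields \<open>T\<close>. Finally, a complex \<open>(Q, d)\<close> of projectives with \<open>Q\<^sub>n\<close> a retract of a free
  \<open>F\<^sub>n\<close> via \<open>i\<close> and \<open>\<pi>\<close> is a retract of the complex \<open>(F, i d \<pi>)\<close>.
\<close>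

section \<open>Left modules, homomorphisms and free modules\<close>

text \<open>The lifting property is a strict form of the statement that every chain map from a
  complex of projectives to the cone of \<open>p\<close> is null homotopic: the equation
  \<open>p T = u\<close> admits no correction by a further homotopy. Both halves of the adjunction
  thereby become instances of one statement, chain maps factor on the nose, and no triangulated
  structure is needed. The obstacle is circular: \<open>h\<close> takes values in the very complex
  that is being built, so each adjoined \<open>T\<close> creates new problems. It is broken by
  countability. Every \<open>h g\<close> has finite support, so a countable system mentions only
  countably many generators of \<open>P\<close>, and a datatype with countably branching nodes
  already contains a node for every such system. Uncountable systems bring a second obstacle: a set
  of basis elements closed under the differential spans a subcomplex that need not split off. A
  partial solution is therefore extended through a corrected system on the quotient. Finally
  \<open>P\<close> must lie in the universe. Labels and trees are countable families of small data,
  whence the use of closure under countable powers.\<close>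

definition lhom :: "('r, 'z) ring_scheme \<Rightarrow> ('r, 'a) module \<Rightarrow> ('r, 'b) module \<Rightarrow> ('a \<Rightarrow> 'b) \<Rightarrow> bool" where
  "lhom R M N f \<longleftrightarrow> f \<in> carrier M \<rightarrow> carrier N \<and>
     (\<forall>x\<in>carrier M. \<forall>y\<in>carrier M. f (x \<oplus>\<^bsub>M\<^esub> y) = f x \<oplus>\<^bsub>N\<^esub> f y) \<and>
     (\<forall>a\<in>carrier R. \<forall>x\<in>carrier M. f (a \<odot>\<^bsub>M\<^esub> x) = a \<odot>\<^bsub>N\<^esub> f x)"

text \<open>\<open>lhom\<close> forgets extensionality and allows source and target to have
  different carrier types. The construction takes place in free modules, whose elements are
  functions, and only its result is copied into the type \<open>'u\<close>; this equivalence is the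
  way back.\<close>

lemma module_homs_iff: "f \<in> module_homs R M N \<longleftrightarrow> lhom R M N f \<and> f \<in> extensional (carrier M)"
  by (auto simp: module_homs_def lhom_def PiE_def)

lemma lhom_closed: "lhom R M N f \<Longrightarrow> x \<in> carrier M \<Longrightarrow> f x \<in> carrier N"
  and lhom_add: "lhom R M N f \<Longrightarrow> x \<in> carrier M \<Longrightarrow> y \<in> carrier M \<Longrightarrow> f (x \<oplus>\<^bsub>M\<^esub> y) = f x \<oplus>\<^bsub>N\<^esub> f y"
  and lhom_smult: "lhom R M N f \<Longrightarrow> a \<in> carrier R \<Longrightarrow> x \<in> carrier M \<Longrightarrow> f (a \<odot>\<^bsub>M\<^esub> x) = a \<odot>\<^bsub>N\<^esub> f x"
  by (auto simp: lhom_def)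

lemma lhom_cong: "(\<And>x. x \<in> carrier M \<Longrightarrow> f x = g x) \<Longrightarrow> left_module R M \<Longrightarrow> lhom R M N f \<Longrightarrow> lhom R M N g"
  unfolding lhom_def
  by (auto simp: Pi_iff left_module.smult_closed abelian_groupE(1)[OF left_module.axioms(2)])

lemma lhom_comp: "lhom R L M f \<Longrightarrow> lhom R M N g \<Longrightarrow> lhom R L N (\<lambda>x. g (f x))"
  by (auto simp: lhom_def Pi_iff)

lemma left_moduleI:
  fixes R (structure) and M (structure)
  assumes "ring R"
    and "\<And>x y. \<lbrakk>x \<in> carrier M; y \<in> carrier M\<rbrakk> \<Longrightarrow> x \<oplus>\<^bsub>M\<^esub> y \<in> carrier M"
    and "\<zero>\<^bsub>M\<^esub> \<in> carrier M"
    and "\<And>x y z. \<lbrakk>x \<in> carrier M; y \<in> carrier M; z \<in> carrier M\<rbrakk> \<Longrightarrow>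
      (x \<oplus>\<^bsub>M\<^esub> y) \<oplus>\<^bsub>M\<^esub> z = x \<oplus>\<^bsub>M\<^esub> (y \<oplus>\<^bsub>M\<^esub> z)"
    and "\<And>x y. \<lbrakk>x \<in> carrier M; y \<in> carrier M\<rbrakk> \<Longrightarrow> x \<oplus>\<^bsub>M\<^esub> y = y \<oplus>\<^bsub>M\<^esub> x"
    and "\<And>x. x \<in> carrier M \<Longrightarrow> \<zero>\<^bsub>M\<^esub> \<oplus>\<^bsub>M\<^esub> x = x"
    and "\<And>x. x \<in> carrier M \<Longrightarrow> \<exists>y\<in>carrier M. y \<oplus>\<^bsub>M\<^esub> x = \<zero>\<^bsub>M\<^esub>"
    and "\<And>a x. \<lbrakk>a \<in> carrier R; x \<in> carrier M\<rbrakk> \<Longrightarrow> a \<odot>\<^bsub>M\<^esub> x \<in> carrier M"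
    and "\<And>a b x. \<lbrakk>a \<in> carrier R; b \<in> carrier R; x \<in> carrier M\<rbrakk> \<Longrightarrow>
      (a \<oplus>\<^bsub>R\<^esub> b) \<odot>\<^bsub>M\<^esub> x = a \<odot>\<^bsub>M\<^esub> x \<oplus>\<^bsub>M\<^esub> b \<odot>\<^bsub>M\<^esub> x"
    and "\<And>a x y. \<lbrakk>a \<in> carrier R; x \<in> carrier M; y \<in> carrier M\<rbrakk> \<Longrightarrow>
      a \<odot>\<^bsub>M\<^esub> (x \<oplus>\<^bsub>M\<^esub> y) = a \<odot>\<^bsub>M\<^esub> x \<oplus>\<^bsub>M\<^esub> a \<odot>\<^bsub>M\<^esub> y"
    and "\<And>a b x. \<lbrakk>a \<in> carrier R; b \<in> carrier R; x \<in> carrier M\<rbrakk> \<Longrightarrow>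
      (a \<otimes>\<^bsub>R\<^esub> b) \<odot>\<^bsub>M\<^esub> x = a \<odot>\<^bsub>M\<^esub> (b \<odot>\<^bsub>M\<^esub> x)"
    and "\<And>x. x \<in> carrier M \<Longrightarrow> \<one>\<^bsub>R\<^esub> \<odot>\<^bsub>M\<^esub> x = x"
  shows "left_module R M"
  using assms(1) abelian_groupI[of M, OF assms(2-7)] assms(8-12)
  by (simp add: left_module_def left_module_axioms_def)

context left_module
begin

lemma smult_l_null [simp]: "x \<in> carrier M \<Longrightarrow> \<zero>\<^bsub>R\<^esub> \<odot>\<^bsub>M\<^esub> x = \<zero>\<^bsub>M\<^esub>"
  by (metis M.add.r_cancel_one' R.add.l_cancel_one R.zero_closed smult_closed smult_l_distr)

lemma smult_r_null [simp]: "a \<in> carrier R \<Longrightarrow> a \<odot>\<^bsub>M\<^esub> \<zero>\<^bsub>M\<^esub> = \<zero>\<^bsub>M\<^esub>"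
  by (metis M.add.r_cancel_one' M.l_zero M.zero_closed smult_closed smult_r_distr)

lemma smult_minus:
  assumes "a \<in> carrier R" "x \<in> carrier M"
  shows "a \<odot>\<^bsub>M\<^esub> (\<ominus>\<^bsub>M\<^esub> x) = \<ominus>\<^bsub>M\<^esub> (a \<odot>\<^bsub>M\<^esub> x)"
  using assms M.minus_equality[of "a \<odot>\<^bsub>M\<^esub> (\<ominus>\<^bsub>M\<^esub> x)" "a \<odot>\<^bsub>M\<^esub> x"]
  by (simp add: smult_r_distr[symmetric] M.l_neg smult_closed)

lemma smult_finsum:
  assumes "a \<in> carrier R" "f \<in> A \<rightarrow> carrier M"
  shows "finsum M (\<lambda>b. a \<odot>\<^bsub>M\<^esub> f b) A = a \<odot>\<^bsub>M\<^esub> finsum M f A"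
  using assms(2)
proof (induct A rule: infinite_finite_induct)
  case (insert x F)
  then have "f \<in> F \<rightarrow> carrier M" "f x \<in> carrier M" by auto
  then show ?case
    using insert assms(1) by (simp add: smult_r_distr smult_closed Pi_iff)
qed (simp_all add: assms(1))

end

lemma lhom_zero:
  assumes "left_module R M" "left_module R N" "lhom R M N f"
  shows "f \<zero>\<^bsub>M\<^esub> = \<zero>\<^bsub>N\<^esub>"
proof -
  interpret M: left_module R M by fact
  interpret N: left_module R N by fact
  have "f \<zero>\<^bsub>M\<^esub> \<oplus>\<^bsub>N\<^esub> f \<zero>\<^bsub>M\<^esub> = f \<zero>\<^bsub>M\<^esub>"
    using lhom_add[OF assms(3), of "\<zero>\<^bsub>M\<^esub>" "\<zero>\<^bsub>M\<^esub>"] by simp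
  then show ?thesis
    using lhom_closed[OF assms(3)] by (metis N.M.add.r_cancel_one' M.M.zero_closed)
qed

lemma lhom_minus:
  assumes "left_module R M" "left_module R N" "lhom R M N f" "x \<in> carrier M"
  shows "f (\<ominus>\<^bsub>M\<^esub> x) = \<ominus>\<^bsub>N\<^esub> (f x)"
proof -
  interpret M: left_module R M by fact
  interpret N: left_module R N by fact
  have "f (\<ominus>\<^bsub>M\<^esub> x) \<oplus>\<^bsub>N\<^esub> f x = \<zero>\<^bsub>N\<^esub>"
    using lhom_add[OF assms(3), of "\<ominus>\<^bsub>M\<^esub> x" x] lhom_zero[OF assms(1-3)] assms(4)
    by (simp add: M.M.l_neg)
  then show ?thesis
    using lhom_closed[OF assms(3)] assms(4) N.M.minus_equality[of "f (\<ominus>\<^bsub>M\<^esub> x)" "f x"] by simp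
qed

lemma lhom_plus:
  assumes "left_module R N" "lhom R M N f" "lhom R M N g"
  shows "lhom R M N (\<lambda>x. f x \<oplus>\<^bsub>N\<^esub> g x)"
proof -
  interpret N: left_module R N by fact
  show ?thesis using assms(2,3) unfolding lhom_def
    by (auto simp: Pi_iff N.smult_r_distr N.M.a_ac)
qed

lemma lhom_uminus:
  assumes "left_module R N" "lhom R M N f"
  shows "lhom R M N (\<lambda>x. \<ominus>\<^bsub>N\<^esub> f x)"
proof -
  interpret N: left_module R N by fact
  show ?thesis using assms(2) unfolding lhom_def
    by (auto simp: Pi_iff N.smult_minus N.M.minus_add)
qed

lemma lhom_const_zero:
  assumes "left_module R N"
  shows "lhom R M N (\<lambda>x. \<zero>\<^bsub>N\<^esub>)"
proof -
  interpret N: left_module R N by fact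
  show ?thesis by (auto simp: lhom_def)
qed

section \<open>Free modules and linear extension\<close>

definition free_mod :: "('r, 'z) ring_scheme \<Rightarrow> 'b set \<Rightarrow> ('r, 'b \<Rightarrow> 'r) module" where
  "free_mod R S = \<lparr>carrier = {\<phi>. (\<forall>b. \<phi> b \<in> carrier R) \<and> finite {b. \<phi> b \<noteq> \<zero>\<^bsub>R\<^esub>} \<and> {b. \<phi> b \<noteq> \<zero>\<^bsub>R\<^esub>} \<subseteq> S},
     mult = undefined, one = undefined, zero = (\<lambda>b. \<zero>\<^bsub>R\<^esub>), add = (\<lambda>\<phi> \<psi> b. \<phi> b \<oplus>\<^bsub>R\<^esub> \<psi> b),
     smult = (\<lambda>a \<phi> b. a \<otimes>\<^bsub>R\<^esub> \<phi> b)\<rparr>"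

definition unit_vec :: "('r, 'z) ring_scheme \<Rightarrow> 'b \<Rightarrow> 'b \<Rightarrow> 'r" where
  "unit_vec R b = (\<lambda>b'. if b' = b then \<one>\<^bsub>R\<^esub> else \<zero>\<^bsub>R\<^esub>)"

definition lin_ext :: "('r, 'z) ring_scheme \<Rightarrow> ('r, 'a) module \<Rightarrow> ('b \<Rightarrow> 'a) \<Rightarrow> ('b \<Rightarrow> 'r) \<Rightarrow> 'a" where
  "lin_ext R M v \<phi> = finsum M (\<lambda>b. \<phi> b \<odot>\<^bsub>M\<^esub> v b) {b. \<phi> b \<noteq> \<zero>\<^bsub>R\<^esub>}"

lemma free_mod_carrier: "\<phi> \<in> carrier (free_mod R S) \<longleftrightarrow>
    (\<forall>b. \<phi> b \<in> carrier R) \<and> finite {b. \<phi> b \<noteq> \<zero>\<^bsub>R\<^esub>} \<and> (\<forall>b. \<phi> b \<noteq> \<zero>\<^bsub>R\<^esub> \<longrightarrow> b \<in> S)"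
  by (auto simp: free_mod_def)

lemma free_mod_simps [simp]:
  "\<zero>\<^bsub>free_mod R S\<^esub> = (\<lambda>b. \<zero>\<^bsub>R\<^esub>)" "\<phi> \<oplus>\<^bsub>free_mod R S\<^esub> \<psi> = (\<lambda>b. \<phi> b \<oplus>\<^bsub>R\<^esub> \<psi> b)"
  "a \<odot>\<^bsub>free_mod R S\<^esub> \<phi> = (\<lambda>b. a \<otimes>\<^bsub>R\<^esub> \<phi> b)"
  by (auto simp: free_mod_def)

text \<open>Vectors are functions on the whole type of basis elements, so enlarging the basis is
  literally the identity on elements and index sets can be changed without coercions.\<close>

lemma free_mod_mono: "S \<subseteq> S' \<Longrightarrow> \<phi> \<in> carrier (free_mod R S) \<Longrightarrow> \<phi> \<in> carrier (free_mod R S')"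
  by (auto simp: free_mod_carrier)

context ring
begin

lemma left_module_free_mod: "left_module R (free_mod R S)"
proof (rule left_moduleI[OF ring_axioms])
  show "\<phi> \<oplus>\<^bsub>free_mod R S\<^esub> \<psi> \<in> carrier (free_mod R S)"
    if "\<phi> \<in> carrier (free_mod R S)" "\<psi> \<in> carrier (free_mod R S)" for \<phi> \<psi>
  proof -
    have "finite ({b. \<phi> b \<noteq> \<zero>} \<union> {b. \<psi> b \<noteq> \<zero>})"
      using that by (auto simp: free_mod_carrier)
    moreover have "{b. \<phi> b \<oplus> \<psi> b \<noteq> \<zero>} \<subseteq> {b. \<phi> b \<noteq> \<zero>} \<union> {b. \<psi> b \<noteq> \<zero>}" by auto
    ultimately show ?thesis
      using that by (auto simp: free_mod_carrier intro: finite_subset)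
  qed
  show "\<exists>\<psi>\<in>carrier (free_mod R S). \<psi> \<oplus>\<^bsub>free_mod R S\<^esub> \<phi> = \<zero>\<^bsub>free_mod R S\<^esub>"
    if "\<phi> \<in> carrier (free_mod R S)" for \<phi>
  proof (rule bexI[of _ "\<lambda>b. \<ominus> \<phi> b"])
    have "{b. \<ominus> \<phi> b \<noteq> \<zero>} = {b. \<phi> b \<noteq> \<zero>}"
      using that by (auto simp: free_mod_carrier)
    then show "(\<lambda>b. \<ominus> \<phi> b) \<in> carrier (free_mod R S)"
      using that by (auto simp: free_mod_carrier)
  qed (use that in \<open>auto simp: free_mod_carrier l_neg\<close>)
  show "a \<odot>\<^bsub>free_mod R S\<^esub> \<phi> \<in> carrier (free_mod R S)"
    if "a \<in> carrier R" "\<phi> \<in> carrier (free_mod R S)" for a \<phi>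
  proof -
    have "{b. a \<otimes> \<phi> b \<noteq> \<zero>} \<subseteq> {b. \<phi> b \<noteq> \<zero>}"
      using that by (auto simp: free_mod_carrier)
    then show ?thesis
      using that by (auto simp: free_mod_carrier intro: finite_subset)
  qed
qed (auto simp: free_mod_carrier fun_eq_iff a_ac l_distr r_distr m_assoc)

lemma unit_vec_closed: "b \<in> S \<Longrightarrow> unit_vec R b \<in> carrier (free_mod R S)"
proof -
  assume "b \<in> S"
  moreover have "{b'. unit_vec R b b' \<noteq> \<zero>} \<subseteq> {b}" by (auto simp: unit_vec_def)
  ultimately show ?thesis
    by (auto simp: free_mod_carrier unit_vec_def)
qed

text \<open>The defining sum runs over the support of the vector; a common finite superset allows
  sums for different vectors to be combined.\<close>

lemma lin_ext_superset:
  assumes "left_module R M" "\<phi> \<in> carrier (free_mod R S)" "v \<in> S \<rightarrow> carrier M"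
    and "finite A" "{b. \<phi> b \<noteq> \<zero>} \<subseteq> A" "A \<subseteq> S"
  shows "lin_ext R M v \<phi> = finsum M (\<lambda>b. \<phi> b \<odot>\<^bsub>M\<^esub> v b) A"
proof -
  interpret M: left_module R M by fact
  show ?thesis unfolding lin_ext_def
    using assms(2-6)
    by (intro M.M.add.finprod_mono_neutral_cong_left)
      (auto simp: free_mod_carrier Pi_iff subset_iff intro!: M.smult_closed M.smult_l_null)
qed

lemma lhom_lin_ext:
  assumes "left_module R M" "v \<in> S \<rightarrow> carrier M"
  shows "lhom R (free_mod R S) M (lin_ext R M v)"
proof -
  interpret M: left_module R M by fact
  interpret F: left_module R "free_mod R S" by (rule left_module_free_mod)
  have cl: "(\<lambda>b. \<phi> b \<odot>\<^bsub>M\<^esub> v b) \<in> A \<rightarrow> carrier M" if "\<phi> \<in> carrier (free_mod R S)" "A \<subseteq> S" for \<phi> A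
    using that assms(2) by (auto simp: free_mod_carrier Pi_iff subset_iff intro!: M.smult_closed)
  show ?thesis unfolding lhom_def
  proof (intro conjI ballI)
    show "lin_ext R M v \<in> carrier (free_mod R S) \<rightarrow> carrier M"
      unfolding lin_ext_def by (intro funcsetI M.M.finsum_closed cl) (auto simp: free_mod_carrier)
  next
    fix \<phi> \<psi> assume P: "\<phi> \<in> carrier (free_mod R S)" "\<psi> \<in> carrier (free_mod R S)"
    let ?A = "{b. \<phi> b \<noteq> \<zero>} \<union> {b. \<psi> b \<noteq> \<zero>}"
    have A: "finite ?A" "?A \<subseteq> S" using P by (auto simp: free_mod_carrier)
    have *: "\<phi> \<oplus>\<^bsub>free_mod R S\<^esub> \<psi> \<in> carrier (free_mod R S)" using P by (rule F.M.a_closed)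
    have **: "{b. (\<phi> \<oplus>\<^bsub>free_mod R S\<^esub> \<psi>) b \<noteq> \<zero>} \<subseteq> ?A" by auto
    have "lin_ext R M v (\<phi> \<oplus>\<^bsub>free_mod R S\<^esub> \<psi>) = finsum M (\<lambda>b. (\<phi> \<oplus>\<^bsub>free_mod R S\<^esub> \<psi>) b \<odot>\<^bsub>M\<^esub> v b) ?A"
      using lin_ext_superset[OF assms(1) * assms(2) A(1) ** A(2)] .
    also have "\<dots> = finsum M (\<lambda>b. \<phi> b \<odot>\<^bsub>M\<^esub> v b \<oplus>\<^bsub>M\<^esub> \<psi> b \<odot>\<^bsub>M\<^esub> v b) ?A"
      using P A assms(2) cl[OF P(1) A(2)] cl[OF P(2) A(2)]
      by (intro M.M.finsum_cong') (auto simp: free_mod_carrier M.smult_l_distr Pi_iff)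
    also have "\<dots> = lin_ext R M v \<phi> \<oplus>\<^bsub>M\<^esub> lin_ext R M v \<psi>"
      using cl[OF P(1) A(2)] cl[OF P(2) A(2)] P
      by (simp add: M.M.finsum_addf lin_ext_superset[OF assms(1) _ assms(2) A(1) _ A(2)])
    finally show "lin_ext R M v (\<phi> \<oplus>\<^bsub>free_mod R S\<^esub> \<psi>) = lin_ext R M v \<phi> \<oplus>\<^bsub>M\<^esub> lin_ext R M v \<psi>" .
  next
    fix a \<phi> assume P: "a \<in> carrier R" "\<phi> \<in> carrier (free_mod R S)"
    let ?A = "{b. \<phi> b \<noteq> \<zero>}"
    have A: "finite ?A" "?A \<subseteq> S" using P by (auto simp: free_mod_carrier)
    have *: "a \<odot>\<^bsub>free_mod R S\<^esub> \<phi> \<in> carrier (free_mod R S)" using P by (rule F.smult_closed)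
    have **: "{b. (a \<odot>\<^bsub>free_mod R S\<^esub> \<phi>) b \<noteq> \<zero>} \<subseteq> ?A" using P by auto
    have "lin_ext R M v (a \<odot>\<^bsub>free_mod R S\<^esub> \<phi>) = finsum M (\<lambda>b. (a \<odot>\<^bsub>free_mod R S\<^esub> \<phi>) b \<odot>\<^bsub>M\<^esub> v b) ?A"
      using lin_ext_superset[OF assms(1) * assms(2) A(1) ** A(2)] .
    also have "\<dots> = finsum M (\<lambda>b. a \<odot>\<^bsub>M\<^esub> (\<phi> b \<odot>\<^bsub>M\<^esub> v b)) ?A"
      using P A assms(2) cl[OF P(2) A(2)]
      by (intro M.M.finsum_cong') (auto simp: free_mod_carrier M.smult_assoc1 Pi_iff intro!: M.smult_closed)
    also have "\<dots> = a \<odot>\<^bsub>M\<^esub> lin_ext R M v \<phi>"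
      unfolding lin_ext_def using M.smult_finsum[OF P(1) cl[OF P(2) A(2)]] by simp
    finally show "lin_ext R M v (a \<odot>\<^bsub>free_mod R S\<^esub> \<phi>) = a \<odot>\<^bsub>M\<^esub> lin_ext R M v \<phi>" .
  qed
qed

lemma lin_ext_unit_vec:
  assumes "left_module R M" "v b \<in> carrier M"
  shows "lin_ext R M v (unit_vec R b) = v b"
proof -
  interpret M: left_module R M by fact
  have "lin_ext R M v (unit_vec R b) = finsum M (\<lambda>b'. unit_vec R b b' \<odot>\<^bsub>M\<^esub> v b') {b}"
    using assms by (intro lin_ext_superset[where S = "{b}"] unit_vec_closed) (auto simp: unit_vec_def)
  then show ?thesis using assms(2) by (simp add: unit_vec_def M.smult_one)
qed

text \<open>Induction on a finite set containing the support: \<open>\<psi>\<close> drops the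
  coefficient at one basis element and \<open>\<chi>\<close> is the matching multiple of a basis
  vector.\<close>

lemma lin_ext_lhom:
  assumes "left_module R N" "lhom R (free_mod R S) N f" "\<phi> \<in> carrier (free_mod R S)"
  shows "f \<phi> = lin_ext R N (\<lambda>b. f (unit_vec R b)) \<phi>"
proof -
  interpret N: left_module R N by fact
  interpret F: left_module R "free_mod R S" by (rule left_module_free_mod)
  let ?L = "lin_ext R N (\<lambda>b. f (unit_vec R b))"
  have v: "(\<lambda>b. f (unit_vec R b)) \<in> S \<rightarrow> carrier N"
    using lhom_closed[OF assms(2) unit_vec_closed] by auto
  note L = lhom_lin_ext[OF assms(1) v]
  have "\<forall>\<phi>. \<phi> \<in> carrier (free_mod R S) \<longrightarrow> {b. \<phi> b \<noteq> \<zero>} \<subseteq> A \<longrightarrow> f \<phi> = ?L \<phi>" if "finite A" for A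
    using that
  proof (induct A)
    case empty
    have "\<phi> = \<zero>\<^bsub>free_mod R S\<^esub>" if "{b. \<phi> b \<noteq> \<zero>} \<subseteq> {}" for \<phi> using that by auto
    then show ?case
      using lhom_zero[OF left_module_free_mod assms(1) assms(2)] lhom_zero[OF left_module_free_mod assms(1) L]
      by metis
  next
    case (insert x A)
    show ?case
    proof (intro allI impI)
      fix \<phi> assume P: "\<phi> \<in> carrier (free_mod R S)" "{b. \<phi> b \<noteq> \<zero>} \<subseteq> insert x A"
      show "f \<phi> = ?L \<phi>"
      proof (cases "\<phi> x = \<zero>")
        case True
        then have "{b. \<phi> b \<noteq> \<zero>} \<subseteq> A" using P(2) by auto
        then show ?thesis using insert(3) P(1) by blast
      next
        case False
        then have x: "x \<in> S" using P(1) by (auto simp: free_mod_carrier)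
        have r: "\<phi> x \<in> carrier R" using P(1) by (auto simp: free_mod_carrier)
        define \<psi> where "\<psi> = (\<lambda>b. if b = x then \<zero> else \<phi> b)"
        define \<chi> where "\<chi> = \<phi> x \<odot>\<^bsub>free_mod R S\<^esub> unit_vec R x"
        have "{b. \<psi> b \<noteq> \<zero>} \<subseteq> {b. \<phi> b \<noteq> \<zero>}" by (auto simp: \<psi>_def)
        then have \<psi>: "\<psi> \<in> carrier (free_mod R S)" "{b. \<psi> b \<noteq> \<zero>} \<subseteq> A"
          using P by (auto simp: \<psi>_def free_mod_carrier intro: finite_subset)
        have \<chi>: "\<chi> \<in> carrier (free_mod R S)"
          unfolding \<chi>_def by (rule F.smult_closed[OF r unit_vec_closed[OF x]])
        have e: "\<phi> = \<psi> \<oplus>\<^bsub>free_mod R S\<^esub> \<chi>"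
          using P(1) r by (auto simp: \<psi>_def \<chi>_def unit_vec_def fun_eq_iff free_mod_carrier)
        have "?L (unit_vec R x) = f (unit_vec R x)"
          using lin_ext_unit_vec[OF assms(1), of "\<lambda>b. f (unit_vec R b)" x] v x by auto
        then have "f \<chi> = ?L \<chi>"
          unfolding \<chi>_def using lhom_smult[OF assms(2) r unit_vec_closed[OF x]] lhom_smult[OF L r unit_vec_closed[OF x]]
          by simp
        moreover have "f \<psi> = ?L \<psi>" using insert(3) \<psi> by blast
        ultimately show ?thesis
          unfolding e using lhom_add[OF assms(2) \<psi>(1) \<chi>] lhom_add[OF L \<psi>(1) \<chi>] by simp
      qed
    qed
  qed
  then show ?thesis using assms(3) by (auto simp: free_mod_carrier)
qed

lemma lhom_free_mod_eqI:
  assumes "left_module R N" "lhom R (free_mod R S) N f" "lhom R (free_mod R S) N f'"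
    and "\<And>b. b \<in> S \<Longrightarrow> f (unit_vec R b) = f' (unit_vec R b)" and "\<phi> \<in> carrier (free_mod R S)"
  shows "f \<phi> = f' \<phi>"
proof -
  interpret N: left_module R N by fact
  have "lin_ext R N (\<lambda>b. f (unit_vec R b)) \<phi> = lin_ext R N (\<lambda>b. f' (unit_vec R b)) \<phi>"
    unfolding lin_ext_def using assms(4,5) lhom_closed[OF assms(3) unit_vec_closed]
    by (intro N.M.finsum_cong') (auto simp: free_mod_carrier intro!: N.smult_closed)
  then show ?thesis using lin_ext_lhom assms by metis
qed

end

subsection \<open>Images of modules under congruences\<close>

text \<open>The operations are computed through chosen preimages, which is meaningful as soon as the
  fibres of \<open>q\<close> form a congruence. An injective \<open>q\<close> yields an isomorphic
  copy in another type; a \<open>q\<close> that picks coset representatives yields a quotient inside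
  the type of \<open>M\<close> itself.\<close>

definition image_mod :: "('a \<Rightarrow> 'b) \<Rightarrow> ('r, 'a) module \<Rightarrow> ('r, 'b) module" where
  "image_mod q M = (let s = inv_into (carrier M) q in
     \<lparr>carrier = q ` carrier M, mult = undefined, one = undefined, zero = q \<zero>\<^bsub>M\<^esub>,
      add = (\<lambda>x y. q (s x \<oplus>\<^bsub>M\<^esub> s y)), smult = (\<lambda>a x. q (a \<odot>\<^bsub>M\<^esub> s x))\<rparr>)"

lemma image_mod_carrier [simp]: "carrier (image_mod q M) = q ` carrier M"
  by (simp add: image_mod_def Let_def)

lemma image_mod_module:
  assumes "left_module R M"
    and add: "\<And>x x' y y'. \<lbrakk>x \<in> carrier M; x' \<in> carrier M; y \<in> carrier M; y' \<in> carrier M; q x = q x'; q y = q y'\<rbrakk>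
      \<Longrightarrow> q (x \<oplus>\<^bsub>M\<^esub> y) = q (x' \<oplus>\<^bsub>M\<^esub> y')"
    and smult: "\<And>a x x'. \<lbrakk>a \<in> carrier R; x \<in> carrier M; x' \<in> carrier M; q x = q x'\<rbrakk>
      \<Longrightarrow> q (a \<odot>\<^bsub>M\<^esub> x) = q (a \<odot>\<^bsub>M\<^esub> x')"
  shows "left_module R (image_mod q M)" "lhom R M (image_mod q M) q"
proof -
  interpret M: left_module R M by fact
  have s: "inv_into (carrier M) q (q x) \<in> carrier M" "q (inv_into (carrier M) q (q x)) = q x"
    if "x \<in> carrier M" for x
    using that by (auto intro: inv_into_into f_inv_into_f)
  have a: "q x \<oplus>\<^bsub>image_mod q M\<^esub> q y = q (x \<oplus>\<^bsub>M\<^esub> y)" if "x \<in> carrier M" "y \<in> carrier M" for x y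
    unfolding image_mod_def Let_def by (simp, rule add; use that s in simp)
  have m: "a \<odot>\<^bsub>image_mod q M\<^esub> q x = q (a \<odot>\<^bsub>M\<^esub> x)" if "a \<in> carrier R" "x \<in> carrier M" for a x
    unfolding image_mod_def Let_def by (simp, rule smult; use that s in simp)
  have z: "\<zero>\<^bsub>image_mod q M\<^esub> = q \<zero>\<^bsub>M\<^esub>" by (simp add: image_mod_def Let_def)
  show "left_module R (image_mod q M)"
  proof (rule left_moduleI[OF M.R.ring_axioms])
    fix x assume "x \<in> carrier (image_mod q M)"
    then obtain x' where x: "x = q x'" "x' \<in> carrier M" by auto
    then show "\<exists>y\<in>carrier (image_mod q M). y \<oplus>\<^bsub>image_mod q M\<^esub> x = \<zero>\<^bsub>image_mod q M\<^esub>"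
      by (intro bexI[of _ "q (\<ominus>\<^bsub>M\<^esub> x')"]) (auto simp: a z M.M.l_neg)
  qed (auto simp: a m z M.smult_closed M.smult_l_distr M.smult_r_distr M.smult_assoc1 M.smult_one M.M.a_ac)
  show "lhom R M (image_mod q M) q"
    by (auto simp: lhom_def a m)
qed

lemma image_mod_inj:
  assumes "left_module R M" "inj_on e (carrier M)"
  shows "left_module R (image_mod e M)" "lhom R M (image_mod e M) e"
    "lhom R (image_mod e M) M (inv_into (carrier M) e)"
proof -
  interpret M: left_module R M by fact
  have c: "e x = e x' \<longleftrightarrow> x = x'" if "x \<in> carrier M" "x' \<in> carrier M" for x x'
    using assms(2) that by (auto simp: inj_on_def)
  show *: "left_module R (image_mod e M)" "lhom R M (image_mod e M) e"
    by (rule image_mod_module[OF assms(1)]; use c in auto)+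
  have a: "e x \<oplus>\<^bsub>image_mod e M\<^esub> e y = e (x \<oplus>\<^bsub>M\<^esub> y)" if "x \<in> carrier M" "y \<in> carrier M" for x y
    using lhom_add[OF *(2) that] by simp
  have m: "a \<odot>\<^bsub>image_mod e M\<^esub> e x = e (a \<odot>\<^bsub>M\<^esub> x)" if "a \<in> carrier R" "x \<in> carrier M" for a x
    using lhom_smult[OF *(2) that] by simp
  show "lhom R (image_mod e M) M (inv_into (carrier M) e)"
    using assms(2) by (auto simp: lhom_def a m M.smult_closed)
qed

section \<open>Complexes of modules\<close>

text \<open>Like \<open>lhom\<close>, this and \<open>cmap\<close> impose neither a size bound nor
  extensionality and work for any carrier type; \<open>complexes_iff\<close> and
  \<open>chain_maps_iff\<close> restore both for the module category.\<close>

definition cx :: "('r, 'z) ring_scheme \<Rightarrow> (('r, 'a) module, 'a \<Rightarrow> 'a) cplx \<Rightarrow> bool" where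
  "cx R Y \<longleftrightarrow> (\<forall>m. left_module R (obj Y m)) \<and>
     (\<forall>m. lhom R (obj Y m) (obj Y (m - 1)) (diff Y m)) \<and>
     (\<forall>m. \<forall>x\<in>carrier (obj Y m). diff Y (m - 1) (diff Y m x) = \<zero>\<^bsub>obj Y (m - 2)\<^esub>)"

definition cmap :: "('r, 'z) ring_scheme \<Rightarrow> (('r, 'a) module, 'a \<Rightarrow> 'a) cplx \<Rightarrow>
    (('r, 'b) module, 'b \<Rightarrow> 'b) cplx \<Rightarrow> (int \<Rightarrow> 'a \<Rightarrow> 'b) \<Rightarrow> bool" where
  "cmap R Y Z f \<longleftrightarrow> (\<forall>m. lhom R (obj Y m) (obj Z m) (f m)) \<and>
     (\<forall>m. \<forall>x\<in>carrier (obj Y m). f (m - 1) (diff Y m x) = diff Z m (f m x))"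

lemma cx_module: "cx R Y \<Longrightarrow> left_module R (obj Y m)"
  and cx_lhom: "cx R Y \<Longrightarrow> lhom R (obj Y m) (obj Y (m - 1)) (diff Y m)"
  and cx_closed: "cx R Y \<Longrightarrow> x \<in> carrier (obj Y m) \<Longrightarrow> diff Y m x \<in> carrier (obj Y (m - 1))"
  and cx_diff2: "cx R Y \<Longrightarrow> x \<in> carrier (obj Y m) \<Longrightarrow> diff Y (m - 1) (diff Y m x) = \<zero>\<^bsub>obj Y (m - 2)\<^esub>"
  by (auto simp: cx_def dest: lhom_closed)

lemma cmap_lhom: "cmap R Y Z f \<Longrightarrow> lhom R (obj Y m) (obj Z m) (f m)"
  and cmap_closed: "cmap R Y Z f \<Longrightarrow> x \<in> carrier (obj Y m) \<Longrightarrow> f m x \<in> carrier (obj Z m)"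
  and cmap_diff: "cmap R Y Z f \<Longrightarrow> x \<in> carrier (obj Y m) \<Longrightarrow> f (m - 1) (diff Y m x) = diff Z m (f m x)"
  by (auto simp: cmap_def dest: lhom_closed)

lemma cmap_add: "cmap R Y Z f \<Longrightarrow> x \<in> carrier (obj Y m) \<Longrightarrow> y \<in> carrier (obj Y m) \<Longrightarrow>
    f m (x \<oplus>\<^bsub>obj Y m\<^esub> y) = f m x \<oplus>\<^bsub>obj Z m\<^esub> f m y"
  by (rule lhom_add[OF cmap_lhom])

lemma cmap_minus: "cx R Y \<Longrightarrow> cx R Z \<Longrightarrow> cmap R Y Z f \<Longrightarrow> x \<in> carrier (obj Y m) \<Longrightarrow>
    f m (\<ominus>\<^bsub>obj Y m\<^esub> x) = \<ominus>\<^bsub>obj Z m\<^esub> f m x"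
  by (rule lhom_minus[OF cx_module cx_module cmap_lhom])

lemma cmap_zero: "cx R Y \<Longrightarrow> cx R Z \<Longrightarrow> cmap R Y Z f \<Longrightarrow> f m \<zero>\<^bsub>obj Y m\<^esub> = \<zero>\<^bsub>obj Z m\<^esub>"
  by (rule lhom_zero[OF cx_module cx_module cmap_lhom])

lemma cx_zero: "cx R Y \<Longrightarrow> diff Y m \<zero>\<^bsub>obj Y m\<^esub> = \<zero>\<^bsub>obj Y (m - 1)\<^esub>"
  by (rule lhom_zero[OF cx_module cx_module cx_lhom])

lemma cmap_comp: "cmap R X Y f \<Longrightarrow> cmap R Y Z g \<Longrightarrow> cmap R X Z (\<lambda>m x. g m (f m x))"
  unfolding cmap_def using lhom_comp lhom_closed by metis

lemma cmap_id: "cmap R X X (\<lambda>m x. x)"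
  by (auto simp: cmap_def lhom_def)

lemma cmap_plus:
  assumes "cx R Z" "cmap R Y Z f" "cmap R Y Z g"
  shows "cmap R Y Z (\<lambda>m x. f m x \<oplus>\<^bsub>obj Z m\<^esub> g m x)"
  unfolding cmap_def
proof (intro conjI allI ballI)
  show "lhom R (obj Y m) (obj Z m) (\<lambda>x. f m x \<oplus>\<^bsub>obj Z m\<^esub> g m x)" for m
    by (rule lhom_plus[OF cx_module[OF assms(1)] cmap_lhom[OF assms(2)] cmap_lhom[OF assms(3)]])
qed (simp add: cmap_diff[OF assms(2)] cmap_diff[OF assms(3)] lhom_add[OF cx_lhom[OF assms(1)]]
    cmap_closed[OF assms(2)] cmap_closed[OF assms(3)])

lemma cmap_uminus:
  assumes "cx R Z" "cmap R Y Z f"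
  shows "cmap R Y Z (\<lambda>m x. \<ominus>\<^bsub>obj Z m\<^esub> f m x)"
  unfolding cmap_def
proof (intro conjI allI ballI)
  show "lhom R (obj Y m) (obj Z m) (\<lambda>x. \<ominus>\<^bsub>obj Z m\<^esub> f m x)" for m
    by (rule lhom_uminus[OF cx_module[OF assms(1)] cmap_lhom[OF assms(2)]])
qed (simp add: cmap_diff[OF assms(2)] cmap_closed[OF assms(2)]
    lhom_minus[OF cx_module[OF assms(1)] cx_module[OF assms(1)] cx_lhom[OF assms(1)]])

lemma cmap_const_zero: "cx R Z \<Longrightarrow> cmap R Y Z (\<lambda>m x. \<zero>\<^bsub>obj Z m\<^esub>)"
  unfolding cmap_def by (auto simp: cx_zero intro!: lhom_const_zero cx_module)

lemma cmap_cong: "cx R Y \<Longrightarrow> cmap R Y Z f \<Longrightarrow> (\<And>m x. x \<in> carrier (obj Y m) \<Longrightarrow> f m x = g m x) \<Longrightarrow> cmap R Y Z g"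
  unfolding cmap_def using cx_closed cx_module
  by (metis lhom_cong)

subsection \<open>Free complexes\<close>

text \<open>A generator \<open>g\<close> of degree \<open>m\<close> contributes the basis element \<open>(g, False)\<close> in degree \<open>m\<close> and
  its boundary \<open>(g, True)\<close> in degree \<open>m - 1\<close>; so this is a direct sum of disk complexes.\<close>

definition free_cx :: "('r, 'z) ring_scheme \<Rightarrow> 'g set \<Rightarrow> ('g \<Rightarrow> int) \<Rightarrow>
    (('r, 'g \<times> bool \<Rightarrow> 'r) module, ('g \<times> bool \<Rightarrow> 'r) \<Rightarrow> 'g \<times> bool \<Rightarrow> 'r) cplx" where
  "free_cx R \<Gamma> deg = \<lparr>obj = (\<lambda>m. free_mod R {b. fst b \<in> \<Gamma> \<and> deg (fst b) = m + of_bool (snd b)}),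
     diff = (\<lambda>m \<phi> b. if snd b then \<phi> (fst b, False) else \<zero>\<^bsub>R\<^esub>)\<rparr>"

text \<open>Universal property of disk complexes: a chain map out of \<open>free_cx\<close> amounts
  to a choice of elements \<open>y g\<close> in degree \<open>deg g\<close>, the value on
  \<open>(g, True)\<close> being forced to be the boundary of \<open>y g\<close>.\<close>

definition cx_ext :: "('r, 'z) ring_scheme \<Rightarrow> (('r, 'a) module, 'a \<Rightarrow> 'a) cplx \<Rightarrow> ('g \<Rightarrow> int) \<Rightarrow>
    ('g \<Rightarrow> 'a) \<Rightarrow> int \<Rightarrow> ('g \<times> bool \<Rightarrow> 'r) \<Rightarrow> 'a" where
  "cx_ext R Y deg y m = lin_ext R (obj Y m)
     (\<lambda>b. if snd b then diff Y (deg (fst b)) (y (fst b)) else y (fst b))"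

lemma free_cx_obj [simp]: "obj (free_cx R \<Gamma> deg) m = free_mod R {b. fst b \<in> \<Gamma> \<and> deg (fst b) = m + of_bool (snd b)}"
  and free_cx_diff [simp]: "diff (free_cx R \<Gamma> deg) m \<phi> = (\<lambda>b. if snd b then \<phi> (fst b, False) else \<zero>\<^bsub>R\<^esub>)"
  by (simp_all add: free_cx_def)

lemma free_cx_mono: "\<Gamma> \<subseteq> \<Gamma>' \<Longrightarrow> \<phi> \<in> carrier (obj (free_cx R \<Gamma> deg) m) \<Longrightarrow> \<phi> \<in> carrier (obj (free_cx R \<Gamma>' deg) m)"
  by (auto simp: free_mod_carrier)

lemma free_cx_restrict: "\<phi> \<in> carrier (obj (free_cx R \<Gamma> deg) m) \<Longrightarrow> (\<And>b. \<phi> b \<noteq> \<zero>\<^bsub>R\<^esub> \<Longrightarrow> fst b \<in> \<Gamma>') \<Longrightarrow>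
    \<phi> \<in> carrier (obj (free_cx R \<Gamma>' deg) m)"
  by (auto simp: free_mod_carrier)

lemma cmap_free_cx_mono: "\<Gamma> \<subseteq> \<Gamma>' \<Longrightarrow> cmap R (free_cx R \<Gamma> deg) (free_cx R \<Gamma>' deg) (\<lambda>m x. x)"
  unfolding cmap_def lhom_def free_cx_diff using free_cx_mono[of \<Gamma> \<Gamma>' _ R deg] by auto

context ring
begin

lemma free_cx_cx:
  fixes \<Gamma> :: "'g set"
  shows "cx R (free_cx R \<Gamma> deg)"
proof -
  have "finite {b. (snd b \<longrightarrow> \<phi> (fst b, False) \<noteq> \<zero>) \<and> snd b}" if "finite {b. \<phi> b \<noteq> \<zero>}" for \<phi> :: "'g \<times> bool \<Rightarrow> 'a"
  proof (rule finite_subset[OF _ finite_imageI[OF that, of "\<lambda>b. (fst b, True)"]], rule subsetI)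
    fix b assume "b \<in> {b. (snd b \<longrightarrow> \<phi> (fst b, False) \<noteq> \<zero>) \<and> snd b}"
    then show "b \<in> (\<lambda>b. (fst b, True)) ` {b. \<phi> b \<noteq> \<zero>}"
      by (intro image_eqI[of _ _ "(fst b, False)"]) (auto simp: prod_eq_iff split: if_splits)
  qed
  then show ?thesis
    by (auto simp: cx_def left_module_free_mod lhom_def free_mod_carrier fun_eq_iff)
qed

lemma unit_vec_free_cx: "g \<in> \<Gamma> \<Longrightarrow> unit_vec R (g, False) \<in> carrier (obj (free_cx R \<Gamma> deg) (deg g))"
  by (auto intro: unit_vec_closed)

lemma cx_ext_cmap:
  assumes "cx R Y" "\<And>g. g \<in> \<Gamma> \<Longrightarrow> y g \<in> carrier (obj Y (deg g))"
  shows "cmap R (free_cx R \<Gamma> deg) Y (cx_ext R Y deg y)"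
proof -
  let ?v = "\<lambda>b. if snd b then diff Y (deg (fst b)) (y (fst b)) else y (fst b)"
  let ?S = "\<lambda>m. {b. fst b \<in> \<Gamma> \<and> deg (fst b) = m + of_bool (snd b)}"
  have v: "?v \<in> ?S m \<rightarrow> carrier (obj Y m)" for m
    using assms cx_closed[OF assms(1)] by (auto split: if_splits) (metis add_diff_cancel_right')
  have l: "lhom R (obj (free_cx R \<Gamma> deg) m) (obj Y m) (cx_ext R Y deg y m)" for m
    unfolding cx_ext_def free_cx_obj by (rule lhom_lin_ext[OF cx_module[OF assms(1)] v])
  have "cx_ext R Y deg y (m - 1) (diff (free_cx R \<Gamma> deg) m \<phi>) = diff Y m (cx_ext R Y deg y m \<phi>)"
    if \<phi>: "\<phi> \<in> carrier (obj (free_cx R \<Gamma> deg) m)" for m \<phi>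
  proof (rule lhom_free_mod_eqI[OF cx_module[OF assms(1)] _ _ _ \<phi>[unfolded free_cx_obj]])
    show "lhom R (free_mod R (?S m)) (obj Y (m - 1)) (\<lambda>\<phi>. cx_ext R Y deg y (m - 1) (diff (free_cx R \<Gamma> deg) m \<phi>))"
      using lhom_comp[OF cx_lhom[OF free_cx_cx] l] by simp
    show "lhom R (free_mod R (?S m)) (obj Y (m - 1)) (\<lambda>\<phi>. diff Y m (cx_ext R Y deg y m \<phi>))"
      using lhom_comp[OF l cx_lhom[OF assms(1)]] by simp
    fix b assume b: "b \<in> ?S m"
    then have vb: "?v b \<in> carrier (obj Y m)" using v by blast
    have e: "cx_ext R Y deg y m (unit_vec R b) = ?v b"
      unfolding cx_ext_def by (rule lin_ext_unit_vec[where v = ?v, OF cx_module[OF assms(1)] vb])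
    show "cx_ext R Y deg y (m - 1) (diff (free_cx R \<Gamma> deg) m (unit_vec R b)) = diff Y m (cx_ext R Y deg y m (unit_vec R b))"
    proof (cases "snd b")
      case True
      then have d: "deg (fst b) - 1 = m" "fst b \<in> \<Gamma>" using b by auto
      have "diff (free_cx R \<Gamma> deg) m (unit_vec R b) = \<zero>\<^bsub>obj (free_cx R \<Gamma> deg) (m - 1)\<^esub>"
        using True by (auto simp: unit_vec_def fun_eq_iff)
      moreover have "diff Y m (diff Y (deg (fst b)) (y (fst b))) = \<zero>\<^bsub>obj Y (m - 1)\<^esub>"
        using cx_diff2[OF assms(1) assms(2)[OF d(2)]] d(1) by (auto simp: algebra_simps)
      ultimately show ?thesis
        using True e lhom_zero[OF cx_module[OF free_cx_cx] cx_module[OF assms(1)] l] by metis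
    next
      case False
      then have d: "deg (fst b) = m" "fst b \<in> \<Gamma>" using b by auto
      have "diff (free_cx R \<Gamma> deg) m (unit_vec R b) = unit_vec R (fst b, True)"
        using False by (auto simp: unit_vec_def fun_eq_iff) (metis prod.collapse)+
      moreover have "cx_ext R Y deg y (m - 1) (unit_vec R (fst b, True)) = diff Y m (y (fst b))"
        unfolding cx_ext_def using d assms(2)[OF d(2)]
        by (subst lin_ext_unit_vec) (use cx_closed[OF assms(1)] in \<open>auto intro: cx_module[OF assms(1)]\<close>)
      ultimately show ?thesis
        using False e by simp
    qed
  qed
  then show ?thesis using l by (auto simp: cmap_def)
qed

lemma cx_ext_gen: "cx R Y \<Longrightarrow> y g \<in> carrier (obj Y (deg g)) \<Longrightarrow> cx_ext R Y deg y (deg g) (unit_vec R (g, False)) = y g"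
  unfolding cx_ext_def by (subst lin_ext_unit_vec) (auto intro: cx_module)

text \<open>Chain maps commute with differentials, so agreement on \<open>(g, False)\<close> forces
  agreement on its boundary \<open>(g, True)\<close>. Later identities between chain maps are
  reduced to generators in this way.\<close>

lemma cmap_free_cx_eqI:
  assumes "cx R Y" "cmap R (free_cx R \<Gamma> deg) Y f" "cmap R (free_cx R \<Gamma> deg) Y f'"
    and "\<And>g. g \<in> \<Gamma> \<Longrightarrow> f (deg g) (unit_vec R (g, False)) = f' (deg g) (unit_vec R (g, False))"
    and "\<phi> \<in> carrier (obj (free_cx R \<Gamma> deg) m)"
  shows "f m \<phi> = f' m \<phi>"
proof (rule lhom_free_mod_eqI[OF cx_module[OF assms(1)] _ _ _ assms(5)[unfolded free_cx_obj]])
  show "lhom R (free_mod R {b. fst b \<in> \<Gamma> \<and> deg (fst b) = m + of_bool (snd b)}) (obj Y m) (f m)"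
    "lhom R (free_mod R {b. fst b \<in> \<Gamma> \<and> deg (fst b) = m + of_bool (snd b)}) (obj Y m) (f' m)"
    using cmap_lhom[OF assms(2), of m] cmap_lhom[OF assms(3), of m] by auto
  fix b assume "b \<in> {b. fst b \<in> \<Gamma> \<and> deg (fst b) = m + of_bool (snd b)}"
  then have b: "fst b \<in> \<Gamma>" "deg (fst b) = m + of_bool (snd b)" by auto
  show "f m (unit_vec R b) = f' m (unit_vec R b)"
  proof (cases "snd b")
    case False
    then have "b = (fst b, False)" "m = deg (fst b)" using b by (auto simp: prod_eq_iff)
    then show ?thesis using assms(4)[OF b(1)] by metis
  next
    case True
    then have m: "b = (fst b, True)" "m = deg (fst b) - 1" using b by (auto simp: prod_eq_iff)
    have "diff (free_cx R \<Gamma> deg) (deg (fst b)) (unit_vec R (fst b, False)) = unit_vec R (fst b, True)"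
      by (auto simp: unit_vec_def fun_eq_iff)
    then show ?thesis
      using cmap_diff[OF assms(2) unit_vec_free_cx[OF b(1)]] cmap_diff[OF assms(3) unit_vec_free_cx[OF b(1)]]
        assms(4)[OF b(1)] m by metis
  qed
qed

text \<open>Both sides are chain maps out of a free complex with equal values on generators. This
  moves extensions past differentials, inclusions and renamings of generators.\<close>

lemma cmap_cx_ext:
  assumes "cx R Y" "cx R Z" "cmap R Y Z f" "\<And>g. g \<in> \<Gamma> \<Longrightarrow> y g \<in> carrier (obj Y (deg g))"
    and "\<phi> \<in> carrier (obj (free_cx R \<Gamma> deg) m)"
  shows "f m (cx_ext R Y deg y m \<phi>) = cx_ext R Z deg (\<lambda>g. f (deg g) (y g)) m \<phi>"
proof (rule cmap_free_cx_eqI[OF assms(2) _ _ _ assms(5)])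
  have *: "f (deg g) (y g) \<in> carrier (obj Z (deg g))" if "g \<in> \<Gamma>" for g
    using cmap_closed[OF assms(3) assms(4)[OF that]] .
  show "cmap R (free_cx R \<Gamma> deg) Z (\<lambda>m \<phi>. f m (cx_ext R Y deg y m \<phi>))"
    by (rule cmap_comp[OF cx_ext_cmap assms(3)]) (use assms in auto)
  show "cmap R (free_cx R \<Gamma> deg) Z (cx_ext R Z deg (\<lambda>g. f (deg g) (y g)))"
    by (rule cx_ext_cmap[OF assms(2) *])
  show "f (deg g) (cx_ext R Y deg y (deg g) (unit_vec R (g, False))) =
      cx_ext R Z deg (\<lambda>g. f (deg g) (y g)) (deg g) (unit_vec R (g, False))" if "g \<in> \<Gamma>" for g
    using cx_ext_gen[where y = y and deg = deg and g = g, OF assms(1) assms(4)[OF that]]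
      cx_ext_gen[where y = "\<lambda>g. f (deg g) (y g)" and deg = deg and g = g, OF assms(2) *[OF that]]
    by simp
qed

lemma cx_ext_cong:
  assumes "cx R Y" "\<And>g. g \<in> \<Gamma> \<Longrightarrow> y g \<in> carrier (obj Y (deg g))" "\<And>g. g \<in> \<Gamma> \<Longrightarrow> y g = y' g"
    "\<phi> \<in> carrier (obj (free_cx R \<Gamma> deg) m)"
  shows "cx_ext R Y deg y m \<phi> = cx_ext R Y deg y' m \<phi>"
proof (rule cmap_free_cx_eqI[OF assms(1) _ _ _ assms(4)])
  show "cmap R (free_cx R \<Gamma> deg) Y (cx_ext R Y deg y)" "cmap R (free_cx R \<Gamma> deg) Y (cx_ext R Y deg y')"
    using assms by (auto intro!: cx_ext_cmap)
  show "cx_ext R Y deg y (deg g) (unit_vec R (g, False)) = cx_ext R Y deg y' (deg g) (unit_vec R (g, False))"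
    if "g \<in> \<Gamma>" for g
    using that assms by (simp add: cx_ext_gen)
qed

end

subsection \<open>Transport along an injection\<close>

text \<open>Objects of \<open>module_cat\<close> have carriers in \<open>'u\<close>, so constructed
  complexes are copied there along an injection; restricting the differential to the image makes it
  extensional, as the Hom sets demand.\<close>

definition image_cx :: "('a \<Rightarrow> 'b) \<Rightarrow> (('r, 'a) module, 'a \<Rightarrow> 'a) cplx \<Rightarrow> (('r, 'b) module, 'b \<Rightarrow> 'b) cplx" where
  "image_cx e Y = \<lparr>obj = (\<lambda>m. image_mod e (obj Y m)),
     diff = (\<lambda>m. \<lambda>z\<in>e ` carrier (obj Y m). e (diff Y m (inv_into (carrier (obj Y m)) e z)))\<rparr>"

definition image_cx_inv :: "('a \<Rightarrow> 'b) \<Rightarrow> (('r, 'a) module, 'a \<Rightarrow> 'a) cplx \<Rightarrow> int \<Rightarrow> 'b \<Rightarrow> 'a" where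
  "image_cx_inv e Y m = inv_into (carrier (obj Y m)) e"

lemma image_cx_carrier [simp]: "carrier (obj (image_cx e Y) m) = e ` carrier (obj Y m)"
  by (simp add: image_cx_def)

lemma image_cx_ext: "diff (image_cx e Y) m \<in> extensional (carrier (obj (image_cx e Y) m))"
  by (simp add: image_cx_def)

lemma image_cx_props:
  assumes "cx R Y" "\<And>m. inj_on e (carrier (obj Y m))"
  shows "cx R (image_cx e Y)" "cmap R Y (image_cx e Y) (\<lambda>m. e)" "cmap R (image_cx e Y) Y (image_cx_inv e Y)"
proof -
  note M = image_mod_inj[OF cx_module[OF assms(1)] assms(2)]
  have i: "inv_into (carrier (obj Y m)) e (e x) = x" if "x \<in> carrier (obj Y m)" for m x
    using assms(2) that by auto
  have d: "diff (image_cx e Y) m (e x) = e (diff Y m x)" if "x \<in> carrier (obj Y m)" for m x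
    using that by (simp add: image_cx_def i)
  have z: "\<zero>\<^bsub>obj (image_cx e Y) m\<^esub> = e \<zero>\<^bsub>obj Y m\<^esub>" for m
    by (simp add: image_cx_def image_mod_def Let_def)
  have l: "lhom R (obj (image_cx e Y) m) (obj (image_cx e Y) (m - 1)) (diff (image_cx e Y) m)" for m
    unfolding image_cx_def cplx.simps
    by (rule lhom_cong[OF _ M(1) lhom_comp[OF lhom_comp[OF M(3) cx_lhom[OF assms(1)]] M(2)]]) simp
  have mo: "left_module R (obj (image_cx e Y) m)" for m
    using M(1) by (simp add: image_cx_def)
  show "cx R (image_cx e Y)"
    unfolding cx_def using mo l by (auto simp: d z cx_closed[OF assms(1)] cx_diff2[OF assms(1)])
  show "cmap R Y (image_cx e Y) (\<lambda>m. e)"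
    unfolding cmap_def using M(2) by (auto simp: d) (simp add: image_cx_def)
  show "cmap R (image_cx e Y) Y (image_cx_inv e Y)"
    unfolding cmap_def image_cx_inv_def using M(3) by (auto simp: d i cx_closed[OF assms(1)]) (simp add: image_cx_def)
qed

lemma image_cx_inv [simp]:
  assumes "\<And>m. inj_on e (carrier (obj Y m))" "x \<in> carrier (obj Y m)"
  shows "image_cx_inv e Y m (e x) = x"
  using assms by (auto simp: image_cx_inv_def)

lemma image_cx_inv' [simp]:
  assumes "z \<in> e ` carrier (obj Y m)"
  shows "e (image_cx_inv e Y m z) = z"
  using assms by (auto simp: image_cx_inv_def f_inv_into_f)

text \<open>\<open>dgen\<close> is written with pointwise negatives in the ring; this identifies
  them with the negative in the free module.\<close>

lemma (in ring) free_mod_uminus: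
  assumes "\<phi> \<in> carrier (free_mod R S)"
  shows "\<ominus>\<^bsub>free_mod R S\<^esub> \<phi> = (\<lambda>b. \<ominus> \<phi> b)"
proof -
  interpret F: left_module R "free_mod R S" by (rule left_module_free_mod)
  have "{b. \<ominus> \<phi> b \<noteq> \<zero>} = {b. \<phi> b \<noteq> \<zero>}"
    using assms by (auto simp: free_mod_carrier)
  then have "(\<lambda>b. \<ominus> \<phi> b) \<in> carrier (free_mod R S)"
    using assms by (auto simp: free_mod_carrier)
  moreover have "(\<lambda>b. \<ominus> \<phi> b) \<oplus>\<^bsub>free_mod R S\<^esub> \<phi> = \<zero>\<^bsub>free_mod R S\<^esub>"
    using assms by (auto simp: free_mod_carrier l_neg)
  ultimately show ?thesis
    using F.M.minus_equality assms by blast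
qed

section \<open>The generators of the approximating complex\<close>

text \<open>
  In \<open>Node a dg u c k ch\<close>, the functions \<open>a\<close> and \<open>dg\<close> describe a complex \<open>F\<close> of free objects of
  \<open>C(R)\<close> on generators \<open>e\<^sub>0, e\<^sub>1, \<dots>\<close>: the generator \<open>e\<^sub>j\<close> has bidegree \<open>dg j\<close> and is sent to \<open>a j\<close> by
  the differential. The remaining data describe a chain map from \<open>F\<close> to the cone of \<open>P \<rightarrow> X\<close> (up to
  signs): its component in \<open>X\<close> is \<open>u\<close>, and its component in \<open>P\<close> sends \<open>e\<^sub>j\<close> to the element
  \<open>lead R c ch j\<close> with coefficients \<open>c j\<close> on the earlier generators enumerated by \<open>ch\<close>. The node
  itself is the image of \<open>e\<^sub>k\<close> under the freely adjoined null homotopy. In a pair \<open>(g, b)\<close> the flag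
  \<open>b\<close> selects between \<open>g\<close> and its boundary, as in \<open>free_cx\<close>.
\<close>

datatype ('r, 'u) gen = Leaf
  | Node "nat \<Rightarrow> nat \<times> bool \<Rightarrow> 'r" "nat \<Rightarrow> int \<times> int" "nat \<Rightarrow> 'u" "nat \<Rightarrow> nat \<times> bool \<Rightarrow> 'r" nat
      "nat \<Rightarrow> ('r, 'u) gen"

primrec odeg :: "('r, 'u) gen \<Rightarrow> int" where
  "odeg Leaf = 0" | "odeg (Node a dg u c k ch) = fst (dg k)"

primrec ideg :: "('r, 'u) gen \<Rightarrow> int" where
  "ideg Leaf = 0" | "ideg (Node a dg u c k ch) = snd (dg k)"

primrec gval :: "('r, 'u) gen \<Rightarrow> 'u" where
  "gval Leaf = undefined" | "gval (Node a dg u c k ch) = u k"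

text \<open>The enumeration \<open>ch\<close> may repeat trees. The coefficient at a tree is read at
  one chosen index and not summed over all of them, so the formula makes sense for every
  \<open>ch\<close>.\<close>

definition lead :: "('r, 'z) ring_scheme \<Rightarrow> (nat \<Rightarrow> nat \<times> bool \<Rightarrow> 'r) \<Rightarrow> (nat \<Rightarrow> ('r, 'u) gen) \<Rightarrow>
    nat \<Rightarrow> ('r, 'u) gen \<times> bool \<Rightarrow> 'r" where
  "lead R c ch k = (\<lambda>b. if fst b \<in> range ch then c k (inv_into UNIV ch (fst b), snd b) else \<zero>\<^bsub>R\<^esub>)"

text \<open>Generators are bigraded: \<open>od\<close> is the degree in the outer complex,
  \<open>deg\<close> the degree inside an object of \<open>C(R)\<close>. The object in outer degree
  \<open>n\<close> is the sum of disks on the generators with \<open>od g = n\<close>.\<close>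

abbreviation fdc :: "('r, 'z) ring_scheme \<Rightarrow> 'g set \<Rightarrow> ('g \<Rightarrow> int) \<Rightarrow> ('g \<Rightarrow> int) \<Rightarrow> int \<Rightarrow>
    (('r, 'g \<times> bool \<Rightarrow> 'r) module, ('g \<times> bool \<Rightarrow> 'r) \<Rightarrow> 'g \<times> bool \<Rightarrow> 'r) cplx" where
  "fdc R \<Gamma> od deg n \<equiv> free_cx R {g \<in> \<Gamma>. od g = n} deg"

text \<open>This solves \<open>h = d T + T D\<close> for \<open>d (T e)\<close> at the generator
  with index \<open>k\<close>, where \<open>T\<close> sends the generator with index
  \<open>j\<close> to the node with the same data and index \<open>j\<close>. These siblings occur
  only as constructor terms, so there is no recursive call. The ambient complex has all trees except
  \<open>Leaf\<close> as generators because validity, which cuts out \<open>P\<close>, is itself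
  defined through \<open>dgen\<close>.\<close>

primrec dgen :: "('r, 'z) ring_scheme \<Rightarrow> ('r, 'u) gen \<Rightarrow> ('r, 'u) gen \<times> bool \<Rightarrow> 'r" where
  "dgen R Leaf = undefined"
| "dgen R (Node a dg u c k ch) = (\<lambda>b. lead R c ch k b \<oplus>\<^bsub>R\<^esub> \<ominus>\<^bsub>R\<^esub>
     (cx_ext R (fdc R (- {Leaf}) odeg ideg (fst (dg k) - 1)) (\<lambda>j. snd (dg j))
       (\<lambda>j. unit_vec R (Node a dg u c j ch, False)) (snd (dg k)) (a k) b))"

section \<open>The complex of projectives and its map to X\<close>

locale dcx = ring R for R :: "('r, 'z) ring_scheme" (structure) +
  fixes X :: "int \<Rightarrow> (('r, 'u) module, 'u \<Rightarrow> 'u) cplx" and dX :: "int \<Rightarrow> int \<Rightarrow> 'u \<Rightarrow> 'u"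
  assumes X_cx: "cx R (X n)"
    and dX_cmap: "cmap R (X n) (X (n - 1)) (dX n)"
begin

abbreviation FN :: "(nat \<Rightarrow> int \<times> int) \<Rightarrow> int \<Rightarrow>
    (('r, nat \<times> bool \<Rightarrow> 'r) module, (nat \<times> bool \<Rightarrow> 'r) \<Rightarrow> nat \<times> bool \<Rightarrow> 'r) cplx" where
  "FN dg \<equiv> fdc R UNIV (\<lambda>j. fst (dg j)) (\<lambda>j. snd (dg j))"

text \<open>The three equations say, in order, that \<open>D D = 0\<close>, that \<open>h\<close>
  commutes with the differentials, and that \<open>u\<close> is a null homotopy of
  \<open>p h\<close>. They live in the complex on all trees but \<open>Leaf\<close>, since
  \<open>P\<close> does not exist yet; membership of \<open>lead R c ch k\<close> there rules out
  nonzero coefficients at \<open>Leaf\<close>. Bounding every \<open>c k b\<close>, including values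
  that \<open>lead\<close> does not read, keeps the set of possible labels small in
  \<open>small_PC\<close>.\<close>

definition good :: "(nat \<Rightarrow> nat \<times> bool \<Rightarrow> 'r) \<Rightarrow> (nat \<Rightarrow> int \<times> int) \<Rightarrow> (nat \<Rightarrow> 'u) \<Rightarrow>
    (nat \<Rightarrow> nat \<times> bool \<Rightarrow> 'r) \<Rightarrow> (nat \<Rightarrow> ('r, 'u) gen) \<Rightarrow> bool" where
  "good a dg u c ch \<longleftrightarrow> (\<forall>k n m. dg k = (n, m) \<longrightarrow>
     a k \<in> carrier (obj (FN dg (n - 1)) m) \<and>
     u k \<in> carrier (obj (X n) m) \<and>
     (\<forall>b. c k b \<in> carrier R) \<and>
     lead R c ch k \<in> carrier (obj (fdc R (- {Leaf}) odeg ideg (n - 1)) m) \<and>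
     cx_ext R (FN dg (n - 2)) (\<lambda>j. snd (dg j)) a m (a k) = (\<lambda>b. \<zero>) \<and>
     cx_ext R (fdc R (- {Leaf}) odeg ideg (n - 2)) ideg (dgen R) m (lead R c ch k) =
       cx_ext R (fdc R (- {Leaf}) odeg ideg (n - 2)) (\<lambda>j. snd (dg j)) (lead R c ch) m (a k) \<and>
     cx_ext R (X (n - 1)) ideg gval m (lead R c ch k) =
       dX n m (u k) \<oplus>\<^bsub>obj (X (n - 1)) m\<^esub> cx_ext R (X (n - 1)) (\<lambda>j. snd (dg j)) u m (a k))"

lemma goodD:
  assumes "good a dg u c ch" "dg k = (n, m)"
  shows "a k \<in> carrier (obj (FN dg (n - 1)) m)"
    and "u k \<in> carrier (obj (X n) m)"
    and "lead R c ch k \<in> carrier (obj (fdc R (- {Leaf}) odeg ideg (n - 1)) m)"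
    and "cx_ext R (FN dg (n - 2)) (\<lambda>j. snd (dg j)) a m (a k) = (\<lambda>b. \<zero>)"
    and "cx_ext R (fdc R (- {Leaf}) odeg ideg (n - 2)) ideg (dgen R) m (lead R c ch k) =
       cx_ext R (fdc R (- {Leaf}) odeg ideg (n - 2)) (\<lambda>j. snd (dg j)) (lead R c ch) m (a k)"
    and "cx_ext R (X (n - 1)) ideg gval m (lead R c ch k) =
       dX n m (u k) \<oplus>\<^bsub>obj (X (n - 1)) m\<^esub> cx_ext R (X (n - 1)) (\<lambda>j. snd (dg j)) u m (a k)"
  using assms(1)[unfolded good_def, THEN spec, THEN spec, THEN spec, THEN mp, OF assms(2)]
  by blast+

text \<open>\<open>good\<close> checks a single node, so only the children enter the recursion.
  \<open>Leaf\<close> counts as valid so that it may serve as filler in \<open>ch\<close>, but it is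
  excluded from the generators of \<open>PC\<close>.\<close>

primrec valid :: "('r, 'u) gen \<Rightarrow> bool" where
  "valid Leaf \<longleftrightarrow> True"
| "valid (Node a dg u c k ch) \<longleftrightarrow> good a dg u c ch \<and> (\<forall>i. valid (ch i))"

definition PC :: "int \<Rightarrow> (('r, ('r, 'u) gen \<times> bool \<Rightarrow> 'r) module,
    (('r, 'u) gen \<times> bool \<Rightarrow> 'r) \<Rightarrow> ('r, 'u) gen \<times> bool \<Rightarrow> 'r) cplx" where
  "PC n = fdc R {g. valid g \<and> g \<noteq> Leaf} odeg ideg n"

definition dP :: "int \<Rightarrow> int \<Rightarrow> (('r, 'u) gen \<times> bool \<Rightarrow> 'r) \<Rightarrow> ('r, 'u) gen \<times> bool \<Rightarrow> 'r" where
  "dP n = cx_ext R (PC (n - 1)) ideg (dgen R)"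

definition pP :: "int \<Rightarrow> int \<Rightarrow> (('r, 'u) gen \<times> bool \<Rightarrow> 'r) \<Rightarrow> 'u" where
  "pP n = cx_ext R (X n) ideg gval"

lemma PC_cx: "cx R (PC n)"
  unfolding PC_def by (rule free_cx_cx)

lemma PC_zero: "\<zero>\<^bsub>obj (PC n) m\<^esub> = (\<lambda>b. \<zero>)"
  by (simp add: PC_def)

lemma PC_incl: "cmap R (PC n) (fdc R (- {Leaf}) odeg ideg n) (\<lambda>m x. x)"
  unfolding PC_def by (rule cmap_free_cx_mono) auto

text \<open>Transfers the equations of \<open>good\<close> and \<open>dgen\<close> from the
  provisional ambient complex to \<open>P\<close>, by naturality along the inclusion, which is the
  identity on elements.\<close>

lemma cx_ext_PC:
  assumes "\<And>g. g \<in> \<Gamma> \<Longrightarrow> y g \<in> carrier (obj (PC n) (deg g))" "\<phi> \<in> carrier (obj (free_cx R \<Gamma> deg) m)"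
  shows "cx_ext R (fdc R (- {Leaf}) odeg ideg n) deg y m \<phi> = cx_ext R (PC n) deg y m \<phi>"
  using cmap_cx_ext[OF PC_cx free_cx_cx PC_incl assms] by simp

context
  fixes a dg u c ch
  assumes good: "good a dg u c ch" and valid: "\<And>i. valid (ch i)"
begin

lemma good_a: "a k \<in> carrier (obj (FN dg (fst (dg k) - 1)) (snd (dg k)))"
  and good_u: "u k \<in> carrier (obj (X (fst (dg k))) (snd (dg k)))"
  by (rule goodD[OF good], simp)+

text \<open>The support lies in \<open>range ch\<close>, whose members are valid, and by
  \<open>good\<close> it avoids \<open>Leaf\<close> and has the right degrees.\<close>

lemma lead_PC: "lead R c ch k \<in> carrier (obj (PC (fst (dg k) - 1)) (snd (dg k)))"
proof -
  have l: "lead R c ch k \<in> carrier (obj (fdc R (- {Leaf}) odeg ideg (fst (dg k) - 1)) (snd (dg k)))"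
    by (rule goodD[OF good], simp)
  show ?thesis
    unfolding PC_def
  proof (rule free_cx_restrict[OF l])
    fix b assume b: "lead R c ch k b \<noteq> \<zero>"
    then have "fst b \<in> range ch" by (auto simp: lead_def split: if_splits)
    moreover have "fst b \<in> {g \<in> - {Leaf}. odeg g = fst (dg k) - 1}"
      using l b unfolding free_cx_obj free_mod_carrier by blast
    ultimately show "fst b \<in> {g \<in> {g. valid g \<and> g \<noteq> Leaf}. odeg g = fst (dg k) - 1}"
      using valid by auto
  qed
qed

lemma unit_vec_node: "fst (dg j) = n \<Longrightarrow> unit_vec R (Node a dg u c j ch, False) \<in> carrier (obj (PC n) (snd (dg j)))"
  unfolding PC_def using unit_vec_free_cx[of "Node a dg u c j ch" "{g \<in> {g. valid g \<and> g \<noteq> Leaf}. odeg g = n}" ideg]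
    good valid by auto

lemma cx_ext_node_cmap: "cmap R (FN dg n) (PC n) (cx_ext R (PC n) (\<lambda>j. snd (dg j)) (\<lambda>j. unit_vec R (Node a dg u c j ch, False)))"
  by (rule cx_ext_cmap[OF PC_cx]) (auto intro: unit_vec_node)

lemma dgen_node:
  "dgen R (Node a dg u c k ch) = lead R c ch k \<oplus>\<^bsub>obj (PC (fst (dg k) - 1)) (snd (dg k))\<^esub>
    \<ominus>\<^bsub>obj (PC (fst (dg k) - 1)) (snd (dg k))\<^esub>
      cx_ext R (PC (fst (dg k) - 1)) (\<lambda>j. snd (dg j)) (\<lambda>j. unit_vec R (Node a dg u c j ch, False)) (snd (dg k)) (a k)"
proof -
  have "cx_ext R (fdc R (- {Leaf}) odeg ideg (fst (dg k) - 1)) (\<lambda>j. snd (dg j)) (\<lambda>j. unit_vec R (Node a dg u c j ch, False)) (snd (dg k)) (a k)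
    = cx_ext R (PC (fst (dg k) - 1)) (\<lambda>j. snd (dg j)) (\<lambda>j. unit_vec R (Node a dg u c j ch, False)) (snd (dg k)) (a k)"
    by (rule cx_ext_PC[OF _ good_a]) (auto intro: unit_vec_node)
  then show ?thesis
    using cmap_closed[OF cx_ext_node_cmap good_a] by (simp add: PC_def free_mod_uminus)
qed

lemma dgen_node_closed: "dgen R (Node a dg u c k ch) \<in> carrier (obj (PC (fst (dg k) - 1)) (snd (dg k)))"
proof -
  interpret M: left_module R "obj (PC (fst (dg k) - 1)) (snd (dg k))" by (rule cx_module[OF PC_cx])
  show ?thesis
    unfolding dgen_node by (intro M.M.a_closed M.M.a_inv_closed lead_PC cmap_closed[OF cx_ext_node_cmap good_a])
qed

end

lemma dgen_closed: "valid g \<Longrightarrow> g \<noteq> Leaf \<Longrightarrow> dgen R g \<in> carrier (obj (PC (odeg g - 1)) (ideg g))"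
  by (cases g) (use dgen_node_closed in auto)

lemma gval_closed: "valid g \<Longrightarrow> g \<noteq> Leaf \<Longrightarrow> gval g \<in> carrier (obj (X (odeg g)) (ideg g))"
  by (cases g) (use good_u in auto)

lemma dP_cmap: "cmap R (PC n) (PC (n - 1)) (dP n)"
  unfolding dP_def PC_def[of n] by (rule cx_ext_cmap[OF PC_cx]) (use dgen_closed in auto)

lemma pP_cmap: "cmap R (PC n) (X n) (pP n)"
  unfolding pP_def PC_def by (rule cx_ext_cmap[OF X_cx]) (use gval_closed in auto)

lemma unit_vec_PC: "valid g \<Longrightarrow> g \<noteq> Leaf \<Longrightarrow> unit_vec R (g, False) \<in> carrier (obj (PC (odeg g)) (ideg g))"
  unfolding PC_def by (rule unit_vec_free_cx) auto

lemma dP_unit_vec: "valid g \<Longrightarrow> g \<noteq> Leaf \<Longrightarrow> dP (odeg g) (ideg g) (unit_vec R (g, False)) = dgen R g"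
  unfolding dP_def by (intro cx_ext_gen PC_cx dgen_closed)

lemma pP_unit_vec: "valid g \<Longrightarrow> g \<noteq> Leaf \<Longrightarrow> pP (odeg g) (ideg g) (unit_vec R (g, False)) = gval g"
  unfolding pP_def by (intro cx_ext_gen X_cx gval_closed)

context
  fixes a dg u c ch
  assumes good: "good a dg u c ch" and valid: "\<And>i. valid (ch i)"
begin

text \<open>With \<open>d T = h - T D\<close> one computes
  \<open>d (h - T D) = h D - (h - T D) D = T D D = 0\<close>. Here \<open>?N\<close> is
  \<open>T\<close> and the extension of \<open>lead R c ch\<close> is \<open>h\<close>.\<close>

lemma dP_dgen_node:
  "dP (fst (dg k) - 1) (snd (dg k)) (dgen R (Node a dg u c k ch)) = (\<lambda>b. \<zero>)"
proof -
  define n m where nm: "n = fst (dg k)" "m = snd (dg k)"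
  interpret M: left_module R "obj (PC (n - 1)) m" by (rule cx_module[OF PC_cx])
  interpret M2: left_module R "obj (PC (n - 2)) m" by (rule cx_module[OF PC_cx])
  note ga = good_a[OF good valid, of k, folded nm]
  note lead = lead_PC[OF good valid] 
  let ?N = "\<lambda>n. cx_ext R (PC n) (\<lambda>j. snd (dg j)) (\<lambda>j. unit_vec R (Node a dg u c j ch, False))"
  note N = cx_ext_node_cmap[OF good valid]
  have d: "cmap R (PC (n - 1)) (PC (n - 2)) (dP (n - 1))" using dP_cmap[of "n - 1"] by simp
  have lead1: "lead R c ch j \<in> carrier (obj (PC (n - 2)) (snd (dg j)))" if "fst (dg j) = n - 1" for j
    using lead[of j] that by simp
  have a1: "a j \<in> carrier (obj (FN dg (n - 2)) (snd (dg j)))" if "fst (dg j) = n - 1" for j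
    using good_a[OF good valid, of j] that by simp
  have eA: "cmap R (FN dg (n - 1)) (FN dg (n - 2)) (cx_ext R (FN dg (n - 2)) (\<lambda>j. snd (dg j)) a)"
    by (rule cx_ext_cmap[OF free_cx_cx]) (use a1 in auto)
  have eL: "cmap R (FN dg (n - 1)) (PC (n - 2)) (cx_ext R (PC (n - 2)) (\<lambda>j. snd (dg j)) (lead R c ch))"
    by (rule cx_ext_cmap[OF PC_cx]) (use lead1 in auto)
  have h: "dP (n - 1) m (lead R c ch k) = cx_ext R (PC (n - 2)) (\<lambda>j. snd (dg j)) (lead R c ch) m (a k)"
  proof -
    have "cx_ext R (fdc R (- {Leaf}) odeg ideg (n - 2)) ideg (dgen R) m (lead R c ch k) =
       cx_ext R (fdc R (- {Leaf}) odeg ideg (n - 2)) (\<lambda>j. snd (dg j)) (lead R c ch) m (a k)"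
      by (rule goodD[OF good]) (simp add: nm)
    moreover have "cx_ext R (fdc R (- {Leaf}) odeg ideg (n - 2)) ideg (dgen R) m (lead R c ch k) =
        cx_ext R (PC (n - 2)) ideg (dgen R) m (lead R c ch k)"
      by (rule cx_ext_PC[OF _ lead[of k, folded nm, unfolded PC_def]])
        (use dgen_closed in \<open>auto simp: algebra_simps\<close>)
    moreover have "cx_ext R (fdc R (- {Leaf}) odeg ideg (n - 2)) (\<lambda>j. snd (dg j)) (lead R c ch) m (a k) =
        cx_ext R (PC (n - 2)) (\<lambda>j. snd (dg j)) (lead R c ch) m (a k)"
      by (rule cx_ext_PC[OF _ ga]) (use lead1 in auto)
    ultimately show ?thesis by (simp add: dP_def)
  qed
  have "dP (n - 1) m (?N (n - 1) m (a k)) =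
      cx_ext R (PC (n - 2)) (\<lambda>j. snd (dg j)) (\<lambda>j. dP (n - 1) (snd (dg j)) (unit_vec R (Node a dg u c j ch, False))) m (a k)"
    by (rule cmap_cx_ext[OF PC_cx PC_cx d _ ga]) (auto intro: unit_vec_node[OF good valid])
  \<comment> \<open>The identity \<open>d T = h - T D\<close> of chain maps on the free object in
    outer degree \<open>n - 1\<close>; on generators it is the definition of
    \<open>dgen\<close>.\<close>
  also have "\<dots> = cx_ext R (PC (n - 2)) (\<lambda>j. snd (dg j)) (lead R c ch) m (a k) \<oplus>\<^bsub>obj (PC (n - 2)) m\<^esub>
      \<ominus>\<^bsub>obj (PC (n - 2)) m\<^esub> ?N (n - 2) m (cx_ext R (FN dg (n - 2)) (\<lambda>j. snd (dg j)) a m (a k))"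
  proof (rule cmap_free_cx_eqI[OF PC_cx _ _ _ ga])
    have *: "dP (n - 1) (snd (dg j)) (unit_vec R (Node a dg u c j ch, False)) = dgen R (Node a dg u c j ch)"
      "dgen R (Node a dg u c j ch) \<in> carrier (obj (PC (n - 2)) (snd (dg j)))" if "fst (dg j) = n - 1" for j
      using dP_unit_vec[of "Node a dg u c j ch"] dgen_closed[of "Node a dg u c j ch"] good valid that by auto
    show "cmap R (FN dg (n - 1)) (PC (n - 2))
        (cx_ext R (PC (n - 2)) (\<lambda>j. snd (dg j)) (\<lambda>j. dP (n - 1) (snd (dg j)) (unit_vec R (Node a dg u c j ch, False))))"
      by (rule cx_ext_cmap[OF PC_cx]) (use * in auto)
    show "cmap R (FN dg (n - 1)) (PC (n - 2)) (\<lambda>m x. cx_ext R (PC (n - 2)) (\<lambda>j. snd (dg j)) (lead R c ch) m x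
        \<oplus>\<^bsub>obj (PC (n - 2)) m\<^esub> \<ominus>\<^bsub>obj (PC (n - 2)) m\<^esub> ?N (n - 2) m (cx_ext R (FN dg (n - 2)) (\<lambda>j. snd (dg j)) a m x))"
      by (intro cmap_plus cmap_uminus PC_cx eL cmap_comp[OF eA N])
    fix j assume "j \<in> {g \<in> UNIV. fst (dg g) = n - 1}"
    then have j: "fst (dg j) = n - 1" by simp
    have "cx_ext R (PC (n - 2)) (\<lambda>j. snd (dg j)) (\<lambda>j. dP (n - 1) (snd (dg j)) (unit_vec R (Node a dg u c j ch, False))) (snd (dg j)) (unit_vec R (j, False)) = dgen R (Node a dg u c j ch)"
      using *[OF j] by (subst cx_ext_gen) (auto intro: PC_cx)
    also have "\<dots> = lead R c ch j \<oplus>\<^bsub>obj (PC (n - 2)) (snd (dg j))\<^esub> \<ominus>\<^bsub>obj (PC (n - 2)) (snd (dg j))\<^esub> ?N (n - 2) (snd (dg j)) (a j)"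
      using dgen_node[OF good valid, of j] j by simp
    also have "\<dots> = cx_ext R (PC (n - 2)) (\<lambda>j. snd (dg j)) (lead R c ch) (snd (dg j)) (unit_vec R (j, False)) \<oplus>\<^bsub>obj (PC (n - 2)) (snd (dg j))\<^esub>
        \<ominus>\<^bsub>obj (PC (n - 2)) (snd (dg j))\<^esub> ?N (n - 2) (snd (dg j)) (cx_ext R (FN dg (n - 2)) (\<lambda>j. snd (dg j)) a (snd (dg j)) (unit_vec R (j, False)))"
      using cx_ext_gen[where deg = "\<lambda>j. snd (dg j)" and g = j, of _ "lead R c ch", OF PC_cx lead1[OF j]]
        cx_ext_gen[where deg = "\<lambda>j. snd (dg j)" and g = j, of _ a, OF free_cx_cx a1[OF j]] by simp
    finally show "cx_ext R (PC (n - 2)) (\<lambda>j. snd (dg j)) (\<lambda>j. dP (n - 1) (snd (dg j)) (unit_vec R (Node a dg u c j ch, False))) (snd (dg j)) (unit_vec R (j, False))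
      = cx_ext R (PC (n - 2)) (\<lambda>j. snd (dg j)) (lead R c ch) (snd (dg j)) (unit_vec R (j, False)) \<oplus>\<^bsub>obj (PC (n - 2)) (snd (dg j))\<^esub>
        \<ominus>\<^bsub>obj (PC (n - 2)) (snd (dg j))\<^esub> ?N (n - 2) (snd (dg j)) (cx_ext R (FN dg (n - 2)) (\<lambda>j. snd (dg j)) a (snd (dg j)) (unit_vec R (j, False)))" .
  qed
  also have "cx_ext R (FN dg (n - 2)) (\<lambda>j. snd (dg j)) a m (a k) = \<zero>\<^bsub>obj (FN dg (n - 2)) m\<^esub>"
    unfolding free_cx_obj free_mod_simps by (rule goodD[OF good]) (simp add: nm)
  also have "?N (n - 2) m \<zero>\<^bsub>obj (FN dg (n - 2)) m\<^esub> = \<zero>\<^bsub>obj (PC (n - 2)) m\<^esub>"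
    by (rule cmap_zero[OF free_cx_cx PC_cx N])
  finally have e: "dP (n - 1) m (?N (n - 1) m (a k)) = cx_ext R (PC (n - 2)) (\<lambda>j. snd (dg j)) (lead R c ch) m (a k)"
    using cmap_closed[OF eL ga] by simp
  have "dP (n - 1) m (dgen R (Node a dg u c k ch)) = dP (n - 1) m (lead R c ch k) \<oplus>\<^bsub>obj (PC (n - 2)) m\<^esub>
      \<ominus>\<^bsub>obj (PC (n - 2)) m\<^esub> dP (n - 1) m (?N (n - 1) m (a k))"
    unfolding dgen_node[OF good valid, of k, folded nm]
    using lead[of k, folded nm] cmap_closed[OF N ga]
    by (simp add: cmap_add[OF d] cmap_minus[OF PC_cx PC_cx d])
  also have "\<dots> = \<zero>\<^bsub>obj (PC (n - 2)) m\<^esub>"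
    unfolding h e using cmap_closed[OF eL ga] by (simp add: M2.M.r_neg)
  finally show ?thesis by (simp add: nm PC_zero)
qed

text \<open>Since \<open>p T = u\<close> on generators,
  \<open>p (h - T D) = (d u + u D) - u D = d u\<close>, which makes \<open>p\<close> compatible with
  the outer differentials.\<close>

lemma pP_dgen_node:
  "pP (fst (dg k) - 1) (snd (dg k)) (dgen R (Node a dg u c k ch)) = dX (fst (dg k)) (snd (dg k)) (u k)"
proof -
  define n m where nm: "n = fst (dg k)" "m = snd (dg k)"
  interpret M: left_module R "obj (PC (n - 1)) m" by (rule cx_module[OF PC_cx])
  interpret X: left_module R "obj (X (n - 1)) m" by (rule cx_module[OF X_cx])
  note ga = good_a[OF good valid, of k, folded nm]
  have gu: "u j \<in> carrier (obj (X n) (snd (dg j)))" if "fst (dg j) = n" for j n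
    using good_u[OF good valid, of j] that by simp
  note lead = lead_PC[OF good valid] 
  let ?N = "\<lambda>n. cx_ext R (PC n) (\<lambda>j. snd (dg j)) (\<lambda>j. unit_vec R (Node a dg u c j ch, False))"
  note N = cx_ext_node_cmap[OF good valid]
  have eU: "cmap R (FN dg (n - 1)) (X (n - 1)) (cx_ext R (X (n - 1)) (\<lambda>j. snd (dg j)) u)"
    by (rule cx_ext_cmap[OF X_cx]) (auto intro: gu)
  have *: "pP (n - 1) (snd (dg j)) (unit_vec R (Node a dg u c j ch, False)) = u j" if "fst (dg j) = n - 1" for j
    using pP_unit_vec[of "Node a dg u c j ch"] good valid that by auto
  have "pP (n - 1) m (?N (n - 1) m (a k)) =
      cx_ext R (X (n - 1)) (\<lambda>j. snd (dg j)) (\<lambda>j. pP (n - 1) (snd (dg j)) (unit_vec R (Node a dg u c j ch, False))) m (a k)"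
    by (rule cmap_cx_ext[OF PC_cx X_cx pP_cmap _ ga]) (auto intro: unit_vec_node[OF good valid])
  also have "\<dots> = cx_ext R (X (n - 1)) (\<lambda>j. snd (dg j)) u m (a k)"
    by (rule cx_ext_cong[OF X_cx _ _ ga]) (auto simp: * intro: gu)
  finally have e: "pP (n - 1) m (?N (n - 1) m (a k)) = cx_ext R (X (n - 1)) (\<lambda>j. snd (dg j)) u m (a k)" .
  have l: "pP (n - 1) m (lead R c ch k) =
      dX n m (u k) \<oplus>\<^bsub>obj (X (n - 1)) m\<^esub> cx_ext R (X (n - 1)) (\<lambda>j. snd (dg j)) u m (a k)"
    unfolding pP_def by (rule goodD[OF good]) (simp add: nm)
  have "pP (n - 1) m (dgen R (Node a dg u c k ch)) = pP (n - 1) m (lead R c ch k) \<oplus>\<^bsub>obj (X (n - 1)) m\<^esub>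
      \<ominus>\<^bsub>obj (X (n - 1)) m\<^esub> pP (n - 1) m (?N (n - 1) m (a k))"
    unfolding dgen_node[OF good valid, of k, folded nm]
    using lead[of k, folded nm] cmap_closed[OF N ga]
    by (simp add: cmap_add[OF pP_cmap] cmap_minus[OF PC_cx X_cx pP_cmap])
  also have "\<dots> = dX n m (u k)"
    unfolding e l using cmap_closed[OF eU ga] cmap_closed[OF dX_cmap gu[of k], OF refl, folded nm]
    by (simp add: X.M.a_assoc X.M.r_neg)
  finally show ?thesis by (simp add: nm)
qed

end

lemma dP_dP:
  assumes "x \<in> carrier (obj (PC n) m)"
  shows "dP (n - 1) m (dP n m x) = (\<lambda>b. \<zero>)"
proof -
  have d: "cmap R (PC (n - 1)) (PC (n - 2)) (dP (n - 1))" using dP_cmap[of "n - 1"] by simp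
  have "dP (n - 1) m (dP n m x) = \<zero>\<^bsub>obj (PC (n - 2)) m\<^esub>"
  proof (rule cmap_free_cx_eqI[OF PC_cx[of "n - 2"] _ _ _ assms[unfolded PC_def]])
    show "cmap R (fdc R {g. valid g \<and> g \<noteq> Leaf} odeg ideg n) (PC (n - 2)) (\<lambda>m x. dP (n - 1) m (dP n m x))"
      using cmap_comp[OF dP_cmap[of n] d] unfolding PC_def[of n] .
    show "cmap R (fdc R {g. valid g \<and> g \<noteq> Leaf} odeg ideg n) (PC (n - 2)) (\<lambda>m x. \<zero>\<^bsub>obj (PC (n - 2)) m\<^esub>)"
      by (rule cmap_const_zero[OF PC_cx])
    fix g assume g: "g \<in> {g \<in> {g. valid g \<and> g \<noteq> Leaf}. odeg g = n}"
    then obtain a dg u c k ch where e: "g = Node a dg u c k ch" by (cases g) auto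
    show "dP (n - 1) (ideg g) (dP n (ideg g) (unit_vec R (g, False))) = \<zero>\<^bsub>obj (PC (n - 2)) (ideg g)\<^esub>"
      using dP_dgen_node[of a dg u c ch k] dP_unit_vec[of g] g e by (auto simp: PC_zero)
  qed
  then show ?thesis by (simp add: PC_zero)
qed

lemma pP_dP:
  assumes "x \<in> carrier (obj (PC n) m)"
  shows "pP (n - 1) m (dP n m x) = dX n m (pP n m x)"
proof (rule cmap_free_cx_eqI[OF X_cx[of "n - 1"] _ _ _ assms[unfolded PC_def]])
  show "cmap R (fdc R {g. valid g \<and> g \<noteq> Leaf} odeg ideg n) (X (n - 1)) (\<lambda>m x. pP (n - 1) m (dP n m x))"
    using cmap_comp[OF dP_cmap[of n] pP_cmap] unfolding PC_def[of n] .
  show "cmap R (fdc R {g. valid g \<and> g \<noteq> Leaf} odeg ideg n) (X (n - 1)) (\<lambda>m x. dX n m (pP n m x))"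
    using cmap_comp[OF pP_cmap[of n] dX_cmap] unfolding PC_def[of n] .
  fix g assume g: "g \<in> {g \<in> {g. valid g \<and> g \<noteq> Leaf}. odeg g = n}"
  then obtain a dg u c k ch where e: "g = Node a dg u c k ch" by (cases g) auto
  show "pP (n - 1) (ideg g) (dP n (ideg g) (unit_vec R (g, False))) = dX n (ideg g) (pP n (ideg g) (unit_vec R (g, False)))"
    using pP_dgen_node[of a dg u c ch k] dP_unit_vec[of g] pP_unit_vec[of g] g e by auto
qed

end

section \<open>Solving the homotopy equations\<close>

lemma (in ring) cx_ext_zero: "cx R Y \<Longrightarrow> cx_ext R Y deg y m (\<lambda>b. \<zero>) = \<zero>\<^bsub>obj Y m\<^esub>"
proof -
  assume "cx R Y"
  then interpret M: left_module R "obj Y m" by (rule cx_module)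
  show ?thesis by (simp add: cx_ext_def lin_ext_def)
qed

context dcx
begin

text \<open>
  A system consists of a complex \<open>F\<close> of free objects of \<open>C(R)\<close> on a bigraded set \<open>\<Gamma>\<close> of generators
  with differential \<open>D\<close>, a chain map \<open>h : F \<rightarrow> P[1]\<close> and a null homotopy \<open>u\<close> of the composite
  \<open>F \<rightarrow> P[1] \<rightarrow> X[1]\<close>; a solution is a null homotopy \<open>T\<close> of \<open>h\<close> that lifts \<open>u\<close>.
\<close>

definition system :: "'g set \<Rightarrow> ('g \<Rightarrow> int) \<Rightarrow> ('g \<Rightarrow> int) \<Rightarrow> ('g \<Rightarrow> 'g \<times> bool \<Rightarrow> 'r) \<Rightarrow>
    ('g \<Rightarrow> ('r, 'u) gen \<times> bool \<Rightarrow> 'r) \<Rightarrow> ('g \<Rightarrow> 'u) \<Rightarrow> bool" where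
  "system \<Gamma> od deg D h u \<longleftrightarrow> (\<forall>g\<in>\<Gamma>.
     D g \<in> carrier (obj (fdc R \<Gamma> od deg (od g - 1)) (deg g)) \<and>
     h g \<in> carrier (obj (PC (od g - 1)) (deg g)) \<and>
     u g \<in> carrier (obj (X (od g)) (deg g)) \<and>
     cx_ext R (fdc R UNIV od deg (od g - 2)) deg D (deg g) (D g) = (\<lambda>b. \<zero>) \<and>
     dP (od g - 1) (deg g) (h g) = cx_ext R (PC (od g - 2)) deg h (deg g) (D g) \<and>
     pP (od g - 1) (deg g) (h g) = dX (od g) (deg g) (u g)
       \<oplus>\<^bsub>obj (X (od g - 1)) (deg g)\<^esub> cx_ext R (X (od g - 1)) deg u (deg g) (D g))"

definition solution :: "'g set \<Rightarrow> ('g \<Rightarrow> int) \<Rightarrow> ('g \<Rightarrow> int) \<Rightarrow> ('g \<Rightarrow> 'g \<times> bool \<Rightarrow> 'r) \<Rightarrow>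
    ('g \<Rightarrow> ('r, 'u) gen \<times> bool \<Rightarrow> 'r) \<Rightarrow> ('g \<Rightarrow> 'u) \<Rightarrow> ('g \<Rightarrow> ('r, 'u) gen \<times> bool \<Rightarrow> 'r) \<Rightarrow> bool" where
  "solution \<Gamma> od deg D h u T \<longleftrightarrow> (\<forall>g\<in>\<Gamma>.
     T g \<in> carrier (obj (PC (od g)) (deg g)) \<and>
     h g = dP (od g) (deg g) (T g)
       \<oplus>\<^bsub>obj (PC (od g - 1)) (deg g)\<^esub> cx_ext R (PC (od g - 1)) deg T (deg g) (D g) \<and>
     u g = pP (od g) (deg g) (T g))"

lemma systemD:
  assumes "system \<Gamma> od deg D h u" "g \<in> \<Gamma>"
  shows "D g \<in> carrier (obj (fdc R \<Gamma> od deg (od g - 1)) (deg g))"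
    and "h g \<in> carrier (obj (PC (od g - 1)) (deg g))"
    and "u g \<in> carrier (obj (X (od g)) (deg g))"
    and "cx_ext R (fdc R UNIV od deg (od g - 2)) deg D (deg g) (D g) = (\<lambda>b. \<zero>)"
    and "dP (od g - 1) (deg g) (h g) = cx_ext R (PC (od g - 2)) deg h (deg g) (D g)"
    and "pP (od g - 1) (deg g) (h g) = dX (od g) (deg g) (u g)
       \<oplus>\<^bsub>obj (X (od g - 1)) (deg g)\<^esub> cx_ext R (X (od g - 1)) deg u (deg g) (D g)"
  using assms unfolding system_def by blast+

lemma solutionD:
  assumes "solution \<Gamma> od deg D h u T" "g \<in> \<Gamma>"
  shows "T g \<in> carrier (obj (PC (od g)) (deg g))"
    and "h g = dP (od g) (deg g) (T g)
       \<oplus>\<^bsub>obj (PC (od g - 1)) (deg g)\<^esub> cx_ext R (PC (od g - 1)) deg T (deg g) (D g)"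
    and "u g = pP (od g) (deg g) (T g)"
  using assms unfolding solution_def by blast+

lemma system_D: "system \<Gamma> od deg D h u \<Longrightarrow> g \<in> \<Gamma> \<Longrightarrow> od g = n \<Longrightarrow> D g \<in> carrier (obj (fdc R \<Gamma> od deg (n - 1)) (deg g))"
  and system_h: "system \<Gamma> od deg D h u \<Longrightarrow> g \<in> \<Gamma> \<Longrightarrow> od g = n \<Longrightarrow> h g \<in> carrier (obj (PC (n - 1)) (deg g))"
  and system_u: "system \<Gamma> od deg D h u \<Longrightarrow> g \<in> \<Gamma> \<Longrightarrow> od g = n \<Longrightarrow> u g \<in> carrier (obj (X n) (deg g))"
  and solution_T: "solution \<Gamma> od deg D h u T \<Longrightarrow> g \<in> \<Gamma> \<Longrightarrow> od g = n \<Longrightarrow> T g \<in> carrier (obj (PC n) (deg g))"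
  unfolding system_def solution_def by blast+

text \<open>\<open>system\<close> states \<open>D D = 0\<close> in the complex on the whole index
  type, so that the condition does not depend on \<open>\<Gamma>\<close> and survives restriction to
  subsets. Naturality along the inclusion recovers it inside \<open>\<Gamma>\<close>.\<close>

lemma system_D2:
  assumes "system \<Gamma> od deg D h u" "g \<in> \<Gamma>"
  shows "cx_ext R (fdc R \<Gamma> od deg (od g - 2)) deg D (deg g) (D g) = (\<lambda>b. \<zero>)"
proof -
  have "cx_ext R (fdc R \<Gamma> od deg (od g - 2)) deg D (deg g) (D g) =
      cx_ext R (fdc R UNIV od deg (od g - 2)) deg D (deg g) (D g)"
    by (rule cmap_cx_ext[OF free_cx_cx free_cx_cx cmap_free_cx_mono _ systemD(1)[OF assms]])
      (use system_D[OF assms(1), of _ "od g - 1"] in auto)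
  then show ?thesis using systemD(4)[OF assms] by simp
qed

text \<open>After renaming its generators by natural numbers, a countable system is itself
  admissible data for nodes, and the nodes carrying this data are a solution by the definition of
  \<open>dgen\<close> and \<open>gval\<close>.\<close>

lemma solution_countable:
  fixes \<Gamma> :: "'g set"
  assumes "countable \<Gamma>" and S: "system \<Gamma> od deg D h u"
  shows "\<exists>T. solution \<Gamma> od deg D h u T"
proof -
  define nu where "nu = to_nat_on \<Gamma>"
  define e where "e = inv_into \<Gamma> nu"
  define K where "K = nu ` \<Gamma>"
  have e: "e (nu g) = g" if "g \<in> \<Gamma>" for g
    unfolding e_def nu_def using assms(1) that by (simp add: inj_on_to_nat_on)
  have K: "nu g \<in> K" if "g \<in> \<Gamma>" for g using that by (simp add: K_def)
  have eK: "e k \<in> \<Gamma>" "nu (e k) = k" if "k \<in> K" for k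
    using that e by (auto simp: K_def)
  \<comment> \<open>\<open>good\<close> quantifies over all natural numbers, so indices outside
    \<open>K\<close> carry zero data in bidegree \<open>(0, 0)\<close>.\<close>
  define dg where "dg k = (if k \<in> K then (od (e k), deg (e k)) else (0, 0))" for k
  have dg: "dg (nu g) = (od g, deg g)" if "g \<in> \<Gamma>" for g using that by (simp add: dg_def K e)
  define u' where "u' k = (if k \<in> K then u (e k) else \<zero>\<^bsub>obj (X 0) 0\<^esub>)" for k
  \<comment> \<open>All generators of \<open>P\<close> that occur in some \<open>h g\<close>. Adding
    \<open>Leaf\<close> keeps the set nonempty, so that it is the range of a sequence even if
    \<open>h\<close> vanishes.\<close>
  define U where "U = insert Leaf (\<Union>g\<in>\<Gamma>. fst ` {b. h g b \<noteq> \<zero>})"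
  have h: "h g \<in> carrier (obj (PC (od g - 1)) (deg g))" if "g \<in> \<Gamma>" for g
    using systemD(2)[OF S that] .
  have U: "countable U"
    unfolding U_def using assms(1) h
    by (intro countable_insert countable_UN) (auto simp: PC_def free_mod_carrier intro: countable_finite)
  define ch where "ch = from_nat_into U"
  have ch: "range ch = U" unfolding ch_def using U by (intro range_from_nat_into) (auto simp: U_def)
  have vch: "valid (ch i)" for i
  proof -
    have "ch i \<in> U" using ch by auto
    then show ?thesis unfolding U_def using h by (auto simp: PC_def free_mod_carrier)
  qed
  define c where "c k b = (if k \<in> K then h (e k) (ch (fst b), snd b) else \<zero>)" for k b
  have lead: "lead R c ch (nu g) = h g" if g: "g \<in> \<Gamma>" for g
  proof
    fix b
    show "lead R c ch (nu g) b = h g b"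
    proof (cases "fst b \<in> U")
      case True
      then have "ch (inv_into UNIV ch (fst b)) = fst b" using ch by (simp add: f_inv_into_f)
      then show ?thesis using True g by (simp add: lead_def ch c_def K e)
    next
      case False
      then have "h g b = \<zero>" using g by (auto simp: U_def)
      then show ?thesis using False by (simp add: lead_def ch)
    qed
  qed
  have lead0: "lead R c ch k = (\<lambda>b. \<zero>)" if "k \<notin> K" for k
    using that by (auto simp: lead_def c_def)
  \<comment> \<open>The chain map renaming \<open>g\<close> to \<open>nu g\<close>;
    \<open>reindex\<close> says that extending \<open>y\<close> after renaming is extending
    \<open>y\<close> composed with \<open>nu\<close>.\<close>
  let ?r = "\<lambda>n. cx_ext R (FN dg n) deg (\<lambda>g. unit_vec R (nu g, False))"
  have bnu: "unit_vec R (nu g, False) \<in> carrier (obj (FN dg n) (deg g))" if "g \<in> \<Gamma>" "od g = n" for g n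
    using unit_vec_free_cx[of "nu g" "{j \<in> UNIV. fst (dg j) = n}" "\<lambda>j. snd (dg j)"] that by (simp add: dg)
  have r: "cmap R (fdc R \<Gamma> od deg n) (FN dg n) (?r n)" for n
    by (rule cx_ext_cmap[OF free_cx_cx]) (use bnu in blast)
  define a where "a k = (if k \<in> K then ?r (od (e k) - 1) (deg (e k)) (D (e k)) else (\<lambda>b. \<zero>))" for k
  have a: "a (nu g) = ?r (od g - 1) (deg g) (D g)" if "g \<in> \<Gamma>" for g
    using that by (simp add: a_def K e)
  have reindex: "cx_ext R Y (\<lambda>j. snd (dg j)) y m (?r n m \<phi>) = cx_ext R Y deg (\<lambda>g. y (nu g)) m \<phi>"
    if Y: "cx R Y" and y: "\<And>j. fst (dg j) = n \<Longrightarrow> y j \<in> carrier (obj Y (snd (dg j)))"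
      and \<phi>: "\<phi> \<in> carrier (obj (fdc R \<Gamma> od deg n) m)"
    for Y :: "(('r, 'b) module, 'b \<Rightarrow> 'b) cplx" and y n m \<phi>
  proof (rule cmap_free_cx_eqI[OF Y _ _ _ \<phi>])
    have yn: "y (nu g) \<in> carrier (obj Y (deg g))" if "g \<in> \<Gamma>" "od g = n" for g
      using y[of "nu g"] that by (simp add: dg)
    show "cmap R (fdc R \<Gamma> od deg n) Y (\<lambda>m \<phi>. cx_ext R Y (\<lambda>j. snd (dg j)) y m (?r n m \<phi>))"
      by (intro cmap_comp[OF r] cx_ext_cmap[OF Y]) (use y in blast)
    show "cmap R (fdc R \<Gamma> od deg n) Y (cx_ext R Y deg (\<lambda>g. y (nu g)))"
      by (intro cx_ext_cmap[OF Y]) (use yn in blast)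
    fix g assume "g \<in> {g \<in> \<Gamma>. od g = n}"
    then have g: "g \<in> \<Gamma>" "od g = n" by auto
    have "?r n (deg g) (unit_vec R (g, False)) = unit_vec R (nu g, False)"
      by (intro cx_ext_gen[where y = "\<lambda>g. unit_vec R (nu g, False)"] free_cx_cx bnu g)
    moreover have "cx_ext R Y (\<lambda>j. snd (dg j)) y (snd (dg (nu g))) (unit_vec R (nu g, False)) = y (nu g)"
      by (intro cx_ext_gen[where deg = "\<lambda>j. snd (dg j)" and y = y] Y y) (simp add: dg g)
    moreover have "cx_ext R Y deg (\<lambda>g. y (nu g)) (deg g) (unit_vec R (g, False)) = y (nu g)"
      by (intro cx_ext_gen[where y = "\<lambda>g. y (nu g)"] Y yn g)
    ultimately show "cx_ext R Y (\<lambda>j. snd (dg j)) y (deg g) (?r n (deg g) (unit_vec R (g, False))) =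
        cx_ext R Y deg (\<lambda>g. y (nu g)) (deg g) (unit_vec R (g, False))"
      using g by (simp add: dg)
  qed
  have zFN: "(\<lambda>b. \<zero>) \<in> carrier (obj (FN dg n) m)" for n m by (simp add: free_mod_carrier)
  have zPP: "(\<lambda>b. \<zero>) \<in> carrier (obj (PC n) m)" for n m by (simp add: free_mod_carrier PC_def)
  have zX: "\<zero>\<^bsub>obj (X n) m\<^esub> \<in> carrier (obj (X n) m)" for n m
  proof -
    interpret M: left_module R "obj (X n) m" by (rule cx_module[OF X_cx])
    show ?thesis by simp
  qed
  have aFN: "a j \<in> carrier (obj (FN dg (n - 1)) (snd (dg j)))" if "fst (dg j) = n" for j n
  proof (cases "j \<in> K")
    case True
    then obtain g where g: "g \<in> \<Gamma>" "j = nu g" by (auto simp: K_def)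
    then show ?thesis
      using cmap_closed[OF r systemD(1)[OF S g(1)]] that by (simp add: a dg del: free_cx_obj)
  qed (use zFN in \<open>simp add: a_def\<close>)
  have lPP: "lead R c ch j \<in> carrier (obj (PC (n - 1)) (snd (dg j)))" if "fst (dg j) = n" for j n
  proof (cases "j \<in> K")
    case True
    then obtain g where g: "g \<in> \<Gamma>" "j = nu g" by (auto simp: K_def)
    then show ?thesis using h that by (auto simp: lead dg)
  qed (use zPP in \<open>simp add: lead0\<close>)
  have uX: "u' j \<in> carrier (obj (X n) (snd (dg j)))" if "fst (dg j) = n" for j n
  proof (cases "j \<in> K")
    case True
    then obtain g where g: "g \<in> \<Gamma>" "j = nu g" by (auto simp: K_def)
    then show ?thesis using systemD(3)[OF S g(1)] that K by (auto simp: u'_def dg e)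
  next
    case False
    then have "dg j = (0, 0)" "n = 0" using that by (auto simp: dg_def)
    then show ?thesis using False zX by (simp add: u'_def)
  qed
  have good: "good a dg u' c ch"
    unfolding good_def
  proof (intro allI impI)
    fix k n m assume k: "dg k = (n, m)"
    have ck: "\<forall>b. c k b \<in> carrier R"
    proof (cases "k \<in> K")
      case True
      then show ?thesis using h[OF eK(1)] by (auto simp: c_def PC_def free_mod_carrier)
    qed (simp add: c_def)
    have closed: "a k \<in> carrier (obj (FN dg (n - 1)) m)" "u' k \<in> carrier (obj (X n) m)"
      "lead R c ch k \<in> carrier (obj (fdc R (- {Leaf}) odeg ideg (n - 1)) m)"
      using aFN[of k n] uX[of k n] cmap_closed[OF PC_incl lPP[of k n]] k by simp_all
    have l1: "lead R c ch j \<in> carrier (obj (PC (n - 2)) (snd (dg j)))" if "fst (dg j) = n - 1" for j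
      using lPP[OF that] by simp
    have a1: "a j \<in> carrier (obj (FN dg (n - 2)) (snd (dg j)))" if "fst (dg j) = n - 1" for j
      using aFN[OF that] by simp
    have dl: "cx_ext R (fdc R (- {Leaf}) odeg ideg (n - 2)) ideg (dgen R) m (lead R c ch k) =
        dP (n - 1) m (lead R c ch k)"
    proof -
      have lk: "lead R c ch k \<in> carrier (obj (PC (n - 1)) m)" using lPP[of k n] k by simp
      show ?thesis
        unfolding dP_def
        by (subst cx_ext_PC[OF _ lk[unfolded PC_def]])
          (use dgen_closed in \<open>auto simp: algebra_simps\<close>)
    qed
    have ll: "cx_ext R (fdc R (- {Leaf}) odeg ideg (n - 2)) (\<lambda>j. snd (dg j)) (lead R c ch) m (a k) =
        cx_ext R (PC (n - 2)) (\<lambda>j. snd (dg j)) (lead R c ch) m (a k)"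
      by (rule cx_ext_PC[OF _ closed(1)]) (use l1 in blast)
    have "cx_ext R (FN dg (n - 2)) (\<lambda>j. snd (dg j)) a m (a k) = (\<lambda>b. \<zero>) \<and>
      dP (n - 1) m (lead R c ch k) = cx_ext R (PC (n - 2)) (\<lambda>j. snd (dg j)) (lead R c ch) m (a k) \<and>
      cx_ext R (X (n - 1)) ideg gval m (lead R c ch k) =
       dX n m (u' k) \<oplus>\<^bsub>obj (X (n - 1)) m\<^esub> cx_ext R (X (n - 1)) (\<lambda>j. snd (dg j)) u' m (a k)"
    proof (cases "k \<in> K")
      case True
      then obtain g where g: "g \<in> \<Gamma>" "k = nu g" by (auto simp: K_def)
      have nm: "n = od g" "m = deg g" using k g by (auto simp: dg)
      note Dg = systemD(1)[OF S g(1)]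
      have ag: "a k = ?r (n - 1) m (D g)" using g nm by (simp add: a)
      have ug: "u' k = u g" using g by (simp add: u'_def K e)
      have "cx_ext R (FN dg (n - 2)) (\<lambda>j. snd (dg j)) a m (a k) =
          cx_ext R (FN dg (n - 2)) deg (\<lambda>g. a (nu g)) m (D g)"
        unfolding ag using Dg nm a1 by (intro reindex free_cx_cx) blast+
      also have "\<dots> = cx_ext R (FN dg (n - 2)) deg (\<lambda>g. ?r (n - 2) (deg g) (D g)) m (D g)"
      proof (rule cx_ext_cong[OF free_cx_cx])
        show "D g \<in> carrier (obj (fdc R \<Gamma> od deg (n - 1)) m)" using Dg nm by simp
        fix g' assume "g' \<in> {g \<in> \<Gamma>. od g = n - 1}"
        then have g': "g' \<in> \<Gamma>" "od g' = n - 1" by auto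
        show "a (nu g') \<in> carrier (obj (FN dg (n - 2)) (deg g'))"
          using a1[of "nu g'"] dg[OF g'(1)] g'(2) by (simp del: free_cx_obj)
        show "a (nu g') = ?r (n - 2) (deg g') (D g')"
          using a[OF g'(1)] g'(2) by simp
      qed
      also have "\<dots> = ?r (n - 2) m (cx_ext R (fdc R \<Gamma> od deg (n - 2)) deg D m (D g))"
      proof (rule cmap_cx_ext[OF free_cx_cx free_cx_cx r, symmetric])
        show "D g \<in> carrier (obj (fdc R \<Gamma> od deg (n - 1)) m)" using Dg nm by simp
        show "D g' \<in> carrier (obj (fdc R \<Gamma> od deg (n - 2)) (deg g'))"
          if "g' \<in> {g \<in> \<Gamma>. od g = n - 1}" for g'
          using system_D[OF S, of g' "n - 1"] that by simp
      qed
      also have "\<dots> = (\<lambda>b. \<zero>)"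
        unfolding nm using system_D2[OF S g(1)] cmap_zero[OF free_cx_cx free_cx_cx r, of "od g - 2" "deg g"] by simp
      finally have 1: "cx_ext R (FN dg (n - 2)) (\<lambda>j. snd (dg j)) a m (a k) = (\<lambda>b. \<zero>)" .
      have "cx_ext R (PC (n - 2)) (\<lambda>j. snd (dg j)) (lead R c ch) m (a k) =
          cx_ext R (PC (n - 2)) deg (\<lambda>g. lead R c ch (nu g)) m (D g)"
        unfolding ag using Dg nm l1 by (intro reindex PC_cx) blast+
      also have "\<dots> = cx_ext R (PC (n - 2)) deg h m (D g)"
      proof (rule cx_ext_cong[OF PC_cx])
        show "D g \<in> carrier (obj (fdc R \<Gamma> od deg (n - 1)) m)" using Dg nm by simp
        fix g' assume "g' \<in> {g \<in> \<Gamma>. od g = n - 1}"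
        then have g': "g' \<in> \<Gamma>" "od g' = n - 1" by auto
        show "lead R c ch (nu g') \<in> carrier (obj (PC (n - 2)) (deg g'))" "lead R c ch (nu g') = h g'"
          using l1[of "nu g'"] dg[OF g'(1)] lead[OF g'(1)] g'(2) by simp_all
      qed
      finally have 2: "dP (n - 1) m (lead R c ch k) = cx_ext R (PC (n - 2)) (\<lambda>j. snd (dg j)) (lead R c ch) m (a k)"
        using systemD(5)[OF S g(1)] lead[OF g(1)] nm g by simp
      have uX1: "u' j \<in> carrier (obj (X (n - 1)) (snd (dg j)))" if "fst (dg j) = n - 1" for j
        using uX[OF that] .
      have "cx_ext R (X (n - 1)) (\<lambda>j. snd (dg j)) u' m (a k) =
          cx_ext R (X (n - 1)) deg (\<lambda>g. u' (nu g)) m (D g)"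
        unfolding ag using Dg nm uX1 by (intro reindex X_cx) blast+
      also have "\<dots> = cx_ext R (X (n - 1)) deg u m (D g)"
      proof (rule cx_ext_cong[OF X_cx])
        show "D g \<in> carrier (obj (fdc R \<Gamma> od deg (n - 1)) m)" using Dg nm by simp
        fix g' assume "g' \<in> {g \<in> \<Gamma>. od g = n - 1}"
        then have g': "g' \<in> \<Gamma>" "od g' = n - 1" by auto
        show "u' (nu g') \<in> carrier (obj (X (n - 1)) (deg g'))" "u' (nu g') = u g'"
          using uX1[of "nu g'"] dg[OF g'(1)] K[OF g'(1)] e[OF g'(1)] g'(2) by (simp_all add: u'_def)
      qed
      finally show ?thesis
        using 1 2 systemD(6)[OF S g(1)] lead[OF g(1)] nm g ug by (simp add: pP_def)
    next
      case False
      then have *: "n = 0" "m = 0" "a k = (\<lambda>b. \<zero>)" "u' k = \<zero>\<^bsub>obj (X n) m\<^esub>" "lead R c ch k = (\<lambda>b. \<zero>)"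
        using k lead0 by (auto simp: dg_def a_def u'_def)
      interpret M: left_module R "obj (X (n - 1)) m" by (rule cx_module[OF X_cx])
      have "\<zero>\<^bsub>obj (X (n - 1)) m\<^esub> \<oplus>\<^bsub>obj (X (n - 1)) m\<^esub> \<zero>\<^bsub>obj (X (n - 1)) m\<^esub> = \<zero>\<^bsub>obj (X (n - 1)) m\<^esub>"
        by simp
      moreover have "dX n m \<zero>\<^bsub>obj (X n) m\<^esub> = \<zero>\<^bsub>obj (X (n - 1)) m\<^esub>"
        by (rule cmap_zero[OF X_cx X_cx dX_cmap])
      moreover have "dP (n - 1) m (\<lambda>b. \<zero>) = (\<lambda>b. \<zero>)"
        unfolding dP_def by (simp add: PC_zero cx_ext_zero[OF PC_cx])
      ultimately show ?thesis
        using * by (simp add: PC_zero cx_ext_zero[OF PC_cx] cx_ext_zero[OF X_cx] cx_ext_zero[OF free_cx_cx])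
    qed
    then show "a k \<in> carrier (obj (FN dg (n - 1)) m) \<and>
       u' k \<in> carrier (obj (X n) m) \<and>
       (\<forall>b. c k b \<in> carrier R) \<and>
       lead R c ch k \<in> carrier (obj (fdc R (- {Leaf}) odeg ideg (n - 1)) m) \<and>
       cx_ext R (FN dg (n - 2)) (\<lambda>j. snd (dg j)) a m (a k) = (\<lambda>b. \<zero>) \<and>
       cx_ext R (fdc R (- {Leaf}) odeg ideg (n - 2)) ideg (dgen R) m (lead R c ch k) =
         cx_ext R (fdc R (- {Leaf}) odeg ideg (n - 2)) (\<lambda>j. snd (dg j)) (lead R c ch) m (a k) \<and>
       cx_ext R (X (n - 1)) ideg gval m (lead R c ch k) =
         dX n m (u' k) \<oplus>\<^bsub>obj (X (n - 1)) m\<^esub> cx_ext R (X (n - 1)) (\<lambda>j. snd (dg j)) u' m (a k)"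
      using closed ck dl ll by simp
  qed
  define T where "T g = unit_vec R (Node a dg u' c (nu g) ch, False)" for g
  have "solution \<Gamma> od deg D h u T"
    unfolding solution_def
  proof (intro ballI conjI)
    fix g assume g: "g \<in> \<Gamma>"
    let ?N = "Node a dg u' c (nu g) ch"
    have v: "valid ?N" "?N \<noteq> Leaf" using good vch by auto
    show "T g \<in> carrier (obj (PC (od g)) (deg g))"
      using unit_vec_PC[OF v] g by (simp add: T_def dg)
    show "u g = pP (od g) (deg g) (T g)"
      using pP_unit_vec[OF v] g by (simp add: T_def dg u'_def K e)
    note Dg = systemD(1)[OF S g]
    interpret M: left_module R "obj (PC (od g - 1)) (deg g)" by (rule cx_module[OF PC_cx])
    let ?E = "cx_ext R (PC (od g - 1)) deg T (deg g) (D g)"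
    have "cx_ext R (PC (od g - 1)) (\<lambda>j. snd (dg j)) (\<lambda>j. unit_vec R (Node a dg u' c j ch, False)) (deg g) (a (nu g)) = ?E"
      unfolding T_def a[OF g] by (rule reindex[OF PC_cx _ Dg]) (auto intro: unit_vec_node[OF good vch])
    then have dg': "dP (od g) (deg g) (T g) = h g \<oplus>\<^bsub>obj (PC (od g - 1)) (deg g)\<^esub> \<ominus>\<^bsub>obj (PC (od g - 1)) (deg g)\<^esub> ?E"
      using dP_unit_vec[OF v] dgen_node[OF good vch, of "nu g"] g lead[OF g] by (simp add: T_def dg del: dgen.simps)
    have "T g' \<in> carrier (obj (PC n) (deg g'))" if "g' \<in> \<Gamma>" "od g' = n" for g' n
      using unit_vec_node[OF good vch, of "nu g'" n] that by (simp add: T_def dg)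
    then have "?E \<in> carrier (obj (PC (od g - 1)) (deg g))"
      by (intro cmap_closed[OF cx_ext_cmap[OF PC_cx] Dg]) blast
    then show "h g = dP (od g) (deg g) (T g) \<oplus>\<^bsub>obj (PC (od g - 1)) (deg g)\<^esub> ?E"
      unfolding dg' using h[OF g] by (simp add: M.M.a_assoc M.M.l_neg)
  qed
  then show ?thesis by blast
qed

end

section \<open>From countable to arbitrary systems\<close>

context dcx
begin

text \<open>Extending \<open>T\<close> by zero to \<open>T0\<close> leaves a defect that vanishes on
  \<open>J\<close> and hence is defined on the quotient by the span of \<open>J\<close>. This
  quotient is free on the countable set \<open>N\<close>, the defect is a system there, and its
  solution, pulled back to \<open>J \<union> N\<close>, corrects \<open>T0\<close>.\<close>

lemma solution_extend:
  fixes J N :: "'g set"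
  assumes S: "system (J \<union> N) od deg D h u" and disj: "J \<inter> N = {}" and N: "countable N"
    and J: "\<And>g. g \<in> J \<Longrightarrow> D g \<in> carrier (obj (fdc R J od deg (od g - 1)) (deg g))"
    and T: "solution J od deg D h u T"
  shows "\<exists>T'. solution (J \<union> N) od deg D h u T' \<and> (\<forall>g\<in>J. T' g = T g)"
proof -
  let ?G = "J \<union> N"
  define T0 where "T0 g = (if g \<in> J then T g else (\<lambda>b. \<zero>))" for g
  \<comment> \<open>Projection killing \<open>J\<close>, that is, the quotient map onto the free
    object on \<open>N\<close>. It is needed because \<open>D\<close> may lead from \<open>N\<close>
    into \<open>J\<close>.\<close>
  let ?q = "\<lambda>n. cx_ext R (fdc R N od deg n) deg (\<lambda>g. if g \<in> N then unit_vec R (g, False) else (\<lambda>b. \<zero>))"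
  have z: "(\<lambda>b. \<zero>) \<in> carrier (free_mod R S)" for S :: "('g \<times> bool) set" by (simp add: free_mod_carrier)
  have zP: "(\<lambda>b. \<zero>) \<in> carrier (obj (PC n) m)" for n m by (simp add: free_mod_carrier PC_def)
  have qg: "(if g \<in> N then unit_vec R (g, False) else (\<lambda>b. \<zero>)) \<in> carrier (obj (fdc R N od deg n) (deg g))"
    if "od g = n" for g n
    using unit_vec_free_cx[of g "{g \<in> N. od g = n}" deg] that z by (auto simp del: free_mod_simps)
  have q: "cmap R (fdc R ?G od deg n) (fdc R N od deg n) (?q n)" for n
    by (rule cx_ext_cmap[OF free_cx_cx]) (use qg in blast)
  have q_N: "?q n (deg g) (unit_vec R (g, False)) = unit_vec R (g, False)" if "g \<in> N" "od g = n" for g n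
    using cx_ext_gen[where y = "\<lambda>g. if g \<in> N then unit_vec R (g, False) else (\<lambda>b. \<zero>)" and deg = deg and g = g, OF free_cx_cx qg[OF that(2)]]
      that by simp
  have q_J: "?q n (deg g) (unit_vec R (g, False)) = (\<lambda>b. \<zero>)" if "g \<in> J" "od g = n" for g n
    using cx_ext_gen[where y = "\<lambda>g. if g \<in> N then unit_vec R (g, False) else (\<lambda>b. \<zero>)" and deg = deg and g = g, OF free_cx_cx qg[OF that(2)]]
      that disj by auto
  have factor: "f m \<phi> = cx_ext R Y deg y m (?q n m \<phi>)"
    if Y: "cx R Y" and f: "cmap R (fdc R ?G od deg n) Y f"
      and fJ: "\<And>g. g \<in> J \<Longrightarrow> od g = n \<Longrightarrow> f (deg g) (unit_vec R (g, False)) = \<zero>\<^bsub>obj Y (deg g)\<^esub>"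
      and fN: "\<And>g. g \<in> N \<Longrightarrow> od g = n \<Longrightarrow> f (deg g) (unit_vec R (g, False)) = y g"
      and \<phi>: "\<phi> \<in> carrier (obj (fdc R ?G od deg n) m)"
    for Y :: "(('r, 'b) module, 'b \<Rightarrow> 'b) cplx" and f y n m \<phi>
  proof (rule cmap_free_cx_eqI[OF Y f _ _ \<phi>])
    have y: "y g \<in> carrier (obj Y (deg g))" if "g \<in> N" "od g = n" for g
      using cmap_closed[OF f unit_vec_free_cx[of g _ deg]] fN[OF that] that by simp
    show c: "cmap R (fdc R ?G od deg n) Y (\<lambda>m x. cx_ext R Y deg y m (?q n m x))"
      by (intro cmap_comp[OF q] cx_ext_cmap Y) (use y in blast)
    fix g assume "g \<in> {g \<in> ?G. od g = n}"
    then consider "g \<in> J" "od g = n" | "g \<in> N" "od g = n" by blast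
    then show "f (deg g) (unit_vec R (g, False)) = cx_ext R Y deg y (deg g) (?q n (deg g) (unit_vec R (g, False)))"
    proof cases
      case 1
      then show ?thesis by (simp add: fJ q_J cx_ext_zero Y)
    next
      case 2
      then show ?thesis using y[OF 2] by (simp add: fN q_N cx_ext_gen Y)
    qed
  qed
  have killJ: "f m \<phi> = \<zero>\<^bsub>obj Y m\<^esub>"
    if Y: "cx R Y" and f: "cmap R (fdc R ?G od deg n) Y f"
      and fJ: "\<And>g. g \<in> J \<Longrightarrow> od g = n \<Longrightarrow> f (deg g) (unit_vec R (g, False)) = \<zero>\<^bsub>obj Y (deg g)\<^esub>"
      and \<phi>: "\<phi> \<in> carrier (obj (fdc R J od deg n) m)"
    for Y :: "(('r, 'b) module, 'b \<Rightarrow> 'b) cplx" and f n m \<phi>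
  proof (rule cmap_free_cx_eqI[OF Y _ cmap_const_zero[OF Y] _ \<phi>])
    have "cmap R (fdc R J od deg n) (fdc R ?G od deg n) (\<lambda>m x. x)"
      by (rule cmap_free_cx_mono) blast
    from cmap_comp[OF this f] show "cmap R (fdc R J od deg n) Y f" .
  qed (use fJ in auto)
  have T0: "T0 g \<in> carrier (obj (PC n) (deg g))" if "od g = n" for g n
    using solution_T[OF T _ that] zP by (auto simp: T0_def)
  have eT0: "cmap R (fdc R ?G od deg n) (PC n) (cx_ext R (PC n) deg T0)" for n
    by (rule cx_ext_cmap[OF PC_cx]) (use T0 in blast)
  have eh: "cmap R (fdc R ?G od deg n) (PC (n - 1)) (cx_ext R (PC (n - 1)) deg h)" for n
    by (rule cx_ext_cmap[OF PC_cx]) (use system_h[OF S] in blast)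
  have eu: "cmap R (fdc R ?G od deg n) (X n) (cx_ext R (X n) deg u)" for n
    by (rule cx_ext_cmap[OF X_cx]) (use system_u[OF S] in blast)
  have eD: "cmap R (fdc R ?G od deg n) (fdc R ?G od deg (n - 1)) (cx_ext R (fdc R ?G od deg (n - 1)) deg D)" for n
    by (rule cx_ext_cmap[OF free_cx_cx]) (use system_D[OF S] in blast)
  \<comment> \<open>The defects \<open>H = h - (d T0 + T0 D)\<close> and
    \<open>W = u - p T0\<close>.\<close>
  define H where "H n m x = cx_ext R (PC (n - 1)) deg h m x \<oplus>\<^bsub>obj (PC (n - 1)) m\<^esub>
      \<ominus>\<^bsub>obj (PC (n - 1)) m\<^esub> (dP n m (cx_ext R (PC n) deg T0 m x) \<oplus>\<^bsub>obj (PC (n - 1)) m\<^esub>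
        cx_ext R (PC (n - 1)) deg T0 m (cx_ext R (fdc R ?G od deg (n - 1)) deg D m x))" for n m x
  define W where "W n m x = cx_ext R (X n) deg u m x \<oplus>\<^bsub>obj (X n) m\<^esub>
      \<ominus>\<^bsub>obj (X n) m\<^esub> pP n m (cx_ext R (PC n) deg T0 m x)" for n m x
  have H: "cmap R (fdc R ?G od deg n) (PC (n - 1)) (H n)" for n
    unfolding H_def by (intro cmap_plus cmap_uminus PC_cx eh cmap_comp[OF eT0 dP_cmap] cmap_comp[OF eD eT0])
  have W: "cmap R (fdc R ?G od deg n) (X n) (W n)" for n
    unfolding W_def by (intro cmap_plus cmap_uminus X_cx eu cmap_comp[OF eT0 pP_cmap])
  have gens: "cx_ext R (PC (n - 1)) deg h (deg g) (unit_vec R (g, False)) = h g"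
      "cx_ext R (PC n) deg T0 (deg g) (unit_vec R (g, False)) = T0 g"
      "cx_ext R (X n) deg u (deg g) (unit_vec R (g, False)) = u g"
      "cx_ext R (fdc R ?G od deg (n - 1)) deg D (deg g) (unit_vec R (g, False)) = D g"
    if "g \<in> ?G" "od g = n" for g n
    using system_h[OF S that] T0[OF that(2)] system_u[OF S that] system_D[OF S that]
    by (auto intro!: cx_ext_gen PC_cx X_cx free_cx_cx simp del: free_cx_obj)
  have TJ: "cx_ext R (PC (n - 1)) deg T0 (deg g) (D g) = cx_ext R (PC (n - 1)) deg T (deg g) (D g)"
    if "g \<in> J" "od g = n" for g n
    by (rule cx_ext_cong[OF PC_cx _ _ J[OF that(1), unfolded that(2)]])
      (use solution_T[OF T] in \<open>auto simp: T0_def\<close>)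
  have HJ: "H n (deg g) (unit_vec R (g, False)) = \<zero>\<^bsub>obj (PC (n - 1)) (deg g)\<^esub>"
    if g: "g \<in> J" "od g = n" for g n
  proof -
    interpret M: left_module R "obj (PC (n - 1)) (deg g)" by (rule cx_module[OF PC_cx])
    have "h g = dP n (deg g) (T0 g) \<oplus>\<^bsub>obj (PC (n - 1)) (deg g)\<^esub> cx_ext R (PC (n - 1)) deg T0 (deg g) (D g)"
      using solutionD(2)[OF T g(1)] TJ[OF g] g by (simp add: T0_def)
    then show ?thesis
      unfolding H_def using gens[of g n] g system_h[OF S, of g n] by (simp add: M.M.r_neg)
  qed
  have WJ: "W n (deg g) (unit_vec R (g, False)) = \<zero>\<^bsub>obj (X n) (deg g)\<^esub>"
    if g: "g \<in> J" "od g = n" for g n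
  proof -
    interpret M: left_module R "obj (X n) (deg g)" by (rule cx_module[OF X_cx])
    have "u g = pP n (deg g) (T0 g)"
      using solutionD(3)[OF T g(1)] g by (simp add: T0_def)
    then show ?thesis
      unfolding W_def using gens[of g n] g system_u[OF S, of g n] by (simp add: M.M.r_neg)
  qed
  define h' where "h' g = H (od g) (deg g) (unit_vec R (g, False))" for g
  define u' where "u' g = W (od g) (deg g) (unit_vec R (g, False))" for g
  \<comment> \<open>The differential induced on the quotient; it is well defined because
    \<open>D\<close> maps \<open>J\<close> into the span of \<open>J\<close>.\<close>
  define D' where "D' g = ?q (od g - 1) (deg g) (D g)" for g
  have Hq: "H n m \<phi> = cx_ext R (PC (n - 1)) deg h' m (?q n m \<phi>)"
    if "\<phi> \<in> carrier (obj (fdc R ?G od deg n) m)" for n m \<phi>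
    by (rule factor[OF PC_cx H HJ _ that]) (simp_all add: h'_def)
  have Wq: "W n m \<phi> = cx_ext R (X n) deg u' m (?q n m \<phi>)"
    if "\<phi> \<in> carrier (obj (fdc R ?G od deg n) m)" for n m \<phi>
    by (rule factor[OF X_cx W WJ _ that]) (simp_all add: u'_def)
  have qD: "cmap R (fdc R ?G od deg n) (fdc R N od deg (n - 1))
      (\<lambda>m x. ?q (n - 1) m (cx_ext R (fdc R ?G od deg (n - 1)) deg D m x))" for n
    by (rule cmap_comp[OF eD q])
  have Dq: "?q (n - 1) m (cx_ext R (fdc R ?G od deg (n - 1)) deg D m \<phi>) =
      cx_ext R (fdc R N od deg (n - 1)) deg D' m (?q n m \<phi>)"
    if "\<phi> \<in> carrier (obj (fdc R ?G od deg n) m)" for n m \<phi>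
  proof (rule factor[OF free_cx_cx qD _ _ that])
    fix g assume g: "g \<in> J" "od g = n"
    have "?q (n - 1) (deg g) (D g) = \<zero>\<^bsub>obj (fdc R N od deg (n - 1)) (deg g)\<^esub>"
      by (rule killJ[OF free_cx_cx q _ J[OF g(1), unfolded g(2)]]) (simp add: q_J)
    then show "?q (n - 1) (deg g) (cx_ext R (fdc R ?G od deg (n - 1)) deg D (deg g) (unit_vec R (g, False))) =
        \<zero>\<^bsub>obj (fdc R N od deg (n - 1)) (deg g)\<^esub>"
      using gens(4)[of g n] g by simp
  next
    fix g assume g: "g \<in> N" "od g = n"
    then show "?q (n - 1) (deg g) (cx_ext R (fdc R ?G od deg (n - 1)) deg D (deg g) (unit_vec R (g, False))) = D' g"
      using gens(4)[of g n] by (simp add: D'_def)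
  qed
  have h'_N: "h' g = h g \<oplus>\<^bsub>obj (PC (n - 1)) (deg g)\<^esub> \<ominus>\<^bsub>obj (PC (n - 1)) (deg g)\<^esub>
      cx_ext R (PC (n - 1)) deg T0 (deg g) (D g)"
    "u' g = u g" if g: "g \<in> N" "od g = n" for g n
  proof -
    interpret M: left_module R "obj (PC (n - 1)) (deg g)" by (rule cx_module[OF PC_cx])
    interpret X: left_module R "obj (X n) (deg g)" by (rule cx_module[OF X_cx])
    have t: "T0 g = \<zero>\<^bsub>obj (PC n) (deg g)\<^esub>" using g disj by (auto simp: T0_def PC_zero)
    have "dP n (deg g) (T0 g) = \<zero>\<^bsub>obj (PC (n - 1)) (deg g)\<^esub>" "pP n (deg g) (T0 g) = \<zero>\<^bsub>obj (X n) (deg g)\<^esub>"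
      unfolding t by (rule cmap_zero[OF PC_cx PC_cx dP_cmap] cmap_zero[OF PC_cx X_cx pP_cmap])+
    then show "h' g = h g \<oplus>\<^bsub>obj (PC (n - 1)) (deg g)\<^esub> \<ominus>\<^bsub>obj (PC (n - 1)) (deg g)\<^esub>
      cx_ext R (PC (n - 1)) deg T0 (deg g) (D g)" "u' g = u g"
      unfolding h'_def u'_def H_def W_def
      using gens[of g n] g cmap_closed[OF eT0 system_D[OF S, of g n]] system_u[OF S, of g n]
      by simp_all
  qed
  have "system N od deg D' h' u'"
    unfolding system_def
  proof (intro ballI conjI)
    fix g assume g: "g \<in> N"
    define n m where nm: "n = od g" "m = deg g"
    have gG: "g \<in> ?G" using g by simp
    note Dg = systemD(1)[OF S gG, folded nm]
    have bg: "unit_vec R (g, False) \<in> carrier (obj (fdc R ?G od deg n) m)"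
      using unit_vec_free_cx[of g "{g \<in> ?G. od g = n}" deg] gG nm by simp
    show "D' g \<in> carrier (obj (fdc R N od deg (od g - 1)) (deg g))"
      unfolding D'_def by (rule cmap_closed[OF q systemD(1)[OF S gG]])
    show "h' g \<in> carrier (obj (PC (od g - 1)) (deg g))" "u' g \<in> carrier (obj (X (od g)) (deg g))"
      unfolding h'_def u'_def nm[symmetric] by (rule cmap_closed[OF H bg] cmap_closed[OF W bg])+
    have D2: "cx_ext R (fdc R ?G od deg (n - 2)) deg D m (D g) = (\<lambda>b. \<zero>)"
      using system_D2[OF S gG] nm by simp
    interpret M: left_module R "obj (PC (n - 1)) m" by (rule cx_module[OF PC_cx])
    interpret M2: left_module R "obj (PC (n - 2)) m" by (rule cx_module[OF PC_cx])
    interpret X: left_module R "obj (X (n - 1)) m" by (rule cx_module[OF X_cx])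
    have D'c: "D' g' \<in> carrier (obj (fdc R N od deg (n - 2)) (deg g'))" if "g' \<in> N" "od g' = n - 1" for g'
      using cmap_closed[OF q system_D[OF S, of g' "n - 1"]] that by (simp add: D'_def)
    have "cx_ext R (fdc R N od deg (n - 2)) deg D' m (D' g) = ?q (n - 2) m (cx_ext R (fdc R ?G od deg (n - 2)) deg D m (D g))"
      using Dq[OF Dg] nm by (simp add: D'_def)
    also have "\<dots> = (\<lambda>b. \<zero>)"
      unfolding D2 by (simp add: cx_ext_zero[OF free_cx_cx])
    also have "cx_ext R (fdc R N od deg (n - 2)) deg D' m (D' g) = cx_ext R (fdc R UNIV od deg (n - 2)) deg D' m (D' g)"
      by (rule cmap_cx_ext[OF free_cx_cx free_cx_cx cmap_free_cx_mono, where \<Gamma> = "{g \<in> N. od g = n - 1}" and deg = deg])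
        (use D'c cmap_closed[OF q Dg] nm in \<open>auto simp: D'_def simp del: free_cx_obj\<close>)
    finally show "cx_ext R (fdc R UNIV od deg (od g - 2)) deg D' (deg g) (D' g) = (\<lambda>b. \<zero>)"
      by (simp add: nm)
    have d: "cmap R (PC (n - 1)) (PC (n - 2)) (dP (n - 1))" using dP_cmap[of "n - 1"] by simp
    have hg: "h g \<in> carrier (obj (PC (n - 1)) m)" using systemD(2)[OF S gG] nm by simp
    have tD: "cx_ext R (PC (n - 1)) deg T0 m (D g) \<in> carrier (obj (PC (n - 1)) m)"
      by (rule cmap_closed[OF eT0 Dg])
    have h'g: "h' g = h g \<oplus>\<^bsub>obj (PC (n - 1)) m\<^esub> \<ominus>\<^bsub>obj (PC (n - 1)) m\<^esub> cx_ext R (PC (n - 1)) deg T0 m (D g)"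
      using h'_N[OF g, of n] nm by simp
    have "dP (n - 1) m (h' g) = dP (n - 1) m (h g) \<oplus>\<^bsub>obj (PC (n - 2)) m\<^esub> \<ominus>\<^bsub>obj (PC (n - 2)) m\<^esub>
        dP (n - 1) m (cx_ext R (PC (n - 1)) deg T0 m (D g))"
      unfolding h'g using hg tD by (simp add: cmap_add[OF d] cmap_minus[OF PC_cx PC_cx d])
    \<comment> \<open>\<open>H\<close> applied to \<open>D g\<close> also contains the term
      \<open>T0 D D g\<close>, which is zero.\<close>
    also have "\<dots> = H (n - 1) m (D g)"
    proof -
      have "cx_ext R (PC (n - 2)) deg T0 m (\<lambda>b. \<zero>) = \<zero>\<^bsub>obj (PC (n - 2)) m\<^esub>" by (rule cx_ext_zero[OF PC_cx])
      then show ?thesis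
        unfolding H_def using D2 systemD(5)[OF S gG, folded nm] cmap_closed[OF d tD] by simp
    qed
    also have "\<dots> = cx_ext R (PC (n - 2)) deg h' m (D' g)"
      using Hq[OF Dg] nm by (simp add: D'_def)
    finally show "dP (od g - 1) (deg g) (h' g) = cx_ext R (PC (od g - 2)) deg h' (deg g) (D' g)"
      by (simp add: nm)
    have dx: "dX n m (u g) \<in> carrier (obj (X (n - 1)) m)"
      using cmap_closed[OF dX_cmap systemD(3)[OF S gG]] nm by simp
    have ux: "cx_ext R (X (n - 1)) deg u m (D g) \<in> carrier (obj (X (n - 1)) m)"
      by (rule cmap_closed[OF eu Dg])
    have px: "pP (n - 1) m (cx_ext R (PC (n - 1)) deg T0 m (D g)) \<in> carrier (obj (X (n - 1)) m)"
      by (rule cmap_closed[OF pP_cmap tD])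
    have "pP (n - 1) m (h' g) = pP (n - 1) m (h g) \<oplus>\<^bsub>obj (X (n - 1)) m\<^esub> \<ominus>\<^bsub>obj (X (n - 1)) m\<^esub>
        pP (n - 1) m (cx_ext R (PC (n - 1)) deg T0 m (D g))"
      unfolding h'g using hg tD by (simp add: cmap_add[OF pP_cmap] cmap_minus[OF PC_cx X_cx pP_cmap])
    also have "\<dots> = dX n m (u g) \<oplus>\<^bsub>obj (X (n - 1)) m\<^esub> W (n - 1) m (D g)"
      unfolding W_def using systemD(6)[OF S gG, folded nm] dx ux px by (simp add: X.M.a_assoc)
    also have "\<dots> = dX n m (u' g) \<oplus>\<^bsub>obj (X (n - 1)) m\<^esub> cx_ext R (X (n - 1)) deg u' m (D' g)"
      using Wq[OF Dg] h'_N(2)[OF g] nm by (simp add: D'_def)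
    finally show "pP (od g - 1) (deg g) (h' g) = dX (od g) (deg g) (u' g)
       \<oplus>\<^bsub>obj (X (od g - 1)) (deg g)\<^esub> cx_ext R (X (od g - 1)) deg u' (deg g) (D' g)"
      by (simp add: nm)
  qed
  from solution_countable[OF N this] obtain T1 where T1: "solution N od deg D' h' u' T1" by blast
  define T' where "T' g = (if g \<in> J then T g else T1 g)" for g
  have T'J: "T' g = T g" if "g \<in> J" for g using that by (simp add: T'_def)
  have T'N: "T' g = T1 g" if "g \<in> N" for g using that disj by (auto simp: T'_def)
  have T'c: "T' g \<in> carrier (obj (PC n) (deg g))" if "g \<in> ?G" "od g = n" for g n
    using that solution_T[OF T _ that(2)] solution_T[OF T1 _ that(2)] T'J T'N by fastforce
  have eT1: "cmap R (fdc R N od deg n) (PC n) (cx_ext R (PC n) deg T1)" for n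
    by (rule cx_ext_cmap[OF PC_cx]) (use solution_T[OF T1] in blast)
  \<comment> \<open>The case distinction defining \<open>T'\<close> becomes a sum of chain maps,
    \<open>T0\<close> being zero on \<open>N\<close> and the projection being zero on
    \<open>J\<close>.\<close>
  have T'ext: "cx_ext R (PC n) deg T' m \<phi> = cx_ext R (PC n) deg T0 m \<phi> \<oplus>\<^bsub>obj (PC n) m\<^esub> cx_ext R (PC n) deg T1 m (?q n m \<phi>)"
    if "\<phi> \<in> carrier (obj (fdc R ?G od deg n) m)" for n m \<phi>
  proof (rule cmap_free_cx_eqI[OF PC_cx _ _ _ that])
    show "cmap R (fdc R ?G od deg n) (PC n) (cx_ext R (PC n) deg T')"
      by (rule cx_ext_cmap[OF PC_cx]) (use T'c in blast)
    show "cmap R (fdc R ?G od deg n) (PC n) (\<lambda>m \<phi>. cx_ext R (PC n) deg T0 m \<phi> \<oplus>\<^bsub>obj (PC n) m\<^esub> cx_ext R (PC n) deg T1 m (?q n m \<phi>))"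
      by (intro cmap_plus PC_cx eT0 cmap_comp[OF q eT1])
    fix g assume "g \<in> {g \<in> ?G. od g = n}"
    then have g: "g \<in> ?G" "od g = n" by auto
    interpret M: left_module R "obj (PC n) (deg g)" by (rule cx_module[OF PC_cx])
    have e: "cx_ext R (PC n) deg T' (deg g) (unit_vec R (g, False)) = T' g"
      by (intro cx_ext_gen PC_cx T'c[OF g])
    from g consider "g \<in> J" "od g = n" | "g \<in> N" "od g = n" by blast
    then show "cx_ext R (PC n) deg T' (deg g) (unit_vec R (g, False)) = cx_ext R (PC n) deg T0 (deg g) (unit_vec R (g, False))
      \<oplus>\<^bsub>obj (PC n) (deg g)\<^esub> cx_ext R (PC n) deg T1 (deg g) (?q n (deg g) (unit_vec R (g, False)))"
    proof cases
      case 1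
      then show ?thesis
        unfolding e using gens(2)[OF g] solution_T[OF T 1] by (simp add: q_J cx_ext_zero[OF PC_cx] T0_def T'_def)
    next
      case 2
      have "T0 g = \<zero>\<^bsub>obj (PC n) (deg g)\<^esub>" using 2 disj by (auto simp: T0_def PC_zero)
      moreover have "cx_ext R (PC n) deg T1 (deg g) (unit_vec R (g, False)) = T1 g"
        by (intro cx_ext_gen PC_cx solution_T[OF T1 2])
      ultimately show ?thesis
        unfolding e using gens(2)[OF g] solution_T[OF T1 2] T'N[OF 2(1)] 2 by (simp add: q_N)
    qed
  qed
  have "solution ?G od deg D h u T'"
    unfolding solution_def
  proof (intro ballI)
    fix g assume g: "g \<in> ?G"
    define n m where nm: "n = od g" "m = deg g"
    interpret M: left_module R "obj (PC (n - 1)) m" by (rule cx_module[OF PC_cx])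
    have "h g = dP n m (T' g) \<oplus>\<^bsub>obj (PC (n - 1)) m\<^esub> cx_ext R (PC (n - 1)) deg T' m (D g) \<and> u g = pP n m (T' g)"
    proof (cases "g \<in> J")
      case True
      have "cx_ext R (PC (n - 1)) deg T' m (D g) = cx_ext R (PC (n - 1)) deg T m (D g)"
        unfolding nm by (rule cx_ext_cong[OF PC_cx _ _ J[OF True]]) (use solution_T[OF T] T'J in auto)
      then show ?thesis using solutionD(2,3)[OF T True] T'J[OF True] nm by simp
    next
      case False
      then have gN: "g \<in> N" using g by blast
      note Dg = systemD(1)[OF S g, folded nm]
      have t0: "cx_ext R (PC (n - 1)) deg T0 m (D g) \<in> carrier (obj (PC (n - 1)) m)"
        by (rule cmap_closed[OF eT0 Dg])
      have t1: "cx_ext R (PC (n - 1)) deg T1 m (D' g) \<in> carrier (obj (PC (n - 1)) m)"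
        using cmap_closed[OF eT1 cmap_closed[OF q Dg]] nm by (simp add: D'_def)
      have dT: "dP n m (T' g) \<in> carrier (obj (PC (n - 1)) m)"
        using cmap_closed[OF dP_cmap T'c[OF g]] nm by simp
      have hg: "h g \<in> carrier (obj (PC (n - 1)) m)" using systemD(2)[OF S g] nm by simp
      have "h' g = dP n m (T' g) \<oplus>\<^bsub>obj (PC (n - 1)) m\<^esub> cx_ext R (PC (n - 1)) deg T1 m (D' g)"
        using solutionD(2)[OF T1 gN] T'N[OF gN] nm by simp
      moreover have "h g = h' g \<oplus>\<^bsub>obj (PC (n - 1)) m\<^esub> cx_ext R (PC (n - 1)) deg T0 m (D g)"
        unfolding h'_N(1)[OF gN nm(1)[symmetric], folded nm(2)] using hg t0 by (simp add: M.M.a_assoc M.M.l_neg)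
      moreover have "cx_ext R (PC (n - 1)) deg T' m (D g) =
          cx_ext R (PC (n - 1)) deg T0 m (D g) \<oplus>\<^bsub>obj (PC (n - 1)) m\<^esub> cx_ext R (PC (n - 1)) deg T1 m (D' g)"
        using T'ext[OF Dg] nm by (simp add: D'_def)
      ultimately have "h g = dP n m (T' g) \<oplus>\<^bsub>obj (PC (n - 1)) m\<^esub> cx_ext R (PC (n - 1)) deg T' m (D g)"
        using t0 t1 dT by (simp add: M.M.a_ac)
      moreover have "u g = pP n m (T' g)"
        using solutionD(3)[OF T1 gN] h'_N(2)[OF gN] T'N[OF gN] nm by simp
      ultimately show ?thesis by blast
    qed
    then show "T' g \<in> carrier (obj (PC (od g)) (deg g)) \<and>
     h g = dP (od g) (deg g) (T' g)
       \<oplus>\<^bsub>obj (PC (od g - 1)) (deg g)\<^esub> cx_ext R (PC (od g - 1)) deg T' (deg g) (D g) \<and>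
     u g = pP (od g) (deg g) (T' g)"
      using T'c[OF g] nm by simp
  qed
  then show ?thesis using T'J by blast
qed

text \<open>Each \<open>D g\<close> has finite support, so the relation of occurring in
  \<open>D g\<close> has finite branching and everything reachable from \<open>g0\<close> is
  countable.\<close>

lemma countable_closure:
  fixes \<Gamma> :: "'g set"
  assumes S: "system \<Gamma> od deg D h u" and g0: "g0 \<in> \<Gamma>"
  shows "\<exists>C\<subseteq>\<Gamma>. countable C \<and> g0 \<in> C \<and> (\<forall>g\<in>C. \<forall>b. D g b \<noteq> \<zero> \<longrightarrow> fst b \<in> C)"
proof -
  define r where "r = {(g, g'). g \<in> \<Gamma> \<and> g' \<in> fst ` {b. D g b \<noteq> \<zero>}}"
  have fin: "finite {b. D g b \<noteq> \<zero>}" if "g \<in> \<Gamma>" for g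
    using systemD(1)[OF S that] by (simp add: free_mod_carrier)
  have sub: "fst b \<in> \<Gamma>" if "g \<in> \<Gamma>" "D g b \<noteq> \<zero>" for g b
    using systemD(1)[OF S that(1)] that(2) unfolding free_cx_obj free_mod_carrier by blast
  have "countable (r `` Y)" if "countable Y" for Y
  proof -
    have "r `` Y \<subseteq> (\<Union>g\<in>Y \<inter> \<Gamma>. fst ` {b. D g b \<noteq> \<zero>})" by (auto simp: r_def)
    moreover have "countable (\<Union>g\<in>Y \<inter> \<Gamma>. fst ` {b. D g b \<noteq> \<zero>})"
      using that fin by (intro countable_UN) (auto intro: countable_finite)
    ultimately show ?thesis by (rule countable_subset)
  qed
  then have "countable (r\<^sup>* `` {g0})" by (rule countable_rtrancl) (simp_all add: countable_finite)
  moreover have C: "r\<^sup>* `` {g0} \<subseteq> \<Gamma>"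
  proof
    fix g assume "g \<in> r\<^sup>* `` {g0}"
    then have "(g0, g) \<in> r\<^sup>*" by simp
    then show "g \<in> \<Gamma>" by induct (use g0 sub in \<open>auto simp: r_def\<close>)
  qed
  moreover have "fst b \<in> r\<^sup>* `` {g0}" if "g \<in> r\<^sup>* `` {g0}" "D g b \<noteq> \<zero>" for g b
  proof -
    have "(g, fst b) \<in> r" using that C by (auto simp: r_def)
    then show ?thesis using that(1) by (auto intro: rtrancl_into_rtrancl)
  qed
  ultimately show ?thesis by blast
qed

theorem solution_exists:
  fixes \<Gamma> :: "'g set"
  assumes S: "system \<Gamma> od deg D h u"
  shows "\<exists>T. solution \<Gamma> od deg D h u T"
proof -
  define cl where "cl J \<longleftrightarrow> J \<subseteq> \<Gamma> \<and> (\<forall>g\<in>J. \<forall>b. D g b \<noteq> \<zero> \<longrightarrow> fst b \<in> J)" for J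
  have clD: "D g \<in> carrier (obj (fdc R J od deg (od g - 1)) (deg g))" if "cl J" "g \<in> J" for J g
  proof (rule free_cx_restrict[OF systemD(1)[OF S]])
    show g: "g \<in> \<Gamma>" using that by (auto simp: cl_def)
    fix b assume b: "D g b \<noteq> \<zero>"
    have "fst b \<in> {g' \<in> \<Gamma>. od g' = od g - 1}"
      using systemD(1)[OF S g] b unfolding free_cx_obj free_mod_carrier by blast
    then show "fst b \<in> {g' \<in> J. od g' = od g - 1}" using that b unfolding cl_def by blast
  qed
  \<comment> \<open>Of all clauses only the one on the support of \<open>D g\<close> mentions the
    index set, and closedness of \<open>J\<close> supplies it.\<close>
  have sysJ: "system J od deg D h u" if "cl J" for J
    unfolding system_def using clD[OF that] S[unfolded system_def] that[unfolded cl_def] by blast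
  \<comment> \<open>Partial solutions are represented by their graphs, so that extension of
    solutions is inclusion of sets.\<close>
  define A where "A = {G. \<exists>J T. cl J \<and> solution J od deg D h u T \<and> G = (\<lambda>g. (g, T g)) ` J}"
  have "\<exists>M\<in>A. \<forall>Y\<in>A. M \<subseteq> Y \<longrightarrow> Y = M"
  proof (rule subset_Zorn_nonempty)
    have "cl {}" "solution {} od deg D h u (\<lambda>_. undefined)" by (auto simp: cl_def solution_def)
    then show "A \<noteq> {}" by (auto simp: A_def)
  next
    fix \<C> assume C: "\<C> \<noteq> {}" "subset.chain A \<C>"
    define J where "J = fst ` \<Union>\<C>"
    define T where "T g = (SOME t. (g, t) \<in> \<Union>\<C>)" for g
    have uniq: "t = t'" if "(g, t) \<in> \<Union>\<C>" "(g, t') \<in> \<Union>\<C>" for g t t'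
    proof -
      from that obtain G G' where G: "G \<in> \<C>" "G' \<in> \<C>" "(g, t) \<in> G" "(g, t') \<in> G'" by blast
      then have "G \<subseteq> G' \<or> G' \<subseteq> G" using C(2) by (auto simp: subset_chain_def)
      then obtain G'' where "G'' \<in> \<C>" "(g, t) \<in> G''" "(g, t') \<in> G''" using G by blast
      then show ?thesis using C(2) by (auto simp: subset_chain_def A_def)
    qed
    have T: "T g = t" if "(g, t) \<in> \<Union>\<C>" for g t
      unfolding T_def using uniq[OF that] someI[of "\<lambda>t. (g, t) \<in> \<Union>\<C>", OF that] by blast
    have ex: "\<exists>J1\<subseteq>J. cl J1 \<and> g \<in> J1 \<and> solution J1 od deg D h u T" if "g \<in> J" for g
    proof -
      from that obtain t G where G: "G \<in> \<C>" "(g, t) \<in> G" by (auto simp: J_def)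
      then obtain J1 T1 where J1: "cl J1" "solution J1 od deg D h u T1" "G = (\<lambda>g. (g, T1 g)) ` J1"
        using C(2) by (auto simp: subset_chain_def A_def)
      have e: "T g = T1 g" if "g \<in> J1" for g
        using T[of g "T1 g"] that G(1) J1(3) by blast
      have "J1 \<subseteq> J" using G(1) J1(3) by (force simp: J_def)
      moreover have "solution J1 od deg D h u T"
        unfolding solution_def
      proof (intro ballI)
        fix g assume g: "g \<in> J1"
        \<comment> \<open>The equation at \<open>g\<close> involves \<open>T\<close> only at
          \<open>g\<close> and on the support of \<open>D g\<close>, which stays in the domain of a
          single member of the chain.\<close>
        have "cx_ext R (PC (od g - 1)) deg T (deg g) (D g) = cx_ext R (PC (od g - 1)) deg T1 (deg g) (D g)"
          by (rule cx_ext_cong[OF PC_cx _ _ clD[OF J1(1) g]]) (use solution_T[OF J1(2)] e in auto)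
        then show "T g \<in> carrier (obj (PC (od g)) (deg g)) \<and>
          h g = dP (od g) (deg g) (T g)
            \<oplus>\<^bsub>obj (PC (od g - 1)) (deg g)\<^esub> cx_ext R (PC (od g - 1)) deg T (deg g) (D g) \<and>
          u g = pP (od g) (deg g) (T g)"
          using solutionD[OF J1(2) g] e[OF g] by simp
      qed
      moreover have "g \<in> J1" using G(2) J1(3) by auto
      ultimately show ?thesis using J1(1) by blast
    qed
    have "cl J" unfolding cl_def using ex by (fastforce simp: cl_def)
    moreover have "solution J od deg D h u T"
      unfolding solution_def
    proof (intro ballI)
      fix g assume "g \<in> J"
      then obtain J1 where "g \<in> J1" "solution J1 od deg D h u T" using ex by blast
      then show "T g \<in> carrier (obj (PC (od g)) (deg g)) \<and>
          h g = dP (od g) (deg g) (T g)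
            \<oplus>\<^bsub>obj (PC (od g - 1)) (deg g)\<^esub> cx_ext R (PC (od g - 1)) deg T (deg g) (D g) \<and>
          u g = pP (od g) (deg g) (T g)"
        by (simp add: solution_def)
    qed
    moreover have "\<Union>\<C> = (\<lambda>g. (g, T g)) ` J"
      using T by (force simp: J_def image_iff)
    ultimately show "\<Union>\<C> \<in> A" unfolding A_def by blast
  qed
  then obtain M where M: "M \<in> A" "\<And>Y. Y \<in> A \<Longrightarrow> M \<subseteq> Y \<Longrightarrow> Y = M" by blast
  then obtain J T where J: "cl J" "solution J od deg D h u T" "M = (\<lambda>g. (g, T g)) ` J"
    by (auto simp: A_def)
  have "J = \<Gamma>"
  proof (rule ccontr)
    assume "J \<noteq> \<Gamma>"
    then obtain g0 where g0: "g0 \<in> \<Gamma>" "g0 \<notin> J" using J(1) by (auto simp: cl_def)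
    obtain C where C: "C \<subseteq> \<Gamma>" "countable C" "g0 \<in> C" "\<forall>g\<in>C. \<forall>b. D g b \<noteq> \<zero> \<longrightarrow> fst b \<in> C"
      using countable_closure[OF S g0(1)] by blast
    \<comment> \<open>The union is closed under \<open>D\<close> although \<open>C - J\<close> alone
      need not be.\<close>
    have clJ: "cl (J \<union> (C - J))" using C(1,4) J(1) unfolding cl_def by blast
    obtain T' where T': "solution (J \<union> (C - J)) od deg D h u T'" "\<forall>g\<in>J. T' g = T g"
      using solution_extend[OF sysJ[OF clJ] _ _ clD[OF J(1)] J(2)] C(2) by blast
    have "(\<lambda>g. (g, T' g)) ` (J \<union> (C - J)) \<in> A" using clJ T'(1) by (auto simp: A_def)
    moreover have "M \<subseteq> (\<lambda>g. (g, T' g)) ` (J \<union> (C - J))" using T'(2) J(3) by auto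
    ultimately have "(g0, T' g0) \<in> M" using M(2) g0 C(3) by blast
    then show False using J(3) g0 by auto
  qed
  then show ?thesis using J(2) by blast
qed

end

section \<open>Cardinality\<close>

lemma card_less_mono: "A \<subseteq> B \<Longrightarrow> |B| <o \<kappa> \<Longrightarrow> |A| <o \<kappa>"
  by (rule ordLeq_ordLess_trans[OF card_of_mono1])

lemma card_less_image: "|A| <o \<kappa> \<Longrightarrow> |f ` A| <o \<kappa>"
  by (rule ordLeq_ordLess_trans[OF card_of_image])

lemma card_less_inj: "inj_on f A \<Longrightarrow> f ` A \<subseteq> B \<Longrightarrow> |B| <o \<kappa> \<Longrightarrow> |A| <o \<kappa>"
  by (rule ordLeq_ordLess_trans) (auto simp: card_of_ordLeq[symmetric])

text \<open>A cardinal below \<open>\<kappa>\<close> is represented by a subset of the type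
  \<open>'u\<close> on which \<open>\<kappa>\<close> is a relation; this is what brings constructed
  modules back into the universe.\<close>

lemma card_less_embed:
  fixes \<kappa> :: "'u rel"
  assumes "|A| <o \<kappa>"
  shows "\<exists>e :: 'a \<Rightarrow> 'u. inj_on e A"
proof -
  obtain B :: "'u set" where "|A| =o |B|"
    using assms internalize_card_of_ordLess[of A \<kappa>] by blast
  then show ?thesis
    by (auto simp: card_of_ordIso[symmetric] bij_betw_def)
qed

context
  fixes \<kappa> :: "'u rel"
  assumes univ: "universe_cardinal \<kappa>"
begin

lemma univ_infinite: "\<not> finite (Field \<kappa>)"
  using univ cinfinite_def cinfinite_mono natLeq_cinfinite ordLess_imp_ordLeq
  unfolding universe_cardinal_def by blast

lemma card_less_Un: "|A| <o \<kappa> \<Longrightarrow> |B| <o \<kappa> \<Longrightarrow> |A \<union> B| <o \<kappa>"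
  using card_of_Un_ordLess_infinite_Field[OF univ_infinite] univ
  unfolding universe_cardinal_def by blast

lemma card_less_countable:
  assumes "countable A"
  shows "|A| <o \<kappa>"
proof -
  have "|A| \<le>o |UNIV :: nat set|"
    using assms by (auto simp: countable_def card_of_ordLeq[symmetric])
  also have "|UNIV :: nat set| =o natLeq" by (rule card_of_nat)
  finally show ?thesis
    using univ ordLeq_ordLess_trans unfolding universe_cardinal_def by blast
qed

lemma card_less_UN:
  assumes "countable I" "\<And>i. i \<in> I \<Longrightarrow> |A i| <o \<kappa>"
  shows "|\<Union>i\<in>I. A i| <o \<kappa>"
proof (rule card_of_UNION_ordLess_infinite_Field_regularCard)
  show "regularCard \<kappa>" "Cinfinite \<kappa>"
    using univ univ_infinite unfolding universe_cardinal_def cinfinite_def by auto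
qed (use card_less_countable[OF assms(1)] assms(2) in auto)

lemma card_less_fun:
  fixes A :: "'a set"
  assumes "|A| <o \<kappa>"
  shows "|{f :: 'i :: countable \<Rightarrow> 'a. range f \<subseteq> A}| <o \<kappa>"
proof -
  obtain B :: "'u set" where B: "|A| =o |B|" "|B| <o \<kappa>"
    using assms internalize_card_of_ordLess[of A \<kappa>] by blast
  have "|A| ^c natLeq \<le>o |B| ^c natLeq"
    by (rule cexp_mono1[OF ordIso_imp_ordLeq[OF B(1)] natLeq_Card_order])
  also have "|B| ^c natLeq <o \<kappa>"
    using univ B(2) unfolding universe_cardinal_def by blast
  finally have "|Func (UNIV :: nat set) A| <o \<kappa>"
    by (simp add: cexp_def Field_natLeq Field_card_of)
  then show ?thesis
  proof (rule card_less_inj[rotated 2])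
    \<comment> \<open>Precomposition with the surjection \<open>from_nat\<close> embeds functions on
      any countable type into sequences.\<close>
    show "inj_on (\<lambda>f. f \<circ> from_nat) {f :: 'i \<Rightarrow> 'a. range f \<subseteq> A}"
      by (rule inj_onI) (metis comp_apply ext from_nat_to_nat)
  qed (auto simp: Func_def)
qed

text \<open>A pair is a function on \<open>bool\<close> into the disjoint sum, so products reduce to
  countable powers.\<close>

lemma card_less_Times:
  assumes "|A| <o \<kappa>" "|B| <o \<kappa>"
  shows "|A \<times> B| <o \<kappa>"
proof (rule card_less_inj)
  show "|{f :: bool \<Rightarrow> _. range f \<subseteq> Inl ` A \<union> Inr ` B}| <o \<kappa>"
    by (intro card_less_fun card_less_Un card_less_image assms)
  show "inj_on (\<lambda>x b. if b then Inl (fst x) else Inr (snd x)) (A \<times> B)"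
    by (rule inj_onI) (metis Inl_inject Inr_inject prod_eqI)
qed auto

text \<open>A vector is recovered from a sequence enumerating its support together with the
  coefficients. The zero vector, having nothing to enumerate, is coded by the constant sequence
  \<open>None\<close>.\<close>

lemma card_less_free_mod:
  assumes "|carrier R| <o \<kappa>" "|S| <o \<kappa>"
  shows "|carrier (free_mod R S)| <o \<kappa>"
proof -
  let ?supp = "\<lambda>\<phi>. {b. \<phi> b \<noteq> \<zero>\<^bsub>R\<^esub>}"
  let ?f = "\<lambda>\<phi> (n :: nat). if ?supp \<phi> = {} then None
    else Some (from_nat_into (?supp \<phi>) n, \<phi> (from_nat_into (?supp \<phi>) n))"
  have small: "|{s :: nat \<Rightarrow> _. range s \<subseteq> {None} \<union> Some ` (S \<times> carrier R)}| <o \<kappa>"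
    by (intro card_less_fun card_less_Un card_less_image card_less_Times assms card_less_countable) auto
  have graph: "\<psi> b = \<phi> b" if "\<phi> \<in> carrier (free_mod R S)" "?f \<phi> = ?f \<psi>" "\<phi> b \<noteq> \<zero>\<^bsub>R\<^esub>" for \<phi> \<psi> b
  proof -
    have b: "b \<in> ?supp \<phi>" "countable (?supp \<phi>)"
      using that by (auto simp: free_mod_carrier intro: countable_finite)
    then obtain n where "b = from_nat_into (?supp \<phi>) n"
      by (metis from_nat_into_surj)
    moreover have "?supp \<phi> \<noteq> {}" using b by blast
    ultimately have "Some (b, \<phi> b) = ?f \<phi> n" by simp
    also have "\<dots> = ?f \<psi> n" by (rule fun_cong[OF that(2)])
    finally have "Some (b, \<phi> b) = ?f \<psi> n" .
    then show ?thesis by (auto split: if_splits)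
  qed
  show ?thesis
  proof (rule card_less_inj[OF _ _ small])
    show "inj_on ?f (carrier (free_mod R S))"
    proof (rule inj_onI, rule ext)
      fix \<phi> \<psi> b assume *: "\<phi> \<in> carrier (free_mod R S)" "\<psi> \<in> carrier (free_mod R S)" "?f \<phi> = ?f \<psi>"
      show "\<phi> b = \<psi> b"
        using graph[OF *(1) *(3), of b] graph[OF *(2) *(3)[symmetric], of b] by metis
    qed
    show "?f ` carrier (free_mod R S) \<subseteq> {s. range s \<subseteq> {None} \<union> Some ` (S \<times> carrier R)}"
    proof (rule image_subsetI)
      fix \<phi> assume \<phi>: "\<phi> \<in> carrier (free_mod R S)"
      have "from_nat_into (?supp \<phi>) n \<in> ?supp \<phi>" if "?supp \<phi> \<noteq> {}" for n
        using that by (rule from_nat_into)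
      moreover have "\<phi> b \<in> carrier R" "\<phi> b \<noteq> \<zero>\<^bsub>R\<^esub> \<Longrightarrow> b \<in> S" for b
        using \<phi> by (auto simp: free_mod_carrier)
      ultimately show "?f \<phi> \<in> {s. range s \<subseteq> {None} \<union> Some ` (S \<times> carrier R)}"
        by fastforce
    qed
  qed
qed

end

section \<open>Counting trees by their labels\<close>

primrec paths :: "('r, 'u) gen \<Rightarrow> nat list \<Rightarrow>
    ((nat \<Rightarrow> nat \<times> bool \<Rightarrow> 'r) \<times> (nat \<Rightarrow> int \<times> int) \<times> (nat \<Rightarrow> 'u) \<times> (nat \<Rightarrow> nat \<times> bool \<Rightarrow> 'r) \<times> nat) option" where
  "paths Leaf = (\<lambda>p. None)"
| "paths (Node a dg u c k ch) = (\<lambda>p. case p of [] \<Rightarrow> Some (a, dg, u, c, k) | i # q \<Rightarrow> paths (ch i) q)"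

text \<open>The label at the empty address gives the data of the root, and addresses starting with
  \<open>i\<close> give the \<open>i\<close>-th child, to which induction applies. Addresses form a
  countable type, so one countable power bounds all trees at once.\<close>

lemma paths_inj: "paths g = paths g' \<Longrightarrow> g = g'"
proof (induct g arbitrary: g')
  case Leaf
  then show ?case by (cases g') (auto dest: fun_cong[of _ _ "[]"])
next
  case (Node a dg u c k ch)
  show ?case
  proof (cases g')
    case Leaf
    then show ?thesis using fun_cong[OF Node(2), of "[]"] by simp
  next
    case (Node a' dg' u' c' k' ch')
    note e = fun_cong[OF \<open>paths (gen.Node a dg u c k ch) = paths g'\<close>]
    have "paths (ch i) = paths (ch' i)" for i
      using e[of "i # _"] Node by (intro ext) simp
    then have "ch i = ch' i" for i using \<open>\<And>x g'. x \<in> range ch \<Longrightarrow> paths x = paths g' \<Longrightarrow> x = g'\<close> by blast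
    then show ?thesis using e[of "[]"] Node by auto
  qed
qed

context dcx
begin

text \<open>Labels of valid trees are countable families from \<open>R\<close>, from the small
  modules of \<open>X\<close> and from countable sets, so there are fewer than
  \<open>\<kappa>\<close> labels, then trees, then vectors. The union over all degrees is bounded so
  that a single embedding can serve every degree.\<close>

lemma small_PC:
  fixes \<kappa> :: "'v rel"
  assumes univ: "universe_cardinal \<kappa>" and R: "|carrier R| <o \<kappa>"
    and X: "\<And>n m. |carrier (obj (X n) m)| <o \<kappa>"
  shows "|\<Union>n m. carrier (obj (PC n) m)| <o \<kappa>"
proof -
  define XX where "XX = (\<Union>nm\<in>UNIV. carrier (obj (X (fst nm)) (snd nm)))"
  have XX: "|XX| <o \<kappa>" unfolding XX_def by (intro card_less_UN[OF univ] X) auto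
  define L where "L = {a :: nat \<Rightarrow> nat \<times> bool \<Rightarrow> 'r. range a \<subseteq> {f. range f \<subseteq> carrier R}} \<times>
    (UNIV :: (nat \<Rightarrow> int \<times> int) set) \<times> {u :: nat \<Rightarrow> 'u. range u \<subseteq> XX} \<times>
    {a :: nat \<Rightarrow> nat \<times> bool \<Rightarrow> 'r. range a \<subseteq> {f. range f \<subseteq> carrier R}} \<times> (UNIV :: nat set)"
  have "|{f :: nat \<Rightarrow> int \<times> int. range f \<subseteq> UNIV}| <o \<kappa>"
    by (intro card_less_fun[OF univ] card_less_countable[OF univ]) auto
  then have "|UNIV :: (nat \<Rightarrow> int \<times> int) set| <o \<kappa>" by simp
  then have L: "|L| <o \<kappa>"
    unfolding L_def by (intro card_less_Times[OF univ] card_less_fun[OF univ] R XX) (auto intro: card_less_countable[OF univ])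
  have paths: "paths g p \<in> {None} \<union> Some ` L" if "valid g" for g p
    using that
  proof (induct g arbitrary: p)
    case (Node a dg u c k ch)
    have "(a, dg, u, c, k) \<in> L"
    proof -
      \<comment> \<open>Bounds by the carrier, not just by the type \<open>'r\<close>, are essential
        here, since only the carrier is assumed to be small.\<close>
      have "a j b \<in> carrier R" "c j b \<in> carrier R" for j b
        using Node(2) unfolding valid.simps good_def free_cx_obj free_mod_carrier by (metis prod.collapse)+
      moreover have "u j \<in> XX" for j
        unfolding XX_def using good_u[of a dg u c ch j] Node(2) by (intro UN_I[of "dg j"]) auto
      ultimately show ?thesis by (auto simp: L_def)
    qed
    then show ?case using Node by (auto split: list.split)
  qed simp
  have "|{F :: nat list \<Rightarrow> _. range F \<subseteq> {None} \<union> Some ` L}| <o \<kappa>"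
    by (intro card_less_fun[OF univ] card_less_Un[OF univ] card_less_image L card_less_countable[OF univ]) auto
  then have "|{g. valid g}| <o \<kappa>"
    by (rule card_less_inj[rotated 2, where f = paths]) (use paths in \<open>auto intro!: inj_onI paths_inj\<close>)
  then have "|carrier (free_mod R ({g. valid g} \<times> (UNIV :: bool set)))| <o \<kappa>"
    by (intro card_less_free_mod[OF univ R] card_less_Times[OF univ]) (auto intro: card_less_countable[OF univ])
  moreover have "(\<Union>n m. carrier (obj (PC n) m)) \<subseteq> carrier (free_mod R ({g. valid g} \<times> UNIV))"
    by (force simp: PC_def free_mod_carrier)
  ultimately show ?thesis by (rule card_less_mono[rotated])
qed

end

section \<open>Universal arrows and homotopy categories\<close>

lemma category_restrict: "is_category D \<Longrightarrow> S \<subseteq> Ob D \<Longrightarrow> is_category (D\<lparr>Ob := S\<rparr>)"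
  unfolding is_category_def by (simp add: subset_iff)

text \<open>A universal arrow from the full subcategory to every object determines the adjoint: its
  value on an arrow is the unique lift, and the adjunction bijection inverts composition with the
  universal arrow.\<close>

lemma right_adjoint_if_universal:
  fixes D :: "('o, 'm) category"
  assumes D: "is_category D" and S: "S \<subseteq> Ob D"
    and univ: "\<And>Y. Y \<in> Ob D \<Longrightarrow> \<exists>P\<in>S. \<exists>p\<in>Hom D P Y. \<forall>Q\<in>S. bij_betw (Comp D Q P Y p) (Hom D Q P) (Hom D Q Y)"
  shows "has_right_adjoint (D\<lparr>Ob := S\<rparr>) D inclusion_functor"
proof -
  have "\<exists>P p. \<forall>Y\<in>Ob D. P Y \<in> S \<and> p Y \<in> Hom D (P Y) Y \<and>
      (\<forall>Q\<in>S. bij_betw (Comp D Q (P Y) Y (p Y)) (Hom D Q (P Y)) (Hom D Q Y))"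
    using univ by metis
  then obtain P p where PC: "\<forall>Y\<in>Ob D. P Y \<in> S \<and> p Y \<in> Hom D (P Y) Y \<and>
      (\<forall>Q\<in>S. bij_betw (Comp D Q (P Y) Y (p Y)) (Hom D Q (P Y)) (Hom D Q Y))"
    by blast
  then have P: "P Y \<in> S" and p: "p Y \<in> Hom D (P Y) Y"
    and bij: "\<And>Q. Q \<in> S \<Longrightarrow> bij_betw (Comp D Q (P Y) Y (p Y)) (Hom D Q (P Y)) (Hom D Q Y)"
    if "Y \<in> Ob D" for Y
    using that by blast+
  have idn: "Idn D Y \<in> Hom D Y Y" if "Y \<in> Ob D" for Y
    using D that by (simp add: is_category_def)
  have comp: "Comp D W Y Z g f \<in> Hom D W Z"
    if "W \<in> Ob D" "Y \<in> Ob D" "Z \<in> Ob D" "f \<in> Hom D W Y" "g \<in> Hom D Y Z" for W Y Z f g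
    using D that by (simp add: is_category_def)
  have unit: "Comp D Y Y Z f (Idn D Y) = f" "Comp D Y Z Z (Idn D Z) f = f"
    if "Y \<in> Ob D" "Z \<in> Ob D" "f \<in> Hom D Y Z" for Y Z f
    using D that by (simp_all add: is_category_def)
  have assoc: "Comp D W X Z (Comp D X Y Z h g) f = Comp D W Y Z h (Comp D W X Y g f)"
    if "W \<in> Ob D" "X \<in> Ob D" "Y \<in> Ob D" "Z \<in> Ob D" "f \<in> Hom D W X" "g \<in> Hom D X Y" "h \<in> Hom D Y Z"
    for W X Y Z f g h
    using D that by (simp add: is_category_def)
  define \<phi> where "\<phi> Q Y = inv_into (Hom D Q (P Y)) (Comp D Q (P Y) Y (p Y))" for Q Y
  have \<phi>: "\<phi> Q Y h \<in> Hom D Q (P Y)" "Comp D Q (P Y) Y (p Y) (\<phi> Q Y h) = h"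
    if "Q \<in> S" "Y \<in> Ob D" "h \<in> Hom D Q Y" for Q Y h
    using bij[OF that(2,1)] that(3) unfolding \<phi>_def bij_betw_def
    by (auto intro: inv_into_into f_inv_into_f)
  \<comment> \<open>Functoriality and both naturality laws come down to comparing composites with
    the universal arrow and cancelling it.\<close>
  have uniq: "f = f'" if "Q \<in> S" "Y \<in> Ob D" "f \<in> Hom D Q (P Y)" "f' \<in> Hom D Q (P Y)"
    "Comp D Q (P Y) Y (p Y) f = Comp D Q (P Y) Y (p Y) f'" for Q Y f f'
    using bij[OF that(2,1)] that unfolding bij_betw_def inj_on_def by blast
  have PO: "P Y \<in> Ob D" if "Y \<in> Ob D" for Y using P[OF that] S by blast
  have pc: "Comp D (P Y) Y Y' v (p Y) \<in> Hom D (P Y) Y'"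
    if "Y \<in> Ob D" "Y' \<in> Ob D" "v \<in> Hom D Y Y'" for Y Y' v
    using comp p PO that by blast
  define G where "G = \<lparr>on_Ob = P, on_Hom = (\<lambda>Y Y' v. \<phi> (P Y) Y' (Comp D (P Y) Y Y' v (p Y)))\<rparr>"
  note G = \<phi>[OF P _ pc]
  let ?C = "D\<lparr>Ob := S\<rparr>"
  have C: "is_category ?C" by (rule category_restrict[OF D S])
  have SO: "Q \<in> Ob D" if "Q \<in> S" for Q using that S by blast
  have "is_functor ?C D inclusion_functor"
    using C D S unfolding is_functor_def inclusion_functor_def by auto
  moreover have "is_functor D ?C G"
    unfolding is_functor_def
  proof (intro conjI ballI)
    fix Y assume Y: "Y \<in> Ob D"
    show "on_Hom G Y Y (Idn D Y) = Idn ?C (on_Ob G Y)"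
      unfolding G_def cfunctor.simps
      by (rule uniq[OF P[OF Y] Y]) (use Y G[OF Y Y Y Y idn[OF Y]] idn PO p unit in auto)
  next
    fix X Y Z f g assume *: "X \<in> Ob D" "Y \<in> Ob D" "Z \<in> Ob D" "f \<in> Hom D X Y" "g \<in> Hom D Y Z"
    note Gf = G[OF *(1,2,1,2,4)] and Gg = G[OF *(2,3,2,3,5)]
    have gf: "Comp D X Y Z g f \<in> Hom D X Z" using comp * by blast
    note Ggf = G[OF *(1,3,1,3) gf]
    let ?f = "\<phi> (P X) Y (Comp D (P X) X Y f (p X))" and ?g = "\<phi> (P Y) Z (Comp D (P Y) Y Z g (p Y))"
    have "Comp D (P X) (P Z) Z (p Z) (Comp D (P X) (P Y) (P Z) ?g ?f) =
        Comp D (P X) (P Y) Z (Comp D (P Y) (P Z) Z (p Z) ?g) ?f"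
      by (rule assoc[OF PO[OF *(1)] PO[OF *(2)] PO[OF *(3)] *(3) Gf(1) Gg(1) p[OF *(3)], symmetric])
    also have "\<dots> = Comp D (P X) Y Z g (Comp D (P X) (P Y) Y (p Y) ?f)"
      unfolding Gg(2) by (rule assoc[OF PO[OF *(1)] PO[OF *(2)] *(2,3) Gf(1) p[OF *(2)] *(5)])
    also have "\<dots> = Comp D (P X) X Z (Comp D X Y Z g f) (p X)"
      unfolding Gf(2) by (rule assoc[OF PO[OF *(1)] *(1,2,3) p[OF *(1)] *(4,5), symmetric])
    also have "\<dots> = Comp D (P X) (P Z) Z (p Z) (\<phi> (P X) Z (Comp D (P X) X Z (Comp D X Y Z g f) (p X)))"
      unfolding Ggf(2) ..
    finally have "\<phi> (P X) Z (Comp D (P X) X Z (Comp D X Y Z g f) (p X)) = Comp D (P X) (P Y) (P Z) ?g ?f"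
      by (rule uniq[OF P[OF *(1)] *(3) Ggf(1)
            comp[OF PO[OF *(1)] PO[OF *(2)] PO[OF *(3)] Gf(1) Gg(1)] sym])
    then show "on_Hom G X Z (Comp D X Y Z g f) =
        Comp ?C (on_Ob G X) (on_Ob G Y) (on_Ob G Z) (on_Hom G Y Z g) (on_Hom G X Y f)"
      by (simp add: G_def)
  next
    show "is_category D" "is_category ?C" by (rule D C)+
    show "on_Ob G Y \<in> Ob ?C" if "Y \<in> Ob D" for Y using P[OF that] by (simp add: G_def)
    show "on_Hom G Y Z v \<in> Hom ?C (on_Ob G Y) (on_Ob G Z)"
      if "Y \<in> Ob D" "Z \<in> Ob D" "v \<in> Hom D Y Z" for Y Z v
      using G(1)[OF that(1,2,1,2,3)] by (simp add: G_def)
  qed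
  moreover have "bij_betw (\<phi> Q Y) (Hom D Q Y) (Hom D Q (P Y))" if "Q \<in> S" "Y \<in> Ob D" for Q Y
    unfolding \<phi>_def by (rule bij_betw_inv_into[OF bij[OF that(2,1)]])
  moreover have "\<phi> Q' Y (Comp D Q' Q Y h w) = Comp D Q' Q (P Y) (\<phi> Q Y h) w"
    if "Q \<in> S" "Q' \<in> S" "Y \<in> Ob D" "w \<in> Hom D Q' Q" "h \<in> Hom D Q Y" for Q Q' Y w h
  proof (rule uniq[OF that(2,3)])
    note h = \<phi>[OF that(1,3,5)]
    have hw: "Comp D Q' Q Y h w \<in> Hom D Q' Y" using comp SO that by blast
    show "\<phi> Q' Y (Comp D Q' Q Y h w) \<in> Hom D Q' (P Y)" by (rule \<phi>(1)[OF that(2,3) hw])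
    show "Comp D Q' Q (P Y) (\<phi> Q Y h) w \<in> Hom D Q' (P Y)" using comp SO PO that h(1) by blast
    show "Comp D Q' (P Y) Y (p Y) (\<phi> Q' Y (Comp D Q' Q Y h w)) =
        Comp D Q' (P Y) Y (p Y) (Comp D Q' Q (P Y) (\<phi> Q Y h) w)"
      unfolding \<phi>(2)[OF that(2,3) hw]
      using assoc[OF SO[OF that(2)] SO[OF that(1)] PO[OF that(3)] that(3) that(4) h(1) p[OF that(3)]] h(2) by simp
  qed
  moreover have "\<phi> Q Y' (Comp D Q Y Y' v h) =
      Comp D Q (P Y) (P Y') (\<phi> (P Y) Y' (Comp D (P Y) Y Y' v (p Y))) (\<phi> Q Y h)"
    if "Q \<in> S" "Y \<in> Ob D" "Y' \<in> Ob D" "v \<in> Hom D Y Y'" "h \<in> Hom D Q Y" for Q Y Y' v h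
  proof (rule uniq[OF that(1,3)])
    note h = \<phi>[OF that(1,2,5)] and v = G[OF that(2,3,2,3,4)]
    have vh: "Comp D Q Y Y' v h \<in> Hom D Q Y'" using comp SO that by blast
    show "\<phi> Q Y' (Comp D Q Y Y' v h) \<in> Hom D Q (P Y')" by (rule \<phi>(1)[OF that(1,3) vh])
    show "Comp D Q (P Y) (P Y') (\<phi> (P Y) Y' (Comp D (P Y) Y Y' v (p Y))) (\<phi> Q Y h) \<in> Hom D Q (P Y')"
      using comp SO PO that h(1) v(1) by blast
    have "Comp D Q (P Y') Y' (p Y') (Comp D Q (P Y) (P Y') (\<phi> (P Y) Y' (Comp D (P Y) Y Y' v (p Y))) (\<phi> Q Y h)) =
        Comp D Q (P Y) Y' (Comp D (P Y) Y Y' v (p Y)) (\<phi> Q Y h)"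
      using assoc[OF SO[OF that(1)] PO[OF that(2)] PO[OF that(3)] that(3) h(1) v(1) p[OF that(3)]] v(2) by simp
    also have "\<dots> = Comp D Q Y Y' v h"
      using assoc[OF SO[OF that(1)] PO[OF that(2)] that(2,3) h(1) p[OF that(2)] that(4)] h(2) by simp
    finally show "Comp D Q (P Y') Y' (p Y') (\<phi> Q Y' (Comp D Q Y Y' v h)) =
        Comp D Q (P Y') Y' (p Y') (Comp D Q (P Y) (P Y') (\<phi> (P Y) Y' (Comp D (P Y) Y Y' v (p Y))) (\<phi> Q Y h))"
      unfolding \<phi>(2)[OF that(1,3) vh] ..
  qed
  ultimately have "is_adjunction ?C D inclusion_functor G \<phi>"
    unfolding is_adjunction_def by (auto simp: inclusion_functor_def G_def)
  then show ?thesis unfolding has_right_adjoint_def by blast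
qed

section \<open>Preadditive categories, complexes and homotopy\<close>

definition hom_group :: "('o, 'm, 'x) additive_category_scheme \<Rightarrow> 'o \<Rightarrow> 'o \<Rightarrow> 'm ring" where
  "hom_group A X Y = \<lparr>carrier = Hom A X Y, mult = undefined, one = undefined, zero = Zero A X Y, add = Add A X Y\<rparr>"

lemma hom_group_simps [simp]:
  "carrier (hom_group A X Y) = Hom A X Y" "\<zero>\<^bsub>hom_group A X Y\<^esub> = Zero A X Y"
  "f \<oplus>\<^bsub>hom_group A X Y\<^esub> g = Add A X Y f g"
  by (simp_all add: hom_group_def)

text \<open>Supplies the axioms that the record \<open>additive_category\<close> does not carry. It
  holds for modules and passes to complexes, so it can be used twice: the homotopy category in
  question consists of complexes over a category of complexes.\<close>

locale preadd =
  fixes A :: "('o, 'm, 'x) additive_category_scheme"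
  assumes cat: "is_category A"
    and grp: "\<And>X Y. X \<in> Ob A \<Longrightarrow> Y \<in> Ob A \<Longrightarrow> abelian_group (hom_group A X Y)"
    and comp_add: "\<And>X Y Z f g g'. \<lbrakk>X \<in> Ob A; Y \<in> Ob A; Z \<in> Ob A; f \<in> Hom A X Y; g \<in> Hom A Y Z; g' \<in> Hom A Y Z\<rbrakk>
      \<Longrightarrow> Comp A X Y Z (Add A Y Z g g') f = Add A X Z (Comp A X Y Z g f) (Comp A X Y Z g' f)"
    and add_comp: "\<And>X Y Z f f' g. \<lbrakk>X \<in> Ob A; Y \<in> Ob A; Z \<in> Ob A; f \<in> Hom A X Y; f' \<in> Hom A X Y; g \<in> Hom A Y Z\<rbrakk>
      \<Longrightarrow> Comp A X Y Z g (Add A X Y f f') = Add A X Z (Comp A X Y Z g f) (Comp A X Y Z g f')"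
begin

lemma idn_hom: "X \<in> Ob A \<Longrightarrow> Idn A X \<in> Hom A X X"
  and comp_hom: "\<lbrakk>X \<in> Ob A; Y \<in> Ob A; Z \<in> Ob A; f \<in> Hom A X Y; g \<in> Hom A Y Z\<rbrakk> \<Longrightarrow> Comp A X Y Z g f \<in> Hom A X Z"
  and comp_idn: "\<lbrakk>X \<in> Ob A; Y \<in> Ob A; f \<in> Hom A X Y\<rbrakk> \<Longrightarrow> Comp A X X Y f (Idn A X) = f"
  and idn_comp: "\<lbrakk>X \<in> Ob A; Y \<in> Ob A; f \<in> Hom A X Y\<rbrakk> \<Longrightarrow> Comp A X Y Y (Idn A Y) f = f"
  and assoc: "\<lbrakk>W \<in> Ob A; X \<in> Ob A; Y \<in> Ob A; Z \<in> Ob A; f \<in> Hom A W X; g \<in> Hom A X Y; h \<in> Hom A Y Z\<rbrakk> \<Longrightarrow>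
     Comp A W X Z (Comp A X Y Z h g) f = Comp A W Y Z h (Comp A W X Y g f)"
  using cat by (simp_all add: is_category_def)

lemma zero_hom: "X \<in> Ob A \<Longrightarrow> Y \<in> Ob A \<Longrightarrow> Zero A X Y \<in> Hom A X Y"
  using abelian_groupE(2)[OF grp] by simp

lemma add_hom: "\<lbrakk>X \<in> Ob A; Y \<in> Ob A; f \<in> Hom A X Y; g \<in> Hom A X Y\<rbrakk> \<Longrightarrow> Add A X Y f g \<in> Hom A X Y"
  using abelian_groupE(1)[OF grp] by simp

lemma add_zero: "\<lbrakk>X \<in> Ob A; Y \<in> Ob A; f \<in> Hom A X Y\<rbrakk> \<Longrightarrow> Add A X Y f (Zero A X Y) = f"
  and zero_add: "\<lbrakk>X \<in> Ob A; Y \<in> Ob A; f \<in> Hom A X Y\<rbrakk> \<Longrightarrow> Add A X Y (Zero A X Y) f = f"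
  using abelian_monoid.r_zero[OF abelian_group.axioms(1)[OF grp], of X Y f]
    abelian_monoid.l_zero[OF abelian_group.axioms(1)[OF grp], of X Y f] by simp_all

lemma add_comm: "\<lbrakk>X \<in> Ob A; Y \<in> Ob A; f \<in> Hom A X Y; g \<in> Hom A X Y\<rbrakk> \<Longrightarrow> Add A X Y f g = Add A X Y g f"
  using abelian_groupE(4)[OF grp] by simp

lemma add_assoc: "\<lbrakk>X \<in> Ob A; Y \<in> Ob A; f \<in> Hom A X Y; g \<in> Hom A X Y; h \<in> Hom A X Y\<rbrakk> \<Longrightarrow>
    Add A X Y (Add A X Y f g) h = Add A X Y f (Add A X Y g h)"
  using abelian_groupE(3)[OF grp] by simp

lemma add_left_comm: "\<lbrakk>X \<in> Ob A; Y \<in> Ob A; f \<in> Hom A X Y; g \<in> Hom A X Y; h \<in> Hom A X Y\<rbrakk> \<Longrightarrow>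
    Add A X Y f (Add A X Y g h) = Add A X Y g (Add A X Y f h)"
  by (metis add_assoc add_comm)

lemma neg_ex: "\<lbrakk>X \<in> Ob A; Y \<in> Ob A; f \<in> Hom A X Y\<rbrakk> \<Longrightarrow> \<exists>g\<in>Hom A X Y. Add A X Y g f = Zero A X Y"
  using abelian_groupE(6)[OF grp] by fastforce

text \<open>Meant for composites with a zero morphism, which \<open>0 + 0 = 0\<close> and
  bilinearity make equal to their own double.\<close>

lemma add_idem_zero:
  assumes "X \<in> Ob A" "Y \<in> Ob A" "f \<in> Hom A X Y" "Add A X Y f f = f"
  shows "f = Zero A X Y"
proof -
  obtain g where g: "g \<in> Hom A X Y" "Add A X Y g f = Zero A X Y" using neg_ex assms by blast
  have "f = Add A X Y g (Add A X Y f f)"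
    using assms(1-3) g by (simp add: add_assoc[symmetric] zero_add)
  also have "\<dots> = Zero A X Y" unfolding assms(4) by (rule g(2))
  finally show ?thesis .
qed

lemma comp_zero:
  assumes "X \<in> Ob A" "Y \<in> Ob A" "Z \<in> Ob A" "g \<in> Hom A Y Z"
  shows "Comp A X Y Z g (Zero A X Y) = Zero A X Z"
  using assms add_comp[of X Y Z "Zero A X Y" "Zero A X Y" g]
  by (intro add_idem_zero comp_hom zero_hom) (simp_all add: zero_hom add_zero)

lemma zero_comp:
  assumes "X \<in> Ob A" "Y \<in> Ob A" "Z \<in> Ob A" "f \<in> Hom A X Y"
  shows "Comp A X Y Z (Zero A Y Z) f = Zero A X Z"
  using assms comp_add[of X Y Z f "Zero A Y Z" "Zero A Y Z"]
  by (intro add_idem_zero comp_hom zero_hom) (simp_all add: zero_hom add_zero)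

lemma cxD: "X \<in> complexes A \<Longrightarrow> obj X n \<in> Ob A"
  "X \<in> complexes A \<Longrightarrow> diff X n \<in> Hom A (obj X n) (obj X (n - 1))"
  by (auto simp: complexes_def)

lemma cxD': "X \<in> complexes A \<Longrightarrow> diff X (n + 1) \<in> Hom A (obj X (n + 1)) (obj X n)"
  using cxD(2)[of X "n + 1"] by simp

lemma chD: "f \<in> chain_maps A X Y \<Longrightarrow> f n \<in> Hom A (obj X n) (obj Y n)"
  "f \<in> chain_maps A X Y \<Longrightarrow> Comp A (obj X n) (obj Y n) (obj Y (n - 1)) (diff Y n) (f n)
          = Comp A (obj X n) (obj X (n - 1)) (obj Y (n - 1)) (f (n - 1)) (diff X n)"
  by (auto simp: chain_maps_def)

lemma comp_chain_maps:
  assumes "X \<in> complexes A" "Y \<in> complexes A" "Z \<in> complexes A" "f \<in> chain_maps A X Y" "g \<in> chain_maps A Y Z"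
  shows "comp_chain A X Y Z g f \<in> chain_maps A X Z"
proof -
  note c = cxD[OF assms(1)] cxD[OF assms(2)] cxD[OF assms(3)] and f = chD(1)[OF assms(4)] and g = chD(1)[OF assms(5)]
  show ?thesis
    unfolding chain_maps_def comp_chain_def
  proof (intro CollectI conjI allI)
    fix n
    have "Comp A (obj X n) (obj Z n) (obj Z (n - 1)) (diff Z n) (Comp A (obj X n) (obj Y n) (obj Z n) (g n) (f n)) =
      Comp A (obj X n) (obj Y n) (obj Z (n - 1)) (Comp A (obj Y n) (obj Z n) (obj Z (n - 1)) (diff Z n) (g n)) (f n)"
      using assoc[OF c(1,3,5,5) f g c(6)] by simp
    also have "\<dots> = Comp A (obj X n) (obj Y (n - 1)) (obj Z (n - 1)) (g (n - 1))
        (Comp A (obj X n) (obj Y n) (obj Y (n - 1)) (diff Y n) (f n))"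
      unfolding chD(2)[OF assms(5)] by (rule assoc[OF c(1,3,3,5) f c(4) g])
    also have "\<dots> = Comp A (obj X n) (obj X (n - 1)) (obj Z (n - 1))
        (Comp A (obj X (n - 1)) (obj Y (n - 1)) (obj Z (n - 1)) (g (n - 1)) (f (n - 1))) (diff X n)"
      unfolding chD(2)[OF assms(4)] by (rule assoc[OF c(1,1,3,5) c(2) f g, symmetric])
    finally show "Comp A (obj X n) (obj Z n) (obj Z (n - 1)) (diff Z n) (Comp A (obj X n) (obj Y n) (obj Z n) (g n) (f n)) =
        Comp A (obj X n) (obj X (n - 1)) (obj Z (n - 1))
        (Comp A (obj X (n - 1)) (obj Y (n - 1)) (obj Z (n - 1)) (g (n - 1)) (f (n - 1))) (diff X n)" .
  qed (use comp_hom c f g in blast)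
qed

lemma idn_chain_map: "X \<in> complexes A \<Longrightarrow> (\<lambda>n. Idn A (obj X n)) \<in> chain_maps A X X"
  unfolding chain_maps_def using cxD[of X] by (simp add: idn_hom comp_idn idn_comp)

lemma complexes_category: "is_category (complex_cat A)"
  unfolding is_category_def complex_cat_def
  by (simp add: idn_chain_map comp_chain_maps)
    (auto simp: comp_chain_def fun_eq_iff comp_idn idn_comp cxD chD assoc)

lemma complexes_preadd: "preadd (complex_cat A)"
proof (rule preadd.intro)
  show "is_category (complex_cat A)" by (rule complexes_category)
next
  fix X Y assume "X \<in> Ob (complex_cat A)" "Y \<in> Ob (complex_cat A)"
  then have X: "X \<in> complexes A" and Y: "Y \<in> complexes A" by (auto simp: complex_cat_def)
  note c = cxD[OF X] cxD[OF Y]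
  have zd: "Comp A (obj X n) (obj Y n) (obj Y (n - 1)) (diff Y n) (Zero A (obj X n) (obj Y n)) =
      Comp A (obj X n) (obj X (n - 1)) (obj Y (n - 1)) (Zero A (obj X (n - 1)) (obj Y (n - 1))) (diff X n)" for n
    using c by (simp add: comp_zero zero_comp)
  have zero: "(\<lambda>n. Zero A (obj X n) (obj Y n)) \<in> chain_maps A X Y"
    unfolding chain_maps_def using c zd by (simp add: zero_hom)
  have add: "(\<lambda>n. Add A (obj X n) (obj Y n) (f n) (g n)) \<in> chain_maps A X Y"
    if "f \<in> chain_maps A X Y" "g \<in> chain_maps A X Y" for f g
    unfolding chain_maps_def using c chD[OF that(1)] chD[OF that(2)]
    by (simp add: add_hom add_comp comp_add)
  have neg: "\<exists>g\<in>chain_maps A X Y. (\<lambda>n. Add A (obj X n) (obj Y n) (g n) (f n)) = (\<lambda>n. Zero A (obj X n) (obj Y n))"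
    if f: "f \<in> chain_maps A X Y" for f
  proof -
    obtain g where g: "g n \<in> Hom A (obj X n) (obj Y n)"
      "Add A (obj X n) (obj Y n) (g n) (f n) = Zero A (obj X n) (obj Y n)" for n
      using neg_ex[OF c(1) c(3) chD(1)[OF f]] by metis
    \<comment> \<open>The negatives \<open>g n\<close> were chosen degree by degree. They commute
      with the differentials because both composites are negatives of the same arrow, and these are
      unique.\<close>
    have "Comp A (obj X n) (obj Y n) (obj Y (n - 1)) (diff Y n) (g n) =
          Comp A (obj X n) (obj X (n - 1)) (obj Y (n - 1)) (g (n - 1)) (diff X n)" (is "?l = ?r") for n
    proof -
      let ?f = "Comp A (obj X n) (obj Y n) (obj Y (n - 1)) (diff Y n) (f n)"
      have h: "?l \<in> Hom A (obj X n) (obj Y (n - 1))" "?r \<in> Hom A (obj X n) (obj Y (n - 1))"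
        "?f \<in> Hom A (obj X n) (obj Y (n - 1))"
        using comp_hom c g(1) chD(1)[OF f] by blast+
      have l: "Add A (obj X n) (obj Y (n - 1)) ?l ?f = Zero A (obj X n) (obj Y (n - 1))"
        using add_comp[OF c(1,3,3) g(1) chD(1)[OF f] c(4), symmetric] comp_zero[OF c(1,3,3,4)] by (simp add: g(2))
      have r: "Add A (obj X n) (obj Y (n - 1)) ?r ?f = Zero A (obj X n) (obj Y (n - 1))"
        unfolding chD(2)[OF f]
        using comp_add[OF c(1,1,3) c(2) g(1) chD(1)[OF f], symmetric] zero_comp[OF c(1,1,3,2)] by (simp add: g(2))
      interpret G: abelian_group "hom_group A (obj X n) (obj Y (n - 1))" using grp c by blast
      show ?thesis using G.add.right_cancel[of ?f ?l ?r] h l r by simp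
    qed
    then have "g \<in> chain_maps A X Y" using g by (simp add: chain_maps_def)
    then show ?thesis using g(2) by blast
  qed
  show "abelian_group (hom_group (complex_cat A) X Y)"
    by (rule abelian_groupI)
      (use c zero add neg in \<open>simp_all add: complex_cat_def fun_eq_iff chD add_assoc zero_add, simp add: add_comm chD\<close>)
next
  fix X Y Z f g g'
  assume "X \<in> Ob (complex_cat A)" "Y \<in> Ob (complex_cat A)" "Z \<in> Ob (complex_cat A)"
    "f \<in> Hom (complex_cat A) X Y" "g \<in> Hom (complex_cat A) Y Z" "g' \<in> Hom (complex_cat A) Y Z"
  then show "Comp (complex_cat A) X Y Z (Add (complex_cat A) Y Z g g') f =
      Add (complex_cat A) X Z (Comp (complex_cat A) X Y Z g f) (Comp (complex_cat A) X Y Z g' f)"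
    by (simp add: complex_cat_def comp_chain_def fun_eq_iff comp_add cxD chD)
next
  fix X Y Z f f' g
  assume "X \<in> Ob (complex_cat A)" "Y \<in> Ob (complex_cat A)" "Z \<in> Ob (complex_cat A)"
    "f \<in> Hom (complex_cat A) X Y" "f' \<in> Hom (complex_cat A) X Y" "g \<in> Hom (complex_cat A) Y Z"
  then show "Comp (complex_cat A) X Y Z g (Add (complex_cat A) X Y f f') =
      Add (complex_cat A) X Z (Comp (complex_cat A) X Y Z g f) (Comp (complex_cat A) X Y Z g f')"
    by (simp add: complex_cat_def comp_chain_def fun_eq_iff add_comp cxD chD)
qed

definition null_htp :: "('o, 'm) cplx \<Rightarrow> ('o, 'm) cplx \<Rightarrow> (int \<Rightarrow> 'm) \<Rightarrow> int \<Rightarrow> 'm" where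
  "null_htp X Y s n = Add A (obj X n) (obj Y n)
     (Comp A (obj X n) (obj Y (n + 1)) (obj Y n) (diff Y (n + 1)) (s n))
     (Comp A (obj X n) (obj X (n - 1)) (obj Y n) (s (n - 1)) (diff X n))"

definition shom :: "('o, 'm) cplx \<Rightarrow> ('o, 'm) cplx \<Rightarrow> (int \<Rightarrow> 'm) set" where
  "shom X Y = {s. \<forall>n. s n \<in> Hom A (obj X n) (obj Y (n + 1))}"

lemma homotopy_rel_iff: "(f, g) \<in> homotopy_rel A X Y \<longleftrightarrow> f \<in> chain_maps A X Y \<and> g \<in> chain_maps A X Y \<and>
    (\<exists>s\<in>shom X Y. \<forall>n. f n = Add A (obj X n) (obj Y n) (g n) (null_htp X Y s n))"
  by (auto simp: homotopy_rel_def null_htp_def shom_def)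

context
  fixes X Y
  assumes X: "X \<in> complexes A" and Y: "Y \<in> complexes A"
begin

lemma shomD: "s \<in> shom X Y \<Longrightarrow> s n \<in> Hom A (obj X n) (obj Y (n + 1))"
  "s \<in> shom X Y \<Longrightarrow> s (n - 1) \<in> Hom A (obj X (n - 1)) (obj Y n)"
  unfolding shom_def by (auto dest: spec[of _ "n - 1"])

lemma null_htp_hom: "s \<in> shom X Y \<Longrightarrow> null_htp X Y s n \<in> Hom A (obj X n) (obj Y n)"
  unfolding null_htp_def using cxD[OF X] cxD[OF Y] cxD'[OF Y] shomD
  by (intro add_hom comp_hom) blast+

lemma null_htp_add:
  assumes "s \<in> shom X Y" "t \<in> shom X Y"
  shows "(\<lambda>n. Add A (obj X n) (obj Y (n + 1)) (s n) (t n)) \<in> shom X Y"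
    "null_htp X Y (\<lambda>n. Add A (obj X n) (obj Y (n + 1)) (s n) (t n)) n = Add A (obj X n) (obj Y n) (null_htp X Y s n) (null_htp X Y t n)"
proof -
  note c = cxD[OF X] cxD[OF Y] cxD'[OF Y] shomD[OF assms(1)] shomD[OF assms(2)]
  show "(\<lambda>n. Add A (obj X n) (obj Y (n + 1)) (s n) (t n)) \<in> shom X Y"
    using c by (simp add: shom_def add_hom)
  let ?a = "\<lambda>s. Comp A (obj X n) (obj Y (n + 1)) (obj Y n) (diff Y (n + 1)) (s n)"
  let ?b = "\<lambda>s. Comp A (obj X n) (obj X (n - 1)) (obj Y n) (s (n - 1)) (diff X n)"
  have h: "?a s \<in> Hom A (obj X n) (obj Y n)" "?a t \<in> Hom A (obj X n) (obj Y n)"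
    "?b s \<in> Hom A (obj X n) (obj Y n)" "?b t \<in> Hom A (obj X n) (obj Y n)"
    using c by (blast intro: comp_hom)+
  show "null_htp X Y (\<lambda>n. Add A (obj X n) (obj Y (n + 1)) (s n) (t n)) n = Add A (obj X n) (obj Y n) (null_htp X Y s n) (null_htp X Y t n)"
    unfolding null_htp_def using c h
    by (simp add: add_comp comp_add add_assoc add_hom) (simp add: add_left_comm add_hom)
qed

lemma null_htp_zero:
  "(\<lambda>n. Zero A (obj X n) (obj Y (n + 1))) \<in> shom X Y"
  "null_htp X Y (\<lambda>n. Zero A (obj X n) (obj Y (n + 1))) n = Zero A (obj X n) (obj Y n)"
  using cxD[OF X] cxD[OF Y] cxD'[OF Y]
  by (auto simp: shom_def null_htp_def zero_hom comp_zero zero_comp add_zero)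

lemma null_htp_neg:
  assumes "s \<in> shom X Y"
  shows "\<exists>t\<in>shom X Y. \<forall>n. Add A (obj X n) (obj Y n) (null_htp X Y s n) (null_htp X Y t n) = Zero A (obj X n) (obj Y n)"
proof -
  have "\<exists>t. \<forall>n. t n \<in> Hom A (obj X n) (obj Y (n + 1)) \<and>
      Add A (obj X n) (obj Y (n + 1)) (t n) (s n) = Zero A (obj X n) (obj Y (n + 1))"
    using neg_ex[OF cxD(1)[OF X] cxD(1)[OF Y] shomD(1)[OF assms]] by metis
  then obtain t where t: "t \<in> shom X Y"
    "\<And>n. Add A (obj X n) (obj Y (n + 1)) (t n) (s n) = Zero A (obj X n) (obj Y (n + 1))"
    by (auto simp: shom_def)
  have "Add A (obj X n) (obj Y n) (null_htp X Y s n) (null_htp X Y t n) = Zero A (obj X n) (obj Y n)" for n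
    using null_htp_add(2)[OF t(1) assms, of n] null_htp_zero(2)[of n] t
      add_comm[OF cxD(1)[OF X] cxD(1)[OF Y] null_htp_hom[OF assms] null_htp_hom[OF t(1)]] by simp
  then show ?thesis using t(1) by blast
qed

text \<open>The map \<open>null_htp\<close> is additive in \<open>s\<close>, so homotopic maps are
  those differing by an element of a subgroup; zero, negatives and sums give reflexivity, symmetry
  and transitivity.\<close>

lemma homotopy_equiv: "equiv (chain_maps A X Y) (homotopy_rel A X Y)"
proof (rule equivI)
  note c = cxD(1)[OF X] cxD(1)[OF Y]
  show "homotopy_rel A X Y \<subseteq> chain_maps A X Y \<times> chain_maps A X Y"
    by (auto simp: homotopy_rel_def)
  show "refl_on (chain_maps A X Y) (homotopy_rel A X Y)"
    unfolding refl_on_def homotopy_rel_iff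
    using null_htp_zero c by (auto simp: add_zero chD intro!: bexI[OF _ null_htp_zero(1)])
  show "sym (homotopy_rel A X Y)"
  proof (rule symI)
    fix f g assume "(f, g) \<in> homotopy_rel A X Y"
    then obtain s where s: "f \<in> chain_maps A X Y" "g \<in> chain_maps A X Y" "s \<in> shom X Y"
      "\<And>n. f n = Add A (obj X n) (obj Y n) (g n) (null_htp X Y s n)"
      by (auto simp: homotopy_rel_iff)
    obtain t where t: "t \<in> shom X Y"
      "\<And>n. Add A (obj X n) (obj Y n) (null_htp X Y s n) (null_htp X Y t n) = Zero A (obj X n) (obj Y n)"
      using null_htp_neg[OF s(3)] by blast
    have "g n = Add A (obj X n) (obj Y n) (f n) (null_htp X Y t n)" for n
      unfolding s(4) using c chD(1)[OF s(2)] null_htp_hom[OF s(3)] null_htp_hom[OF t(1)]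
      by (simp add: add_assoc t(2) add_zero)
    then show "(g, f) \<in> homotopy_rel A X Y"
      using s t(1) by (auto simp: homotopy_rel_iff)
  qed
  show "trans (homotopy_rel A X Y)"
  proof (rule transI)
    fix f g h assume "(f, g) \<in> homotopy_rel A X Y" "(g, h) \<in> homotopy_rel A X Y"
    then obtain s t where s: "f \<in> chain_maps A X Y" "g \<in> chain_maps A X Y" "h \<in> chain_maps A X Y"
      "s \<in> shom X Y" "t \<in> shom X Y"
      "\<And>n. f n = Add A (obj X n) (obj Y n) (g n) (null_htp X Y s n)"
      "\<And>n. g n = Add A (obj X n) (obj Y n) (h n) (null_htp X Y t n)"
      by (auto simp: homotopy_rel_iff)
    have "f n = Add A (obj X n) (obj Y n) (h n)
        (null_htp X Y (\<lambda>n. Add A (obj X n) (obj Y (n + 1)) (t n) (s n)) n)" for n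
      unfolding s(6) s(7) null_htp_add(2)[OF s(5,4)]
      using c chD(1)[OF s(3)] null_htp_hom[OF s(4)] null_htp_hom[OF s(5)] by (simp add: add_assoc)
    then show "(f, h) \<in> homotopy_rel A X Y"
      unfolding homotopy_rel_iff using s null_htp_add(1)[OF s(5,4)] by blast
  qed
qed

end

text \<open>If \<open>s\<close> is a homotopy, then so is \<open>g s\<close>, because
  \<open>g (d s + s d) = d (g s) + (g s) d\<close>.\<close>

lemma homotopy_post:
  assumes X: "X \<in> complexes A" and Y: "Y \<in> complexes A" and Z: "Z \<in> complexes A"
    and g: "g \<in> chain_maps A Y Z" and f: "(f, f') \<in> homotopy_rel A X Y"
  shows "(comp_chain A X Y Z g f, comp_chain A X Y Z g f') \<in> homotopy_rel A X Z"
proof -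
  note c = cxD[OF X] cxD[OF Y] cxD'[OF Y] cxD[OF Z] cxD'[OF Z]
  obtain s where s: "f \<in> chain_maps A X Y" "f' \<in> chain_maps A X Y" "s \<in> shom X Y"
      "\<And>n. f n = Add A (obj X n) (obj Y n) (f' n) (null_htp X Y s n)"
    using f by (auto simp: homotopy_rel_iff)
  note sD = shomD[OF X Y s(3)] and gD = chD[OF g]
  let ?t = "\<lambda>n. Comp A (obj X n) (obj Y (n + 1)) (obj Z (n + 1)) (g (n + 1)) (s n)"
  have t: "?t \<in> shom X Z" unfolding shom_def using comp_hom c sD gD by blast
  have g1: "Comp A (obj Y (n + 1)) (obj Z (n + 1)) (obj Z n) (diff Z (n + 1)) (g (n + 1))
          = Comp A (obj Y (n + 1)) (obj Y n) (obj Z n) (g n) (diff Y (n + 1))" for n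
    using gD(2)[of "n + 1"] by simp
  have n1: "Comp A (obj X n) (obj Y n) (obj Z n) (g n) (null_htp X Y s n) = null_htp X Z ?t n" for n
  proof -
    have a: "Comp A (obj X n) (obj Y (n + 1)) (obj Y n) (diff Y (n + 1)) (s n) \<in> Hom A (obj X n) (obj Y n)"
      "Comp A (obj X n) (obj X (n - 1)) (obj Y n) (s (n - 1)) (diff X n) \<in> Hom A (obj X n) (obj Y n)"
      using comp_hom c sD by blast+
    have "Comp A (obj X n) (obj Y n) (obj Z n) (g n) (Comp A (obj X n) (obj Y (n + 1)) (obj Y n) (diff Y (n + 1)) (s n)) =
        Comp A (obj X n) (obj Z (n + 1)) (obj Z n) (diff Z (n + 1)) (?t n)"
      using assoc[OF c(1,3,3,6) sD(1) c(5) gD(1)] assoc[OF c(1,3,6,6) sD(1) gD(1) c(8)] g1 by simp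
    moreover have "Comp A (obj X n) (obj Y n) (obj Z n) (g n) (Comp A (obj X n) (obj X (n - 1)) (obj Y n) (s (n - 1)) (diff X n)) =
        Comp A (obj X n) (obj X (n - 1)) (obj Z n) (?t (n - 1)) (diff X n)"
      using assoc[OF c(1,1,3,6) c(2) sD(2) gD(1)] by simp
    ultimately show ?thesis
      unfolding null_htp_def add_comp[OF c(1,3,6) a gD(1)] by simp
  qed
  have "Comp A (obj X n) (obj Y n) (obj Z n) (g n) (f n) =
      Add A (obj X n) (obj Z n) (Comp A (obj X n) (obj Y n) (obj Z n) (g n) (f' n)) (null_htp X Z ?t n)" for n
    unfolding s(4) n1[symmetric] by (rule add_comp[OF c(1,3,6) chD(1)[OF s(2)] null_htp_hom[OF X Y s(3)] gD(1)])
  then show ?thesis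
    unfolding homotopy_rel_iff using comp_chain_maps[OF X Y Z s(1) g] comp_chain_maps[OF X Y Z s(2) g] t
    by (auto simp: comp_chain_def intro!: bexI[OF _ t])
qed

lemma homotopy_pre:
  assumes X: "X \<in> complexes A" and Y: "Y \<in> complexes A" and Z: "Z \<in> complexes A"
    and f: "f \<in> chain_maps A X Y" and g: "(g, g') \<in> homotopy_rel A Y Z"
  shows "(comp_chain A X Y Z g f, comp_chain A X Y Z g' f) \<in> homotopy_rel A X Z"
proof -
  note c = cxD[OF X] cxD[OF Y] cxD[OF Z] cxD'[OF Z]
  obtain s where s: "g \<in> chain_maps A Y Z" "g' \<in> chain_maps A Y Z" "s \<in> shom Y Z"
      "\<And>n. g n = Add A (obj Y n) (obj Z n) (g' n) (null_htp Y Z s n)"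
    using g by (auto simp: homotopy_rel_iff)
  note sD = shomD[OF Y Z s(3)] and fD = chD[OF f]
  let ?t = "\<lambda>n. Comp A (obj X n) (obj Y n) (obj Z (n + 1)) (s n) (f n)"
  have t: "?t \<in> shom X Z" unfolding shom_def using comp_hom c sD fD by blast
  have n1: "Comp A (obj X n) (obj Y n) (obj Z n) (null_htp Y Z s n) (f n) = null_htp X Z ?t n" for n
  proof -
    have a: "Comp A (obj Y n) (obj Z (n + 1)) (obj Z n) (diff Z (n + 1)) (s n) \<in> Hom A (obj Y n) (obj Z n)"
      "Comp A (obj Y n) (obj Y (n - 1)) (obj Z n) (s (n - 1)) (diff Y n) \<in> Hom A (obj Y n) (obj Z n)"
      using comp_hom c sD by blast+
    have "Comp A (obj X n) (obj Y n) (obj Z n) (Comp A (obj Y n) (obj Z (n + 1)) (obj Z n) (diff Z (n + 1)) (s n)) (f n) =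
        Comp A (obj X n) (obj Z (n + 1)) (obj Z n) (diff Z (n + 1)) (?t n)"
      by (rule assoc[OF c(1,3,5,5) fD(1) sD(1) c(7)])
    moreover have "Comp A (obj X n) (obj Y n) (obj Z n) (Comp A (obj Y n) (obj Y (n - 1)) (obj Z n) (s (n - 1)) (diff Y n)) (f n) =
        Comp A (obj X n) (obj X (n - 1)) (obj Z n) (?t (n - 1)) (diff X n)"
      using assoc[OF c(1,3,3,5) fD(1) c(4) sD(2)] assoc[OF c(1,1,3,5) c(2) fD(1) sD(2)] fD(2) by simp
    ultimately show ?thesis
      unfolding null_htp_def comp_add[OF c(1,3,5) fD(1) a] by simp
  qed
  have "Comp A (obj X n) (obj Y n) (obj Z n) (g n) (f n) =
      Add A (obj X n) (obj Z n) (Comp A (obj X n) (obj Y n) (obj Z n) (g' n) (f n)) (null_htp X Z ?t n)" for n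
    unfolding s(4) n1[symmetric] by (rule comp_add[OF c(1,3,5) fD(1) chD(1)[OF s(2)] null_htp_hom[OF Y Z s(3)]])
  then show ?thesis
    unfolding homotopy_rel_iff using comp_chain_maps[OF X Y Z f s(1)] comp_chain_maps[OF X Y Z f s(2)] t
    by (auto simp: comp_chain_def intro!: bexI[OF _ t])
qed

text \<open>Composition of classes is defined as a union over all representatives; by
  \<open>homotopy_pre\<close> and \<open>homotopy_post\<close> all sets in the union
  coincide.\<close>

lemma homotopy_comp:
  assumes X: "X \<in> complexes A" and Y: "Y \<in> complexes A" and Z: "Z \<in> complexes A"
    and f: "f \<in> chain_maps A X Y" and g: "g \<in> chain_maps A Y Z"
  shows "Comp (homotopy_cat A) X Y Z (homotopy_rel A Y Z `` {g}) (homotopy_rel A X Y `` {f}) =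
    homotopy_rel A X Z `` {comp_chain A X Y Z g f}"
proof -
  have eq: "homotopy_rel A X Z `` {comp_chain A X Y Z g' f'} = homotopy_rel A X Z `` {comp_chain A X Y Z g f}"
    if "(g, g') \<in> homotopy_rel A Y Z" "(f, f') \<in> homotopy_rel A X Y" for g' f'
  proof -
    have g': "g' \<in> chain_maps A Y Z" using that(1) by (simp add: homotopy_rel_iff)
    have "trans (homotopy_rel A X Z)" by (rule equivE[OF homotopy_equiv[OF X Z]])
    then have "(comp_chain A X Y Z g f, comp_chain A X Y Z g' f') \<in> homotopy_rel A X Z"
      by (rule transD[OF _ homotopy_pre[OF X Y Z f that(1)] homotopy_post[OF X Y Z g' that(2)]])
    then show ?thesis by (rule equiv_class_eq[OF homotopy_equiv[OF X Z], symmetric])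
  qed
  have fg: "g \<in> homotopy_rel A Y Z `` {g}" "f \<in> homotopy_rel A X Y `` {f}"
    by (rule equiv_class_self[OF homotopy_equiv[OF Y Z] g] equiv_class_self[OF homotopy_equiv[OF X Y] f])+
  have "(\<Union>f'\<in>homotopy_rel A X Y `` {f}. homotopy_rel A X Z `` {comp_chain A X Y Z g' f'}) =
      homotopy_rel A X Z `` {comp_chain A X Y Z g f}" if "(g, g') \<in> homotopy_rel A Y Z" for g'
    by (rule UN_constant_eq[OF fg(2)]) (use eq[OF that] in blast)
  then show ?thesis
    unfolding homotopy_cat_def category.simps by (intro UN_constant_eq[OF fg(1)]) blast
qed

lemma homotopy_category: "is_category (homotopy_cat A)"
  unfolding is_category_def
proof (intro conjI ballI)
  fix X assume "X \<in> Ob (homotopy_cat A)"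
  then have X: "X \<in> complexes A" by (simp add: homotopy_cat_def)
  then show "Idn (homotopy_cat A) X \<in> Hom (homotopy_cat A) X X"
    by (simp add: homotopy_cat_def quotientI idn_chain_map)
  fix Y assume "Y \<in> Ob (homotopy_cat A)"
  then have Y: "Y \<in> complexes A" by (simp add: homotopy_cat_def)
  {
    fix F assume "F \<in> Hom (homotopy_cat A) X Y"
    then obtain f where f: "f \<in> chain_maps A X Y" "F = homotopy_rel A X Y `` {f}"
      by (auto simp: homotopy_cat_def elim: quotientE)
    have i: "Idn (homotopy_cat A) X = homotopy_rel A X X `` {\<lambda>n. Idn A (obj X n)}"
      "Idn (homotopy_cat A) Y = homotopy_rel A Y Y `` {\<lambda>n. Idn A (obj Y n)}"
      by (simp_all add: homotopy_cat_def)
    have "comp_chain A X X Y f (\<lambda>n. Idn A (obj X n)) = f" "comp_chain A X Y Y (\<lambda>n. Idn A (obj Y n)) f = f"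
      using cxD[OF X] cxD[OF Y] chD(1)[OF f(1)] by (auto simp: comp_chain_def comp_idn idn_comp)
    then show "Comp (homotopy_cat A) X X Y F (Idn (homotopy_cat A) X) = F"
      "Comp (homotopy_cat A) X Y Y (Idn (homotopy_cat A) Y) F = F"
      unfolding f(2) i homotopy_comp[OF X X Y idn_chain_map[OF X] f(1)]
        homotopy_comp[OF X Y Y f(1) idn_chain_map[OF Y]] by simp_all
  }
  fix Z assume "Z \<in> Ob (homotopy_cat A)"
  then have Z: "Z \<in> complexes A" by (simp add: homotopy_cat_def)
  {
    fix F G assume "F \<in> Hom (homotopy_cat A) X Y" "G \<in> Hom (homotopy_cat A) Y Z"
    then obtain f g where f: "f \<in> chain_maps A X Y" "F = homotopy_rel A X Y `` {f}"
      and g: "g \<in> chain_maps A Y Z" "G = homotopy_rel A Y Z `` {g}"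
      by (auto simp: homotopy_cat_def elim!: quotientE)
    have "homotopy_rel A X Z `` {comp_chain A X Y Z g f} \<in> Hom (homotopy_cat A) X Z"
      using comp_chain_maps[OF X Y Z f(1) g(1)] by (simp add: homotopy_cat_def quotientI)
    then show "Comp (homotopy_cat A) X Y Z G F \<in> Hom (homotopy_cat A) X Z"
      unfolding f(2) g(2) homotopy_comp[OF X Y Z f(1) g(1)] .
  }
  fix W F G H
  assume "W \<in> Ob (homotopy_cat A)" "F \<in> Hom (homotopy_cat A) X Y" "G \<in> Hom (homotopy_cat A) Y Z"
    "H \<in> Hom (homotopy_cat A) Z W"
  then obtain f g h where f: "f \<in> chain_maps A X Y" "F = homotopy_rel A X Y `` {f}"
      and g: "g \<in> chain_maps A Y Z" "G = homotopy_rel A Y Z `` {g}"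
      and h: "h \<in> chain_maps A Z W" "H = homotopy_rel A Z W `` {h}" and W: "W \<in> complexes A"
    by (auto simp: homotopy_cat_def elim!: quotientE)
  have "comp_chain A X Y W (comp_chain A Y Z W h g) f = comp_chain A X Z W h (comp_chain A X Y Z g f)"
    using cxD[OF X] cxD[OF Y] cxD[OF Z] cxD[OF W] chD(1)[OF f(1)] chD(1)[OF g(1)] chD(1)[OF h(1)]
    by (simp add: comp_chain_def assoc)
  then show "Comp (homotopy_cat A) X Y W (Comp (homotopy_cat A) Y Z W H G) F =
      Comp (homotopy_cat A) X Z W H (Comp (homotopy_cat A) X Y Z G F)"
    unfolding f(2) g(2) h(2) homotopy_comp[OF Y Z W g(1) h(1)] homotopy_comp[OF X Y Z f(1) g(1)]
      homotopy_comp[OF X Y W f(1) comp_chain_maps[OF Y Z W g(1) h(1)]]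
      homotopy_comp[OF X Z W comp_chain_maps[OF X Y Z f(1) g(1)] h(1)] by simp
qed

end

text \<open>Chain maps, homotopies and composites never consult \<open>Ob\<close>, so passing to a
  full subcategory only shrinks the set of complexes.\<close>

lemma homotopy_cat_restrict:
  fixes A :: "('o, 'm, 'x) additive_category_scheme"
  shows "homotopy_cat (A\<lparr>Ob := S\<rparr>) = (homotopy_cat A)\<lparr>Ob := complexes (A\<lparr>Ob := S\<rparr>)\<rparr>"
proof -
  have c: "chain_maps (A\<lparr>Ob := S\<rparr>) = chain_maps A" by (auto simp: chain_maps_def fun_eq_iff)
  have h: "homotopy_rel (A\<lparr>Ob := S\<rparr>) = homotopy_rel A" by (simp add: homotopy_rel_def fun_eq_iff c)
  have k: "comp_chain (A\<lparr>Ob := S\<rparr>) = comp_chain A" by (simp add: comp_chain_def fun_eq_iff)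
  show ?thesis by (simp add: homotopy_cat_def c h k)
qed

section \<open>The category of modules in a universe\<close>

lemma module_cat_simps [simp]:
  "Ob (module_cat \<kappa> R) = {M. left_module R M \<and> |carrier M| <o \<kappa>}"
  "Hom (module_cat \<kappa> R) = module_homs R"
  "Comp (module_cat \<kappa> R) L M N g f = compose (carrier L) g f"
  "Idn (module_cat \<kappa> R) M = (\<lambda>x\<in>carrier M. x)"
  "Add (module_cat \<kappa> R) M N f g = (\<lambda>x\<in>carrier M. f x \<oplus>\<^bsub>N\<^esub> g x)"
  "Zero (module_cat \<kappa> R) M N = (\<lambda>x\<in>carrier M. \<zero>\<^bsub>N\<^esub>)"
  by (simp_all add: module_cat_def)

lemma complex_cat_simps [simp]:
  "Ob (complex_cat A) = complexes A"
  "Hom (complex_cat A) = chain_maps A"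
  "Comp (complex_cat A) = comp_chain A"
  "Idn (complex_cat A) = (\<lambda>X n. Idn A (obj X n))"
  "Add (complex_cat A) = (\<lambda>X Y f g n. Add A (obj X n) (obj Y n) (f n) (g n))"
  "Zero (complex_cat A) = (\<lambda>X Y n. Zero A (obj X n) (obj Y n))"
  by (simp_all add: complex_cat_def)

lemma module_homsI: "lhom R M N f \<Longrightarrow> left_module R M \<Longrightarrow> (\<lambda>x\<in>carrier M. f x) \<in> module_homs R M N"
  unfolding module_homs_iff using lhom_cong[of M f "\<lambda>x\<in>carrier M. f x" R N] by simp

lemma module_homs_eqI:
  assumes "f \<in> module_homs R M N" "g \<in> module_homs R M N" "\<And>x. x \<in> carrier M \<Longrightarrow> f x = g x"
  shows "f = g"
  using assms by (auto simp: module_homs_iff intro: extensionalityI)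

lemma module_cat_preadd:
  fixes R :: "('r, 'z) ring_scheme" and \<kappa> :: "'u rel"
  shows "preadd (module_cat \<kappa> R)"
proof (rule preadd.intro)
  have comp: "compose (carrier L) g f \<in> module_homs R L N"
    if "left_module R L" "f \<in> module_homs R L M" "g \<in> module_homs R M N" for L M N :: "('r, 'u) module" and f g
    unfolding compose_def using that lhom_comp by (intro module_homsI) (auto simp: module_homs_iff)
  have assoc: "compose (carrier W) (compose (carrier X) h g) f = compose (carrier W) h (compose (carrier W) g f)"
    if "f \<in> module_homs R W X" for W X :: "('r, 'u) module" and f g h
    using that by (auto simp: compose_def module_homs_iff fun_eq_iff restrict_def lhom_closed)
  have unit: "compose (carrier X) f (\<lambda>x\<in>carrier X. x) = f" "compose (carrier X) (\<lambda>x\<in>carrier Y. x) f = f"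
    if "f \<in> module_homs R X Y" for X Y :: "('r, 'u) module" and f
    using that by (auto simp: compose_def module_homs_iff fun_eq_iff restrict_def lhom_closed extensional_def)
  have idn: "(\<lambda>x\<in>carrier X. x) \<in> module_homs R X X" if "left_module R X" for X :: "('r, 'u) module"
    by (rule module_homsI) (use that in \<open>auto simp: lhom_def\<close>)
  show "is_category (module_cat \<kappa> R)"
    unfolding is_category_def by (simp add: assoc unit idn comp)
next
  fix X Y :: "('r, 'u) module" assume "X \<in> Ob (module_cat \<kappa> R)" "Y \<in> Ob (module_cat \<kappa> R)"
  then have X: "left_module R X" and Y: "left_module R Y" by auto
  interpret Y: left_module R Y by (rule Y)
  have c: "f x \<in> carrier Y" if "f \<in> module_homs R X Y" "x \<in> carrier X" for f x
    using that lhom_closed by (auto simp: module_homs_iff)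
  have e: "f x = undefined" if "f \<in> module_homs R X Y" "x \<notin> carrier X" for f x
    using that by (auto simp: module_homs_iff extensional_def)
  show "abelian_group (hom_group (module_cat \<kappa> R) X Y)"
  proof (rule abelian_groupI; simp)
    show "(\<lambda>x\<in>carrier X. f x \<oplus>\<^bsub>Y\<^esub> g x) \<in> module_homs R X Y"
      if "f \<in> module_homs R X Y" "g \<in> module_homs R X Y" for f g
      using that by (intro module_homsI[OF _ X] lhom_plus[OF Y]) (auto simp: module_homs_iff)
    show "(\<lambda>x\<in>carrier X. \<zero>\<^bsub>Y\<^esub>) \<in> module_homs R X Y"
      by (rule module_homsI[OF lhom_const_zero[OF Y] X])
    show "\<exists>g\<in>module_homs R X Y. (\<lambda>x\<in>carrier X. g x \<oplus>\<^bsub>Y\<^esub> f x) = (\<lambda>x\<in>carrier X. \<zero>\<^bsub>Y\<^esub>)"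
      if f: "f \<in> module_homs R X Y" for f
    proof (rule bexI)
      show "(\<lambda>x\<in>carrier X. \<ominus>\<^bsub>Y\<^esub> f x) \<in> module_homs R X Y"
        using f by (intro module_homsI[OF lhom_uminus[OF Y] X]) (auto simp: module_homs_iff)
      show "(\<lambda>x\<in>carrier X. (\<lambda>x\<in>carrier X. \<ominus>\<^bsub>Y\<^esub> f x) x \<oplus>\<^bsub>Y\<^esub> f x) = (\<lambda>x\<in>carrier X. \<zero>\<^bsub>Y\<^esub>)"
        using c[OF f] by (auto simp: Y.M.l_neg fun_eq_iff restrict_def)
    qed
  qed ((use c in \<open>auto simp: Y.M.a_ac fun_eq_iff restrict_def\<close>), metis e)
next
  fix X Y Z :: "('r, 'u) module" and f g g'
  assume "X \<in> Ob (module_cat \<kappa> R)" "Y \<in> Ob (module_cat \<kappa> R)" "Z \<in> Ob (module_cat \<kappa> R)"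
    "f \<in> Hom (module_cat \<kappa> R) X Y" "g \<in> Hom (module_cat \<kappa> R) Y Z" "g' \<in> Hom (module_cat \<kappa> R) Y Z"
  then show "Comp (module_cat \<kappa> R) X Y Z (Add (module_cat \<kappa> R) Y Z g g') f =
      Add (module_cat \<kappa> R) X Z (Comp (module_cat \<kappa> R) X Y Z g f) (Comp (module_cat \<kappa> R) X Y Z g' f)"
    by (auto simp: compose_def fun_eq_iff restrict_def module_homs_iff lhom_closed)
next
  fix X Y Z :: "('r, 'u) module" and f f' g
  assume "X \<in> Ob (module_cat \<kappa> R)" "Y \<in> Ob (module_cat \<kappa> R)" "Z \<in> Ob (module_cat \<kappa> R)"
    "f \<in> Hom (module_cat \<kappa> R) X Y" "f' \<in> Hom (module_cat \<kappa> R) X Y" "g \<in> Hom (module_cat \<kappa> R) Y Z"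
  then show "Comp (module_cat \<kappa> R) X Y Z g (Add (module_cat \<kappa> R) X Y f f') =
      Add (module_cat \<kappa> R) X Z (Comp (module_cat \<kappa> R) X Y Z g f) (Comp (module_cat \<kappa> R) X Y Z g f')"
    by (auto simp: compose_def fun_eq_iff restrict_def module_homs_iff lhom_closed lhom_add)
qed

lemma complexes_iff: "Y \<in> complexes (module_cat \<kappa> R) \<longleftrightarrow> cx R Y \<and>
    (\<forall>m. |carrier (obj Y m)| <o \<kappa>) \<and> (\<forall>m. diff Y m \<in> extensional (carrier (obj Y m)))"
  unfolding complexes_def cx_def
  by (auto simp: module_homs_iff compose_def fun_eq_iff restrict_def)

lemma complexesD:
  assumes "Y \<in> complexes (module_cat \<kappa> R)"
  shows "cx R Y" "|carrier (obj Y m)| <o \<kappa>" "diff Y m \<in> extensional (carrier (obj Y m))"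
  using assms by (auto simp: complexes_iff)

lemma chain_maps_iff:
  assumes "Y \<in> complexes (module_cat \<kappa> R)" "Z \<in> complexes (module_cat \<kappa> R)"
  shows "f \<in> chain_maps (module_cat \<kappa> R) Y Z \<longleftrightarrow> cmap R Y Z f \<and> (\<forall>m. f m \<in> extensional (carrier (obj Y m)))"
  unfolding chain_maps_def cmap_def
  by (auto simp: module_homs_iff compose_def fun_eq_iff restrict_def)

lemma chain_mapsI:
  assumes "Y \<in> complexes (module_cat \<kappa> R)" "Z \<in> complexes (module_cat \<kappa> R)" "cmap R Y Z f"
  shows "(\<lambda>m. \<lambda>x\<in>carrier (obj Y m). f m x) \<in> chain_maps (module_cat \<kappa> R) Y Z"
  unfolding chain_maps_iff[OF assms(1,2)]
  using cmap_cong[OF complexesD(1)[OF assms(1)] assms(3)] by simp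

lemma chain_maps_eqI:
  assumes "f \<in> chain_maps (module_cat \<kappa> R) Y Z" "g \<in> chain_maps (module_cat \<kappa> R) Y Z"
    "\<And>m x. x \<in> carrier (obj Y m) \<Longrightarrow> f m x = g m x"
  shows "f = g"
proof
  fix m
  have "f m \<in> module_homs R (obj Y m) (obj Z m)" "g m \<in> module_homs R (obj Y m) (obj Z m)"
    using assms(1,2) by (auto simp: chain_maps_def)
  then show "f m = g m" by (rule module_homs_eqI) (rule assms(3))
qed

lemma comp_chain_apply:
  "x \<in> carrier (obj X m) \<Longrightarrow> comp_chain (module_cat \<kappa> R) X Y Z g f m x = g m (f m x)"
  by (simp add: comp_chain_def compose_def)

section \<open>Epimorphisms and projective objects among complexes of modules\<close>

lemma epi_if_surj:
  assumes Y: "Y \<in> complexes (module_cat \<kappa> R)" and Z: "Z \<in> complexes (module_cat \<kappa> R)"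
    and e: "e \<in> chain_maps (module_cat \<kappa> R) Y Z"
    and surj: "\<And>m z. z \<in> carrier (obj Z m) \<Longrightarrow> \<exists>y\<in>carrier (obj Y m). e m y = z"
  shows "is_epi (complex_cat (module_cat \<kappa> R)) Y Z e"
  unfolding is_epi_def complex_cat_simps
proof (intro conjI ballI impI)
  fix W g h
  assume W: "W \<in> complexes (module_cat \<kappa> R)" and g: "g \<in> chain_maps (module_cat \<kappa> R) Z W"
    and h: "h \<in> chain_maps (module_cat \<kappa> R) Z W"
    and eq: "comp_chain (module_cat \<kappa> R) Y Z W g e = comp_chain (module_cat \<kappa> R) Y Z W h e"
  show "g = h"
  proof (rule chain_maps_eqI[OF g h])
    fix m z assume "z \<in> carrier (obj Z m)"
    then obtain y where y: "y \<in> carrier (obj Y m)" "e m y = z" using surj by blast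
    show "g m z = h m z"
      using fun_cong[OF fun_cong[OF eq, of m], of y] y by (simp add: comp_chain_apply)
  qed
qed (rule e)

text \<open>The test object is the disk complex on the cokernel in degree \<open>m0\<close>: the
  quotient map extends to a chain map into it that agrees with zero after composition with
  \<open>e\<close>, hence is zero, so the cokernel vanishes.\<close>

lemma surj_if_epi:
  fixes R :: "('r, 'z) ring_scheme" and \<kappa> :: "'u rel"
  assumes Y: "Y \<in> complexes (module_cat \<kappa> R)" and Z: "Z \<in> complexes (module_cat \<kappa> R)"
    and epi: "is_epi (complex_cat (module_cat \<kappa> R)) Y Z e" and z0: "z0 \<in> carrier (obj Z m0)"
  shows "\<exists>y\<in>carrier (obj Y m0). e m0 y = z0"
proof -
  have e: "e \<in> chain_maps (module_cat \<kappa> R) Y Z" using epi by (simp add: is_epi_def)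
  then have ec: "cmap R Y Z e" by (simp add: chain_maps_iff[OF Y Z])
  note Yc = complexesD(1)[OF Y] and Zc = complexesD(1)[OF Z]
  define N where "N = obj Z m0"
  interpret N: left_module R N unfolding N_def by (rule cx_module[OF Zc])
  define I where "I = e m0 ` carrier (obj Y m0)"
  interpret Y0: left_module R "obj Y m0" by (rule cx_module[OF Yc])
  have I: "\<zero>\<^bsub>N\<^esub> \<in> I" "\<And>x y. x \<in> I \<Longrightarrow> y \<in> I \<Longrightarrow> x \<oplus>\<^bsub>N\<^esub> y \<in> I" "\<And>x. x \<in> I \<Longrightarrow> \<ominus>\<^bsub>N\<^esub> x \<in> I"
    "\<And>a x. a \<in> carrier R \<Longrightarrow> x \<in> I \<Longrightarrow> a \<odot>\<^bsub>N\<^esub> x \<in> I" "I \<subseteq> carrier N"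
    unfolding I_def N_def
    using cmap_zero[OF Yc Zc ec, of m0, symmetric] cmap_add[OF ec, of _ m0, symmetric]
      cmap_minus[OF Yc Zc ec, of _ m0, symmetric] lhom_smult[OF cmap_lhom[OF ec], of _ _ m0, symmetric]
      cmap_closed[OF ec]
    by (auto intro: Y0.smult_closed)
  \<comment> \<open>Cosets are replaced by chosen representatives, so that the cokernel has its
    carrier in \<open>'u\<close> and stays below \<open>\<kappa>\<close>.\<close>
  define q where "q x = (SOME w. w \<in> carrier N \<and> x \<oplus>\<^bsub>N\<^esub> \<ominus>\<^bsub>N\<^esub> w \<in> I)" for x
  have q: "q x \<in> carrier N" "x \<oplus>\<^bsub>N\<^esub> \<ominus>\<^bsub>N\<^esub> q x \<in> I" if "x \<in> carrier N" for x
    using someI[of "\<lambda>w. w \<in> carrier N \<and> x \<oplus>\<^bsub>N\<^esub> \<ominus>\<^bsub>N\<^esub> w \<in> I" x] that I(1)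
    by (auto simp: q_def N.M.r_neg)
  have trans: "x \<oplus>\<^bsub>N\<^esub> \<ominus>\<^bsub>N\<^esub> z \<in> I"
    if "x \<in> carrier N" "y \<in> carrier N" "z \<in> carrier N" "x \<oplus>\<^bsub>N\<^esub> \<ominus>\<^bsub>N\<^esub> y \<in> I" "y \<oplus>\<^bsub>N\<^esub> \<ominus>\<^bsub>N\<^esub> z \<in> I" for x y z
  proof -
    have "x \<oplus>\<^bsub>N\<^esub> \<ominus>\<^bsub>N\<^esub> z = (x \<oplus>\<^bsub>N\<^esub> \<ominus>\<^bsub>N\<^esub> y) \<oplus>\<^bsub>N\<^esub> (y \<oplus>\<^bsub>N\<^esub> \<ominus>\<^bsub>N\<^esub> z)"
      using that(1-3) by (metis N.M.a_assoc N.M.a_inv_closed N.M.l_neg N.M.r_zero N.M.add.m_closed N.M.l_zero)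
    then show ?thesis using I(2) that by simp
  qed
  have sym: "y \<oplus>\<^bsub>N\<^esub> \<ominus>\<^bsub>N\<^esub> x \<in> I" if "x \<in> carrier N" "y \<in> carrier N" "x \<oplus>\<^bsub>N\<^esub> \<ominus>\<^bsub>N\<^esub> y \<in> I" for x y
    using I(3)[OF that(3)] that(1,2) by (simp add: N.M.minus_add N.M.a_comm)
  have q_iff: "q x = q y \<longleftrightarrow> x \<oplus>\<^bsub>N\<^esub> \<ominus>\<^bsub>N\<^esub> y \<in> I" if x: "x \<in> carrier N" and y: "y \<in> carrier N" for x y
  proof
    assume "q x = q y"
    then show "x \<oplus>\<^bsub>N\<^esub> \<ominus>\<^bsub>N\<^esub> y \<in> I"
      using trans[OF x q(1)[OF y] y] q(2)[OF x] sym[OF y q(1)[OF y] q(2)[OF y]] by simp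
  next
    assume xy: "x \<oplus>\<^bsub>N\<^esub> \<ominus>\<^bsub>N\<^esub> y \<in> I"
    have "(x \<oplus>\<^bsub>N\<^esub> \<ominus>\<^bsub>N\<^esub> w \<in> I) = (y \<oplus>\<^bsub>N\<^esub> \<ominus>\<^bsub>N\<^esub> w \<in> I)" if "w \<in> carrier N" for w
      using trans[OF x y that xy] trans[OF y x that sym[OF x y xy]] by blast
    then show "q x = q y" unfolding q_def by metis
  qed
  have mz: "\<ominus>\<^bsub>N\<^esub> \<zero>\<^bsub>N\<^esub> = \<zero>\<^bsub>N\<^esub>"
    using N.M.minus_equality[of "\<zero>\<^bsub>N\<^esub>" "\<zero>\<^bsub>N\<^esub>"] by simp
  have qm: "left_module R (image_mod q N)" "lhom R N (image_mod q N) q"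
  proof -
    have a: "q (x \<oplus>\<^bsub>N\<^esub> y) = q (x' \<oplus>\<^bsub>N\<^esub> y')"
      if "x \<in> carrier N" "x' \<in> carrier N" "y \<in> carrier N" "y' \<in> carrier N" "q x = q x'" "q y = q y'" for x x' y y'
    proof -
      have "(x \<oplus>\<^bsub>N\<^esub> y) \<oplus>\<^bsub>N\<^esub> \<ominus>\<^bsub>N\<^esub> (x' \<oplus>\<^bsub>N\<^esub> y') = (x \<oplus>\<^bsub>N\<^esub> \<ominus>\<^bsub>N\<^esub> x') \<oplus>\<^bsub>N\<^esub> (y \<oplus>\<^bsub>N\<^esub> \<ominus>\<^bsub>N\<^esub> y')"
        using that(1-4) by (simp add: N.M.minus_add N.M.a_ac)
      then show ?thesis using that I(2) by (simp add: q_iff)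
    qed
    have m: "q (a \<odot>\<^bsub>N\<^esub> x) = q (a \<odot>\<^bsub>N\<^esub> x')"
      if "a \<in> carrier R" "x \<in> carrier N" "x' \<in> carrier N" "q x = q x'" for a x x'
    proof -
      have "a \<odot>\<^bsub>N\<^esub> x \<oplus>\<^bsub>N\<^esub> \<ominus>\<^bsub>N\<^esub> (a \<odot>\<^bsub>N\<^esub> x') = a \<odot>\<^bsub>N\<^esub> (x \<oplus>\<^bsub>N\<^esub> \<ominus>\<^bsub>N\<^esub> x')"
        using that(1-3) by (simp add: N.smult_r_distr N.smult_minus)
      then show ?thesis using that I(4) by (simp add: q_iff N.smult_closed)
    qed
    show "left_module R (image_mod q N)" "lhom R N (image_mod q N) q"
      by (rule image_mod_module[OF N.left_module_axioms a m]; assumption)+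
  qed
  \<comment> \<open>The zero module, realised on the singleton of the element \<open>z0\<close> at
    hand.\<close>
  have tm: "left_module R (image_mod (\<lambda>_. z0) N)"
    by (rule image_mod_module[OF N.left_module_axioms]) auto
  have Nk: "|carrier N| <o \<kappa>" unfolding N_def by (rule complexesD(2)[OF Z])
  \<comment> \<open>The disk: the cokernel in degrees \<open>m0\<close> and \<open>m0 + 1\<close>
    with identity differential between them, and zero elsewhere.\<close>
  define W where "W = \<lparr>obj = (\<lambda>m. if m = m0 \<or> m = m0 + 1 then image_mod q N else image_mod (\<lambda>_. z0) N),
    diff = (\<lambda>m. if m = m0 + 1 then (\<lambda>x\<in>q ` carrier N. x)
      else if m = m0 then (\<lambda>x\<in>q ` carrier N. \<zero>\<^bsub>image_mod (\<lambda>_. z0) N\<^esub>)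
      else (\<lambda>x\<in>{z0}. if m = m0 + 2 then \<zero>\<^bsub>image_mod q N\<^esub> else \<zero>\<^bsub>image_mod (\<lambda>_. z0) N\<^esub>))\<rparr>"
  have tc: "carrier (image_mod (\<lambda>_. z0) N) = {z0}" "\<zero>\<^bsub>image_mod (\<lambda>_. z0) N\<^esub> = z0"
    by (auto simp: image_mod_def Let_def intro: image_eqI[OF _ N.M.zero_closed])
  interpret Q: left_module R "image_mod q N" by (rule qm(1))
  have W_obj: "obj W m = (if m = m0 \<or> m = m0 + 1 then image_mod q N else image_mod (\<lambda>_. z0) N)" for m
    by (simp add: W_def)
  have Wm: "left_module R (obj W m)" for m using qm(1) tm by (simp add: W_obj)
  have W_diff: "diff W m = (\<lambda>x\<in>carrier (obj W m). if m = m0 + 1 then x else \<zero>\<^bsub>obj W (m - 1)\<^esub>)" for m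
    by (auto simp: W_def tc fun_eq_iff restrict_def)
  have Wcx: "cx R W"
    unfolding cx_def
  proof (intro conjI allI ballI)
    show "lhom R (obj W m) (obj W (m - 1)) (diff W m)" for m
    proof (cases "m = m0 + 1")
      case True
      then have "lhom R (obj W m) (obj W (m - 1)) (\<lambda>x. x)" by (simp add: W_obj lhom_def)
      then show ?thesis
        by (rule lhom_cong[rotated 2]) (use Wm True in \<open>auto simp: W_diff\<close>)
    next
      case False
      show ?thesis
        by (rule lhom_cong[OF _ Wm lhom_const_zero[OF Wm]]) (use False in \<open>simp add: W_diff\<close>)
    qed
    fix m x assume x: "x \<in> carrier (obj W m)"
    show "diff W (m - 1) (diff W m x) = \<zero>\<^bsub>obj W (m - 2)\<^esub>"
    proof -
      interpret Wl: left_module R "obj W (m - 1)" by (rule Wm)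
      have "\<zero>\<^bsub>image_mod q N\<^esub> \<in> q ` carrier N" using Q.M.zero_closed by simp
      then show ?thesis using x by (auto simp: W_diff) (simp_all add: W_obj)
    qed
  qed (rule Wm)
  have "|carrier (obj W m)| <o \<kappa>" for m
    using Nk by (simp add: W_obj card_less_image del: image_constant_conv)
  then have W: "W \<in> complexes (module_cat \<kappa> R)"
    unfolding complexes_iff using Wcx by (simp add: W_diff)
  \<comment> \<open>In degree \<open>m0 + 1\<close> compatibility with the identity differential
    forces the quotient map after \<open>diff Z\<close>.\<close>
  define f where "f m z = (if m = m0 then q z else if m = m0 + 1 then q (diff Z m z) else \<zero>\<^bsub>obj W m\<^esub>)" for m z
  have q0: "q \<zero>\<^bsub>N\<^esub> = \<zero>\<^bsub>image_mod q N\<^esub>" by (rule lhom_zero[OF N.left_module_axioms qm])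
  have fc: "cmap R Z W f"
    unfolding cmap_def
  proof (intro conjI allI ballI)
    fix m
    show "lhom R (obj Z m) (obj W m) (f m)"
    proof -
      consider "m = m0" | "m = m0 + 1" | "m \<noteq> m0" "m \<noteq> m0 + 1" by blast
      then show ?thesis
      proof cases
        case 1
        moreover from 1 have "f m = q" by (simp add: f_def fun_eq_iff)
        ultimately show ?thesis using qm(2) by (simp add: W_obj N_def)
      next
        case 2
        moreover from 2 have "f m = (\<lambda>z. q (diff Z m z))" by (simp add: f_def fun_eq_iff)
        ultimately show ?thesis
          using lhom_comp[OF cx_lhom[OF Zc, of m], of "image_mod q N" q] qm(2) by (simp add: W_obj N_def)
      next
        case 3
        then have "f m = (\<lambda>z. \<zero>\<^bsub>obj W m\<^esub>)" by (simp add: f_def fun_eq_iff)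
        then show ?thesis using lhom_const_zero[OF Wm] by simp
      qed
    qed
    fix z assume z: "z \<in> carrier (obj Z m)"
    have z1: "diff Z m z \<in> carrier (obj Z (m - 1))" by (rule cx_closed[OF Zc z])
    have fz: "f m z \<in> carrier (obj W m)"
      using \<open>lhom R (obj Z m) (obj W m) (f m)\<close> z by (rule lhom_closed)
    show "f (m - 1) (diff Z m z) = diff W m (f m z)"
    proof -
      consider "m = m0 + 1" | "m = m0 + 2" | "m \<noteq> m0 + 1" "m \<noteq> m0 + 2" by blast
      then show ?thesis
      proof cases
        case 1
        then show ?thesis using fz by (simp add: W_diff) (simp add: f_def)
      next
        case 2
        then have m: "m - 1 = m0 + 1" "m - 2 = m0" by simp_all
        have "diff Z (m0 + 1) (diff Z m z) = \<zero>\<^bsub>N\<^esub>"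
          using cx_diff2[OF Zc z] unfolding m N_def .
        then show ?thesis using 2 fz q0 by (simp add: W_diff) (simp add: f_def W_obj add.commute)
      next
        case 3
        then show ?thesis using fz by (simp add: W_diff) (simp add: f_def)
      qed
    qed
  qed
  define g where "g = (\<lambda>m. \<lambda>z\<in>carrier (obj Z m). f m z)"
  define g' where "g' = (\<lambda>m. \<lambda>z\<in>carrier (obj Z m). \<zero>\<^bsub>obj W m\<^esub>)"
  have gg: "g \<in> chain_maps (module_cat \<kappa> R) Z W" "g' \<in> chain_maps (module_cat \<kappa> R) Z W"
    unfolding g_def g'_def by (rule chain_mapsI[OF Z W] fc cmap_const_zero[OF Wcx])+
  have kill: "f m (e m y) = \<zero>\<^bsub>obj W m\<^esub>" if y: "y \<in> carrier (obj Y m)" for m y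
  proof -
    have qI: "q w = \<zero>\<^bsub>image_mod q N\<^esub>" if "w \<in> I" for w
    proof -
      have "w \<in> carrier N" using that I(5) by blast
      then have "q w = q \<zero>\<^bsub>N\<^esub>" using that q_iff[of w "\<zero>\<^bsub>N\<^esub>"] by (simp add: mz)
      then show ?thesis using q0 by simp
    qed
    consider "m = m0" | "m = m0 + 1" | "m \<noteq> m0" "m \<noteq> m0 + 1" by blast
    then show ?thesis
    proof cases
      case 1
      then show ?thesis using y qI by (simp add: f_def I_def W_obj)
    next
      case 2
      have "diff Z m (e m y) = e m0 (diff Y m y)" using cmap_diff[OF ec y] 2 by simp
      moreover have "diff Y m y \<in> carrier (obj Y m0)" using cx_closed[OF Yc y] 2 by simp
      ultimately show ?thesis using 2 qI by (simp add: f_def I_def W_obj)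
    next
      case 3
      then show ?thesis by (simp add: f_def)
    qed
  qed
  have "comp_chain (module_cat \<kappa> R) Y Z W g e = comp_chain (module_cat \<kappa> R) Y Z W g' e"
  proof -
    have "g m (e m y) = g' m (e m y)" if "y \<in> carrier (obj Y m)" for m y
      using kill[OF that] cmap_closed[OF ec that] by (simp add: g_def g'_def)
    then show ?thesis by (auto simp: comp_chain_def compose_def fun_eq_iff restrict_def)
  qed
  then have "g = g'" using epi W gg by (auto simp: is_epi_def)
  then have "g m0 z0 = g' m0 z0" by simp
  then have "q z0 = q \<zero>\<^bsub>N\<^esub>"
    using z0 q0 by (simp add: g_def g'_def f_def W_obj)
  moreover have "z0 \<in> carrier N" using z0 by (simp add: N_def)
  ultimately have "z0 \<in> I" using q_iff[of z0 "\<zero>\<^bsub>N\<^esub>"] by (simp add: mz)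
  then show ?thesis by (auto simp: I_def)
qed

lemma image_cx_complexes:
  assumes "cx R F" "\<And>m. inj_on e (carrier (obj F m))" "\<And>m. |carrier (obj F m)| <o \<kappa>"
  shows "image_cx e F \<in> complexes (module_cat \<kappa> R)"
  unfolding complexes_iff using image_cx_props(1)[OF assms(1,2)] image_cx_ext assms(3) by (auto simp: card_less_image)

text \<open>Epimorphisms are surjective in every degree, so the images of generators can be lifted
  one by one and the lifts extended freely; \<open>e\<close> only copies the free complex into
  \<open>'u\<close>.\<close>

lemma projective_free:
  fixes R :: "('r, 'z) ring_scheme" and \<kappa> :: "'u rel" and e :: "('g \<times> bool \<Rightarrow> 'r) \<Rightarrow> 'u"
  assumes "ring R" and inj: "\<And>m. inj_on e (carrier (obj (free_cx R \<Gamma> deg) m))"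
    and small: "\<And>m. |carrier (obj (free_cx R \<Gamma> deg) m)| <o \<kappa>"
  shows "projective_object (complex_cat (module_cat \<kappa> R)) (image_cx e (free_cx R \<Gamma> deg))"
proof -
  interpret ring R by fact
  let ?F = "free_cx R \<Gamma> deg"
  note T = image_cx_complexes[OF free_cx_cx inj small] and I = image_cx_props[OF free_cx_cx inj]
  show ?thesis
    unfolding projective_object_def complex_cat_simps
  proof (intro conjI ballI allI impI)
    fix Y Z \<epsilon> f
    assume Y: "Y \<in> complexes (module_cat \<kappa> R)" and Z: "Z \<in> complexes (module_cat \<kappa> R)"
      and epi: "is_epi (complex_cat (module_cat \<kappa> R)) Y Z \<epsilon>"
      and f: "f \<in> chain_maps (module_cat \<kappa> R) (image_cx e ?F) Z"
    note Yc = complexesD(1)[OF Y] and Zc = complexesD(1)[OF Z]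
    have \<epsilon>: "cmap R Y Z \<epsilon>" using epi by (simp add: is_epi_def chain_maps_iff[OF Y Z])
    have fc: "cmap R (image_cx e ?F) Z f" using f by (simp add: chain_maps_iff[OF T Z])
    note fe = cmap_comp[OF I(2) fc]
    have "\<exists>y\<in>carrier (obj Y (deg g)). \<epsilon> (deg g) y = f (deg g) (e (unit_vec R (g, False)))" if "g \<in> \<Gamma>" for g
      by (rule surj_if_epi[OF Y Z epi cmap_closed[OF fe unit_vec_free_cx[OF that]]])
    then obtain y where y: "y g \<in> carrier (obj Y (deg g))" "\<epsilon> (deg g) (y g) = f (deg g) (e (unit_vec R (g, False)))"
      if "g \<in> \<Gamma>" for g by metis
    have ey: "cmap R ?F Y (cx_ext R Y deg y)" by (rule cx_ext_cmap[OF Yc y(1)])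
    note G = cmap_comp[OF I(3) ey]
    have eq: "\<epsilon> m (cx_ext R Y deg y m \<phi>) = f m (e \<phi>)" if "\<phi> \<in> carrier (obj ?F m)" for m \<phi>
      by (rule cmap_free_cx_eqI[OF Zc cmap_comp[OF ey \<epsilon>] fe _ that]) (use y cx_ext_gen[OF Yc] in metis)
    let ?G = "\<lambda>m. \<lambda>z\<in>carrier (obj (image_cx e ?F) m). cx_ext R Y deg y m (image_cx_inv e ?F m z)"
    have G': "?G \<in> chain_maps (module_cat \<kappa> R) (image_cx e ?F) Y" by (rule chain_mapsI[OF T Y G])
    interpret MC: preadd "module_cat \<kappa> R" by (rule module_cat_preadd)
    show "\<exists>g\<in>chain_maps (module_cat \<kappa> R) (image_cx e ?F) Y. comp_chain (module_cat \<kappa> R) (image_cx e ?F) Y Z \<epsilon> g = f"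
    proof (rule bexI[OF _ G'], rule chain_maps_eqI[OF MC.comp_chain_maps[OF T Y Z G'] f])
      show "\<epsilon> \<in> chain_maps (module_cat \<kappa> R) Y Z" using epi by (simp add: is_epi_def)
      fix m z assume z: "z \<in> carrier (obj (image_cx e ?F) m)"
      then obtain \<phi> where \<phi>: "\<phi> \<in> carrier (obj ?F m)" "z = e \<phi>" unfolding image_cx_carrier by blast
      show "comp_chain (module_cat \<kappa> R) (image_cx e ?F) Y Z \<epsilon> ?G m z = f m z"
        unfolding comp_chain_apply[OF z] using z eq[OF \<phi>(1)] image_cx_inv[OF inj \<phi>(1)] \<phi>(2) by simp
    qed
  qed (rule T)
qed

text \<open>If the chosen elements exhaust \<open>Q\<close>, evaluation is an epimorphism from a
  free complex, and lifting the identity of \<open>Q\<close> along it gives a section. The cardinal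
  bounds are used to place the free complex in the universe.\<close>

lemma projective_section:
  fixes R :: "('r, 'z) ring_scheme" and \<kappa> :: "'u rel" and val :: "'g \<Rightarrow> 'u"
  assumes "ring R" and univ: "universe_cardinal \<kappa>" and R: "|carrier R| <o \<kappa>"
    and Q: "projective_object (complex_cat (module_cat \<kappa> R)) Q" and \<Gamma>: "|\<Gamma>| <o \<kappa>"
    and val: "\<And>g. g \<in> \<Gamma> \<Longrightarrow> val g \<in> carrier (obj Q (deg g))"
    and surj: "\<And>m x. x \<in> carrier (obj Q m) \<Longrightarrow> \<exists>g\<in>\<Gamma>. deg g = m \<and> val g = x"
  shows "\<exists>i. cmap R Q (free_cx R \<Gamma> deg) i \<and> (\<forall>m. \<forall>x\<in>carrier (obj Q m). cx_ext R Q deg val m (i m x) = x)"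
proof -
  interpret ring R by fact
  let ?F = "free_cx R \<Gamma> deg"
  let ?A = "carrier (free_mod R (\<Gamma> \<times> (UNIV :: bool set)))"
  have "|?A| <o \<kappa>"
    by (intro card_less_free_mod[OF univ R] card_less_Times[OF univ \<Gamma>] card_less_countable[OF univ]) auto
  moreover from card_less_embed[OF this] obtain e :: "('g \<times> bool \<Rightarrow> 'r) \<Rightarrow> 'u" where e: "inj_on e ?A" by blast
  moreover have sub: "carrier (obj ?F m) \<subseteq> ?A" for m
    unfolding free_cx_obj by (intro subsetI, erule free_mod_mono[rotated]) auto
  ultimately have inj: "\<And>m. inj_on e (carrier (obj ?F m))" and small: "\<And>m. |carrier (obj ?F m)| <o \<kappa>"
    by (blast intro: inj_on_subset card_less_mono)+
  note T = image_cx_complexes[OF free_cx_cx inj small] and I = image_cx_props[OF free_cx_cx inj]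
  have Qc: "Q \<in> complexes (module_cat \<kappa> R)" using Q by (simp add: projective_object_def)
  note Qx = complexesD(1)[OF Qc]
  have ev: "cmap R ?F Q (cx_ext R Q deg val)" by (rule cx_ext_cmap[OF Qx val])
  let ?p = "\<lambda>m. \<lambda>z\<in>carrier (obj (image_cx e ?F) m). cx_ext R Q deg val m (image_cx_inv e ?F m z)"
  have p: "?p \<in> chain_maps (module_cat \<kappa> R) (image_cx e ?F) Q"
    by (rule chain_mapsI[OF T Qc cmap_comp[OF I(3) ev]])
  have "is_epi (complex_cat (module_cat \<kappa> R)) (image_cx e ?F) Q ?p"
  proof (rule epi_if_surj[OF T Qc p])
    fix m x assume "x \<in> carrier (obj Q m)"
    then obtain g where g: "g \<in> \<Gamma>" "deg g = m" "val g = x" using surj by blast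
    have b: "unit_vec R (g, False) \<in> carrier (obj ?F m)" using unit_vec_free_cx[OF g(1), of deg] g(2) by simp
    have "cx_ext R Q deg val m (unit_vec R (g, False)) = x"
      using cx_ext_gen[OF Qx, of val g deg] val[OF g(1)] g by simp
    then show "\<exists>y\<in>carrier (obj (image_cx e ?F) m). ?p m y = x"
      using b image_cx_inv[OF inj b] by (intro bexI[of _ "e (unit_vec R (g, False))"]) auto
  qed
  moreover have idn: "(\<lambda>m. \<lambda>x\<in>carrier (obj Q m). x) \<in> chain_maps (module_cat \<kappa> R) Q Q"
    by (rule chain_mapsI[OF Qc Qc cmap_id])
  ultimately obtain s where s: "s \<in> chain_maps (module_cat \<kappa> R) Q (image_cx e ?F)"
    "comp_chain (module_cat \<kappa> R) Q (image_cx e ?F) Q ?p s = (\<lambda>m. \<lambda>x\<in>carrier (obj Q m). x)"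
    using Q T Qc unfolding projective_object_def complex_cat_simps by blast
  have sc: "cmap R Q (image_cx e ?F) s" using s(1) by (simp add: chain_maps_iff[OF Qc T])
  have "cx_ext R Q deg val m (image_cx_inv e ?F m (s m x)) = x" if x: "x \<in> carrier (obj Q m)" for m x
    using fun_cong[OF fun_cong[OF s(2), of m], of x] x cmap_closed[OF sc x] by (simp add: comp_chain_apply del: image_cx_carrier)
  then show ?thesis using cmap_comp[OF sc I(3)] by blast
qed

section \<open>The right adjoint\<close>

text \<open>The equations are pulled back along \<open>\<pi>\<close>, the evaluation from the free
  objects onto \<open>Q\<close>, solved there, and the solution is restricted along the section
  \<open>i\<close>. The differential on the free side is \<open>i D \<pi>\<close>.\<close>

lemma (in dcx) projective_solution:
  fixes \<kappa> :: "'u rel"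
  assumes univ: "universe_cardinal \<kappa>" and R: "|carrier R| <o \<kappa>"
    and Q: "\<And>n. projective_object (complex_cat (module_cat \<kappa> R)) (Q n)"
    and D: "\<And>n. cmap R (Q n) (Q (n - 1)) (D n)"
    and DD: "\<And>n m x. x \<in> carrier (obj (Q n) m) \<Longrightarrow> D (n - 1) m (D n m x) = \<zero>\<^bsub>obj (Q (n - 2)) m\<^esub>"
    and h: "\<And>n. cmap R (Q n) (PC (n - 1)) (h n)"
    and u: "\<And>n. cmap R (Q n) (X n) (u n)"
    and dh: "\<And>n m x. x \<in> carrier (obj (Q n) m) \<Longrightarrow> dP (n - 1) m (h n m x) = h (n - 1) m (D n m x)"
    and ph: "\<And>n m x. x \<in> carrier (obj (Q n) m) \<Longrightarrow>
      pP (n - 1) m (h n m x) = dX n m (u n m x) \<oplus>\<^bsub>obj (X (n - 1)) m\<^esub> u (n - 1) m (D n m x)"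
  shows "\<exists>T. (\<forall>n. cmap R (Q n) (PC n) (T n)) \<and>
    (\<forall>n m. \<forall>x\<in>carrier (obj (Q n) m).
      h n m x = dP n m (T n m x) \<oplus>\<^bsub>obj (PC (n - 1)) m\<^esub> T (n - 1) m (D n m x) \<and> u n m x = pP n m (T n m x))"
proof -
  have Qk: "Q n \<in> complexes (module_cat \<kappa> R)" for n using Q[of n] by (simp add: projective_object_def)
  note Qc = complexesD(1)[OF Qk]
  \<comment> \<open>All elements of all \<open>Q n\<close>, tagged by their bidegree, serve as
    generators; this makes evaluation onto and the generating set small.\<close>
  define \<Gamma> where "\<Gamma> = {(n, m, x) |n m x. x \<in> carrier (obj (Q n) m)}"
  define od :: "int \<times> int \<times> 'u \<Rightarrow> int" where "od = fst"
  define deg :: "int \<times> int \<times> 'u \<Rightarrow> int" where "deg g = fst (snd g)" for g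
  define val :: "int \<times> int \<times> 'u \<Rightarrow> 'u" where "val g = snd (snd g)" for g
  let ?F = "fdc R \<Gamma> od deg"
  have "|\<Union>nm\<in>UNIV. carrier (obj (Q (fst nm)) (snd nm))| <o \<kappa>"
    by (intro card_less_UN[OF univ]) (auto intro: complexesD(2)[OF Qk])
  then have "|(UNIV :: int set) \<times> (UNIV :: int set) \<times> (\<Union>nm\<in>UNIV. carrier (obj (Q (fst nm)) (snd nm)))| <o \<kappa>"
    by (intro card_less_Times[OF univ]) (auto intro: card_less_countable[OF univ])
  then have \<Gamma>: "|\<Gamma>| <o \<kappa>"
    by (rule card_less_mono[rotated]) (force simp: \<Gamma>_def)
  have val: "val g \<in> carrier (obj (Q n) (deg g))" if "g \<in> \<Gamma>" "od g = n" for g n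
    using that by (auto simp: \<Gamma>_def od_def deg_def val_def)
  have ex: "\<exists>i. cmap R (Q n) (?F n) i \<and> (\<forall>m. \<forall>x\<in>carrier (obj (Q n) m). cx_ext R (Q n) deg val m (i m x) = x)" for n
  proof (rule projective_section[OF ring_axioms univ R Q])
    show "|{g \<in> \<Gamma>. od g = n}| <o \<kappa>" by (rule card_less_mono[OF _ \<Gamma>]) blast
    show "\<exists>g\<in>{g \<in> \<Gamma>. od g = n}. deg g = m \<and> val g = x" if "x \<in> carrier (obj (Q n) m)" for m x
      using that by (intro bexI[of _ "(n, m, x)"]) (auto simp: \<Gamma>_def od_def deg_def val_def)
  qed (use val in blast)
  then have "\<forall>n. \<exists>i. cmap R (Q n) (?F n) i \<and> (\<forall>m. \<forall>x\<in>carrier (obj (Q n) m). cx_ext R (Q n) deg val m (i m x) = x)"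
    by blast
  from choice[OF this] obtain i where i: "\<And>n. cmap R (Q n) (?F n) (i n)"
    and i_val: "\<And>n m x. x \<in> carrier (obj (Q n) m) \<Longrightarrow> cx_ext R (Q n) deg val m (i n m x) = x"
    by blast
  \<comment> \<open>Extending the values of \<open>f\<close> at the elements named by the generators
    is \<open>f\<close> after evaluation.\<close>
  have push: "cx_ext R Y deg (\<lambda>g. f (od g) (deg g) (val g)) m \<phi> = f n m (cx_ext R (Q n) deg val m \<phi>)"
    if Y: "cx R Y" and f: "cmap R (Q n) Y (f n)" and \<phi>: "\<phi> \<in> carrier (obj (?F n) m)"
    for Y :: "(('r, 'b) module, 'b \<Rightarrow> 'b) cplx" and f n m \<phi>
  proof -
    have "f n m (cx_ext R (Q n) deg val m \<phi>) = cx_ext R Y deg (\<lambda>g. f n (deg g) (val g)) m \<phi>"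
      by (rule cmap_cx_ext[OF Qc Y f _ \<phi>]) (use val in blast)
    also have "\<dots> = cx_ext R Y deg (\<lambda>g. f (od g) (deg g) (val g)) m \<phi>"
      by (rule cx_ext_cong[OF Y _ _ \<phi>]) (use cmap_closed[OF f val] in auto)
    finally show ?thesis by simp
  qed
  define D' where "D' g = i (od g - 1) (deg g) (D (od g) (deg g) (val g))" for g
  define h' where "h' g = h (od g) (deg g) (val g)" for g
  define u' where "u' g = u (od g) (deg g) (val g)" for g
  have iD: "cmap R (Q n) (?F (n - 1)) (\<lambda>m x. i (n - 1) m (D n m x))" for n
    by (rule cmap_comp[OF D i])
  have pushD: "cx_ext R (?F (n - 1)) deg D' m \<phi> = i (n - 1) m (D n m (cx_ext R (Q n) deg val m \<phi>))"
    if "\<phi> \<in> carrier (obj (?F n) m)" for n m \<phi>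
    unfolding D'_def
    using push[of _ n "\<lambda>n m x. i (n - 1) m (D n m x)", OF free_cx_cx iD that] .
  have pushh: "cx_ext R (PC (n - 1)) deg h' m \<phi> = h n m (cx_ext R (Q n) deg val m \<phi>)"
    if "\<phi> \<in> carrier (obj (?F n) m)" for n m \<phi>
    unfolding h'_def by (rule push[of _ n h, OF PC_cx h that])
  have pushu: "cx_ext R (X n) deg u' m \<phi> = u n m (cx_ext R (Q n) deg val m \<phi>)"
    if "\<phi> \<in> carrier (obj (?F n) m)" for n m \<phi>
    unfolding u'_def by (rule push[of _ n u, OF X_cx u that])
  have S: "system \<Gamma> od deg D' h' u'"
    unfolding system_def
  proof (intro ballI)
    fix g assume g: "g \<in> \<Gamma>"
    define n m x where nm: "n = od g" "m = deg g" "x = val g"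
    have x: "x \<in> carrier (obj (Q n) m)" using val[OF g] nm by simp
    have Dx: "D n m x \<in> carrier (obj (Q (n - 1)) m)" by (rule cmap_closed[OF D x])
    have D'g: "D' g \<in> carrier (obj (?F (n - 1)) m)"
      unfolding D'_def nm[symmetric] by (rule cmap_closed[OF i Dx])
    have v: "cx_ext R (Q (n - 1)) deg val m (D' g) = D n m x"
      unfolding D'_def nm[symmetric] by (rule i_val[OF Dx])
    have "D' g \<in> carrier (obj (?F (n - 1)) m) \<and>
      h' g \<in> carrier (obj (PC (n - 1)) m) \<and> u' g \<in> carrier (obj (X n) m) \<and>
      cx_ext R (fdc R UNIV od deg (n - 2)) deg D' m (D' g) = (\<lambda>b. \<zero>) \<and>
      dP (n - 1) m (h' g) = cx_ext R (PC (n - 2)) deg h' m (D' g) \<and>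
      pP (n - 1) m (h' g) = dX n m (u' g) \<oplus>\<^bsub>obj (X (n - 1)) m\<^esub> cx_ext R (X (n - 1)) deg u' m (D' g)"
    proof (intro conjI)
      have h'g: "h' g = h n m x" and u'g: "u' g = u n m x" by (simp_all add: h'_def u'_def nm)
      show "h' g \<in> carrier (obj (PC (n - 1)) m)" "u' g \<in> carrier (obj (X n) m)"
        unfolding h'g u'g by (rule cmap_closed[OF h x] cmap_closed[OF u x])+
      \<comment> \<open>From \<open>\<pi> i = 1\<close> one gets
        \<open>(i D \<pi>) (i D \<pi>) = i D D \<pi> = 0\<close>.\<close>
      have "cx_ext R (fdc R \<Gamma> od deg (n - 2)) deg D' m (D' g) = i (n - 2) m (D (n - 1) m (D n m x))"
        using pushD[OF D'g] v by simp
      also have "\<dots> = \<zero>\<^bsub>obj (fdc R \<Gamma> od deg (n - 2)) m\<^esub>"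
        unfolding DD[OF x] by (rule cmap_zero[OF Qc free_cx_cx i])
      finally have "cx_ext R (fdc R \<Gamma> od deg (n - 2)) deg D' m (D' g) = (\<lambda>b. \<zero>)" by simp
      moreover have "cx_ext R (fdc R \<Gamma> od deg (n - 2)) deg D' m (D' g) = cx_ext R (fdc R UNIV od deg (n - 2)) deg D' m (D' g)"
      proof (rule cmap_cx_ext[OF free_cx_cx free_cx_cx cmap_free_cx_mono _ D'g])
        fix g' assume g': "g' \<in> {g \<in> \<Gamma>. od g = n - 1}"
        then show "D' g' \<in> carrier (obj (fdc R \<Gamma> od deg (n - 2)) (deg g'))"
          using cmap_closed[OF iD val[of g' "n - 1"]] by (simp add: D'_def del: free_cx_obj)
      qed auto
      ultimately show "cx_ext R (fdc R UNIV od deg (n - 2)) deg D' m (D' g) = (\<lambda>b. \<zero>)" by simp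
      show "dP (n - 1) m (h' g) = cx_ext R (PC (n - 2)) deg h' m (D' g)"
        using pushh[OF D'g] v dh[OF x] h'g by simp
      show "pP (n - 1) m (h' g) = dX n m (u' g) \<oplus>\<^bsub>obj (X (n - 1)) m\<^esub> cx_ext R (X (n - 1)) deg u' m (D' g)"
        using pushu[OF D'g] v ph[OF x] h'g u'g by simp
    qed (rule D'g)
    then show "D' g \<in> carrier (obj (?F (od g - 1)) (deg g)) \<and>
      h' g \<in> carrier (obj (PC (od g - 1)) (deg g)) \<and> u' g \<in> carrier (obj (X (od g)) (deg g)) \<and>
      cx_ext R (fdc R UNIV od deg (od g - 2)) deg D' (deg g) (D' g) = (\<lambda>b. \<zero>) \<and>
      dP (od g - 1) (deg g) (h' g) = cx_ext R (PC (od g - 2)) deg h' (deg g) (D' g) \<and>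
      pP (od g - 1) (deg g) (h' g) = dX (od g) (deg g) (u' g)
        \<oplus>\<^bsub>obj (X (od g - 1)) (deg g)\<^esub> cx_ext R (X (od g - 1)) deg u' (deg g) (D' g)"
      unfolding nm .
  qed
  obtain T' where T': "solution \<Gamma> od deg D' h' u' T'" using solution_exists[OF S] by blast
  have eT: "cmap R (?F n) (PC n) (cx_ext R (PC n) deg T')" for n
    by (rule cx_ext_cmap[OF PC_cx]) (use solution_T[OF T'] in blast)
  define T where "T n m x = cx_ext R (PC n) deg T' m (i n m x)" for n m x
  have T: "cmap R (Q n) (PC n) (T n)" for n
    unfolding T_def[abs_def] by (rule cmap_comp[OF i eT])
  have gens: "cx_ext R (PC (n - 1)) deg h' (deg g) (unit_vec R (g, False)) = h' g"
    "cx_ext R (X n) deg u' (deg g) (unit_vec R (g, False)) = u' g"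
    "cx_ext R (PC n) deg T' (deg g) (unit_vec R (g, False)) = T' g"
    "cx_ext R (?F (n - 1)) deg D' (deg g) (unit_vec R (g, False)) = D' g" if "g \<in> \<Gamma>" "od g = n" for g n
    using system_h[OF S that] system_u[OF S that] solution_T[OF T' that] system_D[OF S that]
    by (auto intro!: cx_ext_gen PC_cx X_cx free_cx_cx simp del: free_cx_obj)
  have eh: "cmap R (?F n) (PC (n - 1)) (cx_ext R (PC (n - 1)) deg h')" for n
    by (rule cx_ext_cmap[OF PC_cx]) (use system_h[OF S] in blast)
  have eu: "cmap R (?F n) (X n) (cx_ext R (X n) deg u')" for n
    by (rule cx_ext_cmap[OF X_cx]) (use system_u[OF S] in blast)
  have eD: "cmap R (?F n) (?F (n - 1)) (cx_ext R (?F (n - 1)) deg D')" for n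
    by (rule cx_ext_cmap[OF free_cx_cx]) (use system_D[OF S] in blast)
  have eq1: "cx_ext R (PC (n - 1)) deg h' m \<phi> = dP n m (cx_ext R (PC n) deg T' m \<phi>)
      \<oplus>\<^bsub>obj (PC (n - 1)) m\<^esub> cx_ext R (PC (n - 1)) deg T' m (cx_ext R (?F (n - 1)) deg D' m \<phi>)"
    if "\<phi> \<in> carrier (obj (?F n) m)" for n m \<phi>
  proof (rule cmap_free_cx_eqI[OF PC_cx eh _ _ that])
    show "cmap R (?F n) (PC (n - 1)) (\<lambda>m \<phi>. dP n m (cx_ext R (PC n) deg T' m \<phi>)
      \<oplus>\<^bsub>obj (PC (n - 1)) m\<^esub> cx_ext R (PC (n - 1)) deg T' m (cx_ext R (?F (n - 1)) deg D' m \<phi>))"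
      by (intro cmap_plus PC_cx cmap_comp[OF eT dP_cmap] cmap_comp[OF eD eT])
    fix g assume "g \<in> {g \<in> \<Gamma>. od g = n}"
    then have g: "g \<in> \<Gamma>" "od g = n" by auto
    show "cx_ext R (PC (n - 1)) deg h' (deg g) (unit_vec R (g, False)) = dP n (deg g) (cx_ext R (PC n) deg T' (deg g) (unit_vec R (g, False)))
      \<oplus>\<^bsub>obj (PC (n - 1)) (deg g)\<^esub> cx_ext R (PC (n - 1)) deg T' (deg g) (cx_ext R (?F (n - 1)) deg D' (deg g) (unit_vec R (g, False)))"
      unfolding gens[OF g] using solutionD(2)[OF T' g(1)] g(2) by simp
  qed
  have eq2: "cx_ext R (X n) deg u' m \<phi> = pP n m (cx_ext R (PC n) deg T' m \<phi>)"
    if "\<phi> \<in> carrier (obj (?F n) m)" for n m \<phi>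
  proof (rule cmap_free_cx_eqI[OF X_cx eu cmap_comp[OF eT pP_cmap] _ that])
    fix g assume "g \<in> {g \<in> \<Gamma>. od g = n}"
    then have g: "g \<in> \<Gamma>" "od g = n" by auto
    show "cx_ext R (X n) deg u' (deg g) (unit_vec R (g, False)) = pP n (deg g) (cx_ext R (PC n) deg T' (deg g) (unit_vec R (g, False)))"
      unfolding gens[OF g] using solutionD(3)[OF T' g(1)] g(2) by simp
  qed
  have "h n m x = dP n m (T n m x) \<oplus>\<^bsub>obj (PC (n - 1)) m\<^esub> T (n - 1) m (D n m x)" "u n m x = pP n m (T n m x)"
    if x: "x \<in> carrier (obj (Q n) m)" for n m x
  proof -
    have ix: "i n m x \<in> carrier (obj (?F n) m)" by (rule cmap_closed[OF i x])
    \<comment> \<open>The identity for \<open>T'\<close> is evaluated at \<open>i x\<close>; as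
      \<open>\<pi> i = 1\<close>, the free differential satisfies \<open>D' i = i D\<close> and
      \<open>h \<pi> i = h\<close>.\<close>
    show "h n m x = dP n m (T n m x) \<oplus>\<^bsub>obj (PC (n - 1)) m\<^esub> T (n - 1) m (D n m x)"
      using eq1[OF ix] pushh[OF ix] pushD[OF ix] i_val[OF x] by (simp add: T_def)
    show "u n m x = pP n m (T n m x)"
      using eq2[OF ix] pushu[OF ix] i_val[OF x] by (simp add: T_def)
  qed
  then show ?thesis using T by blast
qed

section \<open>Complexes of complexes in terms of elements, and the universal map\<close>

lemma homotopic_apply:
  fixes R :: "('r, 'z) ring_scheme" and \<kappa> :: "'u rel"
  defines "A \<equiv> complex_cat (module_cat \<kappa> R)"
  shows "(f, g) \<in> homotopy_rel A X Y \<longleftrightarrow> f \<in> chain_maps A X Y \<and> g \<in> chain_maps A X Y \<and>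
    (\<exists>s. (\<forall>n. s n \<in> chain_maps (module_cat \<kappa> R) (obj X n) (obj Y (n + 1))) \<and>
      (\<forall>n m. \<forall>x\<in>carrier (obj (obj X n) m). f n m x = g n m x \<oplus>\<^bsub>obj (obj Y n) m\<^esub>
        (diff Y (n + 1) m (s n m x) \<oplus>\<^bsub>obj (obj Y n) m\<^esub> s (n - 1) m (diff X n m x))))"
proof -
  have eq: "(f n = Add A (obj X n) (obj Y n) (g n)
             (Add A (obj X n) (obj Y n)
               (Comp A (obj X n) (obj Y (n + 1)) (obj Y n) (diff Y (n + 1)) (s n))
               (Comp A (obj X n) (obj X (n - 1)) (obj Y n) (s (n - 1)) (diff X n)))) \<longleftrightarrow>
     (\<forall>m. \<forall>x\<in>carrier (obj (obj X n) m). f n m x = g n m x \<oplus>\<^bsub>obj (obj Y n) m\<^esub>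
        (diff Y (n + 1) m (s n m x) \<oplus>\<^bsub>obj (obj Y n) m\<^esub> s (n - 1) m (diff X n m x)))"
    if "f \<in> chain_maps A X Y" for s n
  proof -
    have "f n m \<in> extensional (carrier (obj (obj X n) m))" for m
    proof -
      have "f n \<in> chain_maps (module_cat \<kappa> R) (obj X n) (obj Y n)"
        using that unfolding A_def chain_maps_def[of "complex_cat (module_cat \<kappa> R)"] by simp
      then have "f n m \<in> module_homs R (obj (obj X n) m) (obj (obj Y n) m)" by (simp add: chain_maps_def)
      then show ?thesis by (simp add: module_homs_iff)
    qed
    then show ?thesis
      by (auto simp: A_def comp_chain_def compose_def fun_eq_iff restrict_def extensional_def)
  qed
  have Hom: "Hom A = chain_maps (module_cat \<kappa> R)" by (simp add: A_def)
  show ?thesis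
  proof (cases "f \<in> chain_maps A X Y")
    case True
    show ?thesis
      unfolding homotopy_rel_def mem_Collect_eq prod.case Hom by (simp only: eq[OF True])
  next
    case False
    then show ?thesis by (simp add: homotopy_rel_def)
  qed
qed

lemma chain_maps2D:
  assumes "f \<in> chain_maps (complex_cat (module_cat \<kappa> R)) X Y"
    and "X \<in> complexes (complex_cat (module_cat \<kappa> R))" "Y \<in> complexes (complex_cat (module_cat \<kappa> R))"
  shows "f n \<in> chain_maps (module_cat \<kappa> R) (obj X n) (obj Y n)" "cmap R (obj X n) (obj Y n) (f n)"
    "x \<in> carrier (obj (obj X n) m) \<Longrightarrow> f (n - 1) m (diff X n m x) = diff Y n m (f n m x)"
proof -
  have X: "obj X n \<in> complexes (module_cat \<kappa> R)" and Y: "obj Y n \<in> complexes (module_cat \<kappa> R)" for n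
    using assms(2,3) by (auto simp: complexes_def[of "complex_cat (module_cat \<kappa> R)"])
  show f: "f n \<in> chain_maps (module_cat \<kappa> R) (obj X n) (obj Y n)" for n
    using assms(1) by (simp add: chain_maps_def[of "complex_cat (module_cat \<kappa> R)"])
  then show "cmap R (obj X n) (obj Y n) (f n)" by (simp add: chain_maps_iff[OF X Y])
  have "comp_chain (module_cat \<kappa> R) (obj X n) (obj Y n) (obj Y (n - 1)) (diff Y n) (f n) =
      comp_chain (module_cat \<kappa> R) (obj X n) (obj X (n - 1)) (obj Y (n - 1)) (f (n - 1)) (diff X n)"
    using assms(1) by (simp add: chain_maps_def[of "complex_cat (module_cat \<kappa> R)"])
  from fun_cong[OF fun_cong[OF this, of m], of x]
  show "x \<in> carrier (obj (obj X n) m) \<Longrightarrow> f (n - 1) m (diff X n m x) = diff Y n m (f n m x)"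
    by (simp add: comp_chain_apply)
qed

lemma complexes2D:
  assumes "X \<in> complexes (complex_cat (module_cat \<kappa> R))"
  shows "obj X n \<in> complexes (module_cat \<kappa> R)" "cmap R (obj X n) (obj X (n - 1)) (diff X n)"
    "diff X n \<in> chain_maps (module_cat \<kappa> R) (obj X n) (obj X (n - 1))"
    "x \<in> carrier (obj (obj X n) m) \<Longrightarrow> diff X (n - 1) m (diff X n m x) = \<zero>\<^bsub>obj (obj X (n - 2)) m\<^esub>"
proof -
  show X: "obj X n \<in> complexes (module_cat \<kappa> R)" for n
    using assms by (auto simp: complexes_def[of "complex_cat (module_cat \<kappa> R)"])
  show d: "diff X n \<in> chain_maps (module_cat \<kappa> R) (obj X n) (obj X (n - 1))"
    using assms by (auto simp: complexes_def[of "complex_cat (module_cat \<kappa> R)"])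
  then show "cmap R (obj X n) (obj X (n - 1)) (diff X n)" by (simp add: chain_maps_iff[OF X X])
  have "comp_chain (module_cat \<kappa> R) (obj X n) (obj X (n - 1)) (obj X (n - 2)) (diff X (n - 1)) (diff X n) =
      (\<lambda>m. \<lambda>x\<in>carrier (obj (obj X n) m). \<zero>\<^bsub>obj (obj X (n - 2)) m\<^esub>)"
    using assms by (simp add: complexes_def[of "complex_cat (module_cat \<kappa> R)"])
  from fun_cong[OF fun_cong[OF this, of m], of x]
  show "x \<in> carrier (obj (obj X n) m) \<Longrightarrow> diff X (n - 1) m (diff X n m x) = \<zero>\<^bsub>obj (obj X (n - 2)) m\<^esub>"
    by (simp add: comp_chain_apply)
qed

lemma complexes_Prj: "X \<in> complexes (Prj A) \<longleftrightarrow> X \<in> complexes A \<and> (\<forall>n. projective_object A (obj X n))"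
  by (auto simp: complexes_def Prj_def projective_object_def)

text \<open>Factorisation holds strictly, uniqueness up to homotopy. Both come from
  \<open>projective_solution\<close>, with signs and shifts chosen so that its null homotopy is a
  chain map in one case and a homotopy in the other.\<close>

lemma universal_map_exists:
  fixes R :: "('r, 'z) ring_scheme" and \<kappa> :: "'u rel"
  defines "A \<equiv> complex_cat (module_cat \<kappa> R)"
  assumes "ring R" and univ: "universe_cardinal \<kappa>" and R: "|carrier R| <o \<kappa>" and X: "X \<in> complexes A"
  shows "\<exists>P\<in>complexes (Prj A). \<exists>p\<in>chain_maps A P X. \<forall>Q\<in>complexes (Prj A).
    (\<forall>g\<in>chain_maps A Q X. \<exists>f\<in>chain_maps A Q P. comp_chain A Q P X p f = g) \<and>
    (\<forall>f\<in>chain_maps A Q P. \<forall>f'\<in>chain_maps A Q P.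
      (comp_chain A Q P X p f, comp_chain A Q P X p f') \<in> homotopy_rel A Q X \<longrightarrow> (f, f') \<in> homotopy_rel A Q P)"
proof -
  interpret ring R by fact
  note X' = X[unfolded A_def]
  interpret dcx R "obj X" "diff X"
    by unfold_locales (rule complexesD(1)[OF complexes2D(1)[OF X']] complexes2D(2)[OF X'])+
  have small: "|\<Union>n m. carrier (obj (PC n) m)| <o \<kappa>"
    by (rule small_PC[OF univ R complexesD(2)[OF complexes2D(1)[OF X']]])
  \<comment> \<open>One embedding for all bidegrees at once, so that the same \<open>e\<close>
    copies every \<open>PC n\<close> and the differentials between them.\<close>
  obtain e :: "(('r, 'u) gen \<times> bool \<Rightarrow> 'r) \<Rightarrow> 'u" where "inj_on e (\<Union>n m. carrier (obj (PC n) m))"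
    using card_less_embed[OF small] by blast
  then have inj: "inj_on e (carrier (obj (PC n) m))" for n m by (rule inj_on_subset) blast
  have smallP: "|carrier (obj (PC n) m)| <o \<kappa>" for n m by (rule card_less_mono[OF _ small]) blast
  let ?E = "\<lambda>n. image_cx e (PC n)" and ?v = "\<lambda>n. image_cx_inv e (PC n)"
  note E = image_cx_complexes[OF PC_cx inj smallP] and I = image_cx_props[OF PC_cx inj]
  have v: "?v n m z \<in> carrier (obj (PC n) m)" "e (?v n m z) = z" if "z \<in> carrier (obj (?E n) m)" for n m z
    using cmap_closed[OF I(3) that] that by simp_all
  have ve: "?v n m (e \<phi>) = \<phi>" if "\<phi> \<in> carrier (obj (PC n) m)" for n m \<phi> by (rule image_cx_inv[OF inj that])
  have proj: "projective_object A (?E n)" for n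
    using inj[of n] smallP[of n] unfolding A_def PC_def by (intro projective_free[OF \<open>ring R\<close>]) auto
  define d where "d n = (\<lambda>m. \<lambda>z\<in>carrier (obj (?E n) m). e (dP n m (?v n m z)))" for n
  define P where "P = \<lparr>obj = ?E, diff = d\<rparr>"
  have Pobj [simp]: "obj P n = ?E n" and Pdiff [simp]: "diff P n = d n" for n by (simp_all add: P_def)
  have dmap: "d n \<in> chain_maps (module_cat \<kappa> R) (?E n) (?E (n - 1))" for n
    unfolding d_def by (rule chain_mapsI[OF E E]) (intro cmap_comp[OF cmap_comp[OF I(3) dP_cmap] I(2)])
  have de: "d n m (e \<phi>) = e (dP n m \<phi>)" if "\<phi> \<in> carrier (obj (PC n) m)" for n m \<phi>
    using that by (simp add: d_def ve)
  have ez: "e \<zero>\<^bsub>obj (PC n) m\<^esub> = \<zero>\<^bsub>obj (?E n) m\<^esub>" for n m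
    by (rule cmap_zero[OF PC_cx I(1) I(2)])
  have dd: "d (n - 1) m (d n m z) = \<zero>\<^bsub>obj (?E (n - 2)) m\<^esub>" if z: "z \<in> carrier (obj (?E n) m)" for n m z
  proof -
    obtain \<phi> where \<phi>: "\<phi> \<in> carrier (obj (PC n) m)" "z = e \<phi>" using z by auto
    show ?thesis
      unfolding \<phi>(2) de[OF \<phi>(1)] de[OF cmap_closed[OF dP_cmap \<phi>(1)]] dP_dP[OF \<phi>(1)] ez[symmetric] PC_zero ..
  qed
  have PA: "P \<in> complexes A"
    unfolding complexes_def using E dmap dd
    by (auto simp: A_def comp_chain_def compose_def fun_eq_iff restrict_def simp del: image_cx_carrier)
  have PPrj: "P \<in> complexes (Prj A)"
    using PA proj by (simp add: complexes_Prj)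
  define p where "p n = (\<lambda>m. \<lambda>z\<in>carrier (obj (?E n) m). pP n m (?v n m z))" for n
  have pmap: "p n \<in> chain_maps (module_cat \<kappa> R) (?E n) (obj X n)" for n
    unfolding p_def by (rule chain_mapsI[OF E complexes2D(1)[OF X']]) (rule cmap_comp[OF I(3) pP_cmap])
  have pe: "p n m (e \<phi>) = pP n m \<phi>" if "\<phi> \<in> carrier (obj (PC n) m)" for n m \<phi>
    using that by (simp add: p_def ve)
  have p: "p \<in> chain_maps A P X"
  proof -
    have "p (n - 1) m (d n m z) = diff X n m (p n m z)" if z: "z \<in> carrier (obj (?E n) m)" for n m z
    proof -
      obtain \<phi> where \<phi>: "\<phi> \<in> carrier (obj (PC n) m)" "z = e \<phi>" using z by auto
      show ?thesis
        unfolding \<phi>(2) de[OF \<phi>(1)] pe[OF \<phi>(1)] pe[OF cmap_closed[OF dP_cmap \<phi>(1)]] by (rule pP_dP[OF \<phi>(1)])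
    qed
    then show ?thesis
      unfolding chain_maps_def using pmap
      by (auto simp: A_def comp_chain_def compose_def fun_eq_iff restrict_def simp del: image_cx_carrier)
  qed
  show ?thesis
  proof (rule bexI[OF _ PPrj], rule bexI[OF _ p], intro ballI conjI impI)
    fix Q assume Q: "Q \<in> complexes (Prj A)"
    then have Qp: "projective_object (complex_cat (module_cat \<kappa> R)) (obj Q n)" for n
      by (simp add: complexes_Prj A_def)
    have QA: "Q \<in> complexes (complex_cat (module_cat \<kappa> R))"
      using Q by (simp add: complexes_Prj A_def)
    note Qk = complexes2D(1)[OF QA]
    note Qc = complexesD(1)[OF Qk] and Qd = complexes2D(2)[OF QA] and Qdd = complexes2D(4)[OF QA]
    {
      fix g assume "g \<in> chain_maps A Q X"
      then have g: "g \<in> chain_maps (complex_cat (module_cat \<kappa> R)) Q X" by (simp add: A_def)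
      note gD = chain_maps2D[OF g QA X']
      \<comment> \<open>For \<open>h = 0\<close> and \<open>u = g\<close> the hypothesis reads
        \<open>d g + g D = 0\<close>, which holds for the negated differential. The resulting
        \<open>0 = d T + T D\<close> then says that \<open>T\<close> is a chain map for the original
        one.\<close>
      let ?D = "\<lambda>n m x. \<ominus>\<^bsub>obj (obj Q (n - 1)) m\<^esub> diff Q n m x"
      have D: "cmap R (obj Q n) (obj Q (n - 1)) (?D n)" for n by (rule cmap_uminus[OF Qc Qd])
      have "\<exists>T. (\<forall>n. cmap R (obj Q n) (PC n) (T n)) \<and>
        (\<forall>n m. \<forall>x\<in>carrier (obj (obj Q n) m).
          \<zero>\<^bsub>obj (PC (n - 1)) m\<^esub> = dP n m (T n m x) \<oplus>\<^bsub>obj (PC (n - 1)) m\<^esub> T (n - 1) m (?D n m x) \<and> g n m x = pP n m (T n m x))"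
      proof (rule projective_solution[OF univ R Qp D _ cmap_const_zero[OF PC_cx] gD(2)])
        fix n m x assume x: "x \<in> carrier (obj (obj Q n) m)"
        interpret N: left_module R "obj (obj Q (n - 2)) m" by (rule cx_module[OF Qc])
        interpret N1: left_module R "obj (obj X (n - 1)) m" by (rule cx_module[OF X_cx])
        have dx: "diff Q n m x \<in> carrier (obj (obj Q (n - 1)) m)" by (rule cmap_closed[OF Qd x])
        have d1: "cmap R (obj Q (n - 1)) (obj Q (n - 2)) (diff Q (n - 1))" using Qd[of "n - 1"] by simp
        have mz: "\<ominus>\<^bsub>obj (obj Q (n - 2)) m\<^esub> \<zero>\<^bsub>obj (obj Q (n - 2)) m\<^esub> = \<zero>\<^bsub>obj (obj Q (n - 2)) m\<^esub>"
          using N.M.minus_equality[of "\<zero>\<^bsub>obj (obj Q (n - 2)) m\<^esub>" "\<zero>\<^bsub>obj (obj Q (n - 2)) m\<^esub>"] by simp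
        show "?D (n - 1) m (?D n m x) = \<zero>\<^bsub>obj (obj Q (n - 2)) m\<^esub>"
          using cmap_minus[OF Qc Qc d1 dx] Qdd[OF x] mz by simp
        show "dP (n - 1) m \<zero>\<^bsub>obj (PC (n - 1)) m\<^esub> = \<zero>\<^bsub>obj (PC (n - 1 - 1)) m\<^esub>"
          by (rule cmap_zero[OF PC_cx PC_cx dP_cmap])
        have gdx: "g (n - 1) m (diff Q n m x) \<in> carrier (obj (obj X (n - 1)) m)"
          by (rule cmap_closed[OF gD(2) dx])
        show "pP (n - 1) m \<zero>\<^bsub>obj (PC (n - 1)) m\<^esub> =
            diff X n m (g n m x) \<oplus>\<^bsub>obj (obj X (n - 1)) m\<^esub> g (n - 1) m (?D n m x)"
          using cmap_zero[OF PC_cx X_cx pP_cmap] gD(3)[OF x, symmetric] gdx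
          by (simp add: cmap_minus[OF Qc X_cx gD(2) dx] N1.M.r_neg)
      qed
      then obtain T where T: "\<And>n. cmap R (obj Q n) (PC n) (T n)"
        and T1: "\<And>n m x. x \<in> carrier (obj (obj Q n) m) \<Longrightarrow>
          \<zero>\<^bsub>obj (PC (n - 1)) m\<^esub> = dP n m (T n m x) \<oplus>\<^bsub>obj (PC (n - 1)) m\<^esub> T (n - 1) m (?D n m x)"
        and T2: "\<And>n m x. x \<in> carrier (obj (obj Q n) m) \<Longrightarrow> g n m x = pP n m (T n m x)"
        by blast
      have Td: "T (n - 1) m (diff Q n m x) = dP n m (T n m x)" if x: "x \<in> carrier (obj (obj Q n) m)" for n m x
      proof -
        interpret N: left_module R "obj (PC (n - 1)) m" by (rule cx_module[OF PC_cx])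
        have dx: "diff Q n m x \<in> carrier (obj (obj Q (n - 1)) m)" by (rule cmap_closed[OF Qd x])
        have c: "T (n - 1) m (diff Q n m x) \<in> carrier (obj (PC (n - 1)) m)" "dP n m (T n m x) \<in> carrier (obj (PC (n - 1)) m)"
          by (rule cmap_closed[OF T dx] cmap_closed[OF dP_cmap cmap_closed[OF T x]])+
        have "dP n m (T n m x) \<oplus>\<^bsub>obj (PC (n - 1)) m\<^esub> \<ominus>\<^bsub>obj (PC (n - 1)) m\<^esub> T (n - 1) m (diff Q n m x) = \<zero>\<^bsub>obj (PC (n - 1)) m\<^esub>"
          using T1[OF x] cmap_minus[OF Qc PC_cx T dx] by simp
        then show ?thesis
          using c N.M.minus_equality[of "dP n m (T n m x)" "\<ominus>\<^bsub>obj (PC (n - 1)) m\<^esub> T (n - 1) m (diff Q n m x)"] by simp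
      qed
      define f where "f n = (\<lambda>m. \<lambda>x\<in>carrier (obj (obj Q n) m). e (T n m x))" for n
      have fmap: "f n \<in> chain_maps (module_cat \<kappa> R) (obj Q n) (?E n)" for n
        unfolding f_def by (rule chain_mapsI[OF Qk E cmap_comp[OF T I(2)]])
      have "f \<in> chain_maps A Q P"
      proof -
        have "f (n - 1) m (diff Q n m x) = d n m (f n m x)" if x: "x \<in> carrier (obj (obj Q n) m)" for n m x
          using cmap_closed[OF Qd x] x by (simp add: f_def de[OF cmap_closed[OF T x]] Td)
        then show ?thesis
          unfolding chain_maps_def using fmap
          by (auto simp: A_def comp_chain_def compose_def fun_eq_iff restrict_def)
      qed
      moreover have "comp_chain A Q P X p f = g"
      proof
        fix n
        have "comp_chain (module_cat \<kappa> R) (obj Q n) (?E n) (obj X n) (p n) (f n) = g n"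
        proof (rule chain_maps_eqI[OF _ gD(1)])
          show "comp_chain (module_cat \<kappa> R) (obj Q n) (?E n) (obj X n) (p n) (f n)
              \<in> chain_maps (module_cat \<kappa> R) (obj Q n) (obj X n)"
            by (rule preadd.comp_chain_maps[OF module_cat_preadd Qk E complexes2D(1)[OF X'] fmap pmap])
          fix m x assume x: "x \<in> carrier (obj (obj Q n) m)"
          show "comp_chain (module_cat \<kappa> R) (obj Q n) (?E n) (obj X n) (p n) (f n) m x = g n m x"
            using x by (simp add: comp_chain_apply f_def pe[OF cmap_closed[OF T x]] T2)
        qed
        then show "comp_chain A Q P X p f n = g n" by (simp add: A_def comp_chain_def[of "complex_cat _"])
      qed
      ultimately show "\<exists>f\<in>chain_maps A Q P. comp_chain A Q P X p f = g" by blast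
    next
      fix f f' assume ff: "f \<in> chain_maps A Q P" "f' \<in> chain_maps A Q P"
        and hom: "(comp_chain A Q P X p f, comp_chain A Q P X p f') \<in> homotopy_rel A Q X"
      note fD = chain_maps2D[OF ff(1)[unfolded A_def] QA PA[unfolded A_def], simplified]
        and f'D = chain_maps2D[OF ff(2)[unfolded A_def] QA PA[unfolded A_def], simplified]
      obtain s where s: "\<And>n. s n \<in> chain_maps (module_cat \<kappa> R) (obj Q n) (obj X (n + 1))"
        and s_eq: "\<And>n m x. x \<in> carrier (obj (obj Q n) m) \<Longrightarrow>
          comp_chain A Q P X p f n m x = comp_chain A Q P X p f' n m x \<oplus>\<^bsub>obj (obj X n) m\<^esub>
          (diff X (n + 1) m (s n m x) \<oplus>\<^bsub>obj (obj X n) m\<^esub> s (n - 1) m (diff Q n m x))"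
        using hom unfolding A_def homotopic_apply by blast
      have sc: "cmap R (obj Q n) (obj X (n + 1)) (s n)" for n
        using s[of n] by (simp add: chain_maps_iff[OF Qk complexes2D(1)[OF X']])
      have vf: "cmap R (obj Q n) (PC n) (\<lambda>m x. ?v n m (f n m x))" "cmap R (obj Q n) (PC n) (\<lambda>m x. ?v n m (f' n m x))" for n
        using cmap_comp[OF fD(2) I(3)] cmap_comp[OF f'D(2) I(3)] by auto
      \<comment> \<open>The difference of \<open>f\<close> and \<open>f'\<close>, read back in
        \<open>PC\<close>; the given homotopy \<open>s\<close> shows that \<open>p H\<close> is null
        homotopic.\<close>
      define H where "H n m x = ?v n m (f n m x) \<oplus>\<^bsub>obj (PC n) m\<^esub> \<ominus>\<^bsub>obj (PC n) m\<^esub> ?v n m (f' n m x)" for n m x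
      have H: "cmap R (obj Q n) (PC n) (H n)" for n
        unfolding H_def[abs_def] by (intro cmap_plus cmap_uminus PC_cx vf)
      have vd: "?v (n - 1) m (d n m z) = dP n m (?v n m z)" if z: "z \<in> carrier (obj (?E n) m)" for n m z
        unfolding d_def using z cmap_closed[OF dP_cmap v(1)[OF z]] by (simp add: ve)
      have pv: "p n m z = pP n m (?v n m z)" if z: "z \<in> carrier (obj (?E n) m)" for n m z
        using z by (simp add: p_def)
      have dH: "dP n m (H n m x) = H (n - 1) m (diff Q n m x)" if x: "x \<in> carrier (obj (obj Q n) m)" for n m x
      proof -
        note c = cmap_closed[OF vf(1) x] cmap_closed[OF vf(2) x]
        interpret N: left_module R "obj (PC n) m" by (rule cx_module[OF PC_cx])
        have "dP n m (H n m x) = dP n m (?v n m (f n m x)) \<oplus>\<^bsub>obj (PC (n - 1)) m\<^esub>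
            \<ominus>\<^bsub>obj (PC (n - 1)) m\<^esub> dP n m (?v n m (f' n m x))"
          unfolding H_def using c by (simp add: cmap_add[OF dP_cmap] cmap_minus[OF PC_cx PC_cx dP_cmap])
        also have "\<dots> = H (n - 1) m (diff Q n m x)"
          unfolding H_def fD(3)[OF x] f'D(3)[OF x]
          using vd[OF cmap_closed[OF fD(2) x]] vd[OF cmap_closed[OF f'D(2) x]] by simp
        finally show ?thesis .
      qed
      have pH: "pP n m (H n m x) = diff X (n + 1) m (s n m x) \<oplus>\<^bsub>obj (obj X n) m\<^esub> s (n - 1) m (diff Q n m x)"
        if x: "x \<in> carrier (obj (obj Q n) m)" for n m x
      proof -
        note c = cmap_closed[OF vf(1) x] cmap_closed[OF vf(2) x]
        interpret N: left_module R "obj (PC n) m" by (rule cx_module[OF PC_cx])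
        interpret N1: left_module R "obj (obj X n) m" by (rule cx_module[OF X_cx])
        let ?r = "diff X (n + 1) m (s n m x) \<oplus>\<^bsub>obj (obj X n) m\<^esub> s (n - 1) m (diff Q n m x)"
        have r: "?r \<in> carrier (obj (obj X n) m)"
          using cmap_closed[OF dX_cmap cmap_closed[OF sc x]] cmap_closed[OF sc cmap_closed[OF Qd x]] by simp
        have "pP n m (?v n m (f n m x)) = pP n m (?v n m (f' n m x)) \<oplus>\<^bsub>obj (obj X n) m\<^esub> ?r"
          using s_eq[OF x] x pv[OF cmap_closed[OF fD(2) x]] pv[OF cmap_closed[OF f'D(2) x]]
          by (simp add: A_def comp_chain_def[of "complex_cat _"] comp_chain_apply)
        moreover have "pP n m (H n m x) = pP n m (?v n m (f n m x)) \<oplus>\<^bsub>obj (obj X n) m\<^esub>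
            \<ominus>\<^bsub>obj (obj X n) m\<^esub> pP n m (?v n m (f' n m x))"
          unfolding H_def using c by (simp add: cmap_add[OF pP_cmap] cmap_minus[OF PC_cx X_cx pP_cmap])
        moreover have "pP n m (?v n m (f' n m x)) \<in> carrier (obj (obj X n) m)"
          by (rule cmap_closed[OF pP_cmap c(2)])
        ultimately show ?thesis
          using r N1.M.a_comm[of "pP n m (?v n m (f' n m x))" ?r] by (simp add: N1.M.a_assoc N1.M.r_neg)
      qed
      \<comment> \<open>Applied to \<open>Q\<close> shifted by one, so that \<open>H\<close> lowers
        the outer degree as required and \<open>T\<close> raises the degree of \<open>Q\<close> by
        one, as a homotopy must.\<close>
      have "\<exists>T. (\<forall>n. cmap R (obj Q (n - 1)) (PC n) (T n)) \<and>
        (\<forall>n m. \<forall>x\<in>carrier (obj (obj Q (n - 1)) m).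
          H (n - 1) m x = dP n m (T n m x) \<oplus>\<^bsub>obj (PC (n - 1)) m\<^esub> T (n - 1) m (diff Q (n - 1) m x) \<and>
          s (n - 1) m x = pP n m (T n m x))"
      proof (rule projective_solution[OF univ R Qp Qd _ H])
        show "cmap R (obj Q (n - 1)) (obj X n) (s (n - 1))" for n using sc[of "n - 1"] by simp
        fix n m x assume x: "x \<in> carrier (obj (obj Q (n - 1)) m)"
        show "diff Q (n - 1 - 1) m (diff Q (n - 1) m x) = \<zero>\<^bsub>obj (obj Q (n - 2 - 1)) m\<^esub>"
          using Qdd[OF x] by (simp add: algebra_simps)
        show "dP (n - 1) m (H (n - 1) m x) = H (n - 1 - 1) m (diff Q (n - 1) m x)"
          by (rule dH[OF x])
        show "pP (n - 1) m (H (n - 1) m x) =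
            diff X n m (s (n - 1) m x) \<oplus>\<^bsub>obj (obj X (n - 1)) m\<^esub> s (n - 1 - 1) m (diff Q (n - 1) m x)"
          using pH[OF x] by simp
      qed
      then obtain T where T: "\<And>n. cmap R (obj Q (n - 1)) (PC n) (T n)"
        and T1: "\<And>n m x. x \<in> carrier (obj (obj Q (n - 1)) m) \<Longrightarrow>
          H (n - 1) m x = dP n m (T n m x) \<oplus>\<^bsub>obj (PC (n - 1)) m\<^esub> T (n - 1) m (diff Q (n - 1) m x)"
        by blast
      \<comment> \<open>Undoes the shift: the component of \<open>T\<close> with index
        \<open>n + 1\<close> starts at \<open>obj Q n\<close>.\<close>
      define t where "t n = (\<lambda>m. \<lambda>x\<in>carrier (obj (obj Q n) m). e (T (n + 1) m x))" for n
      have T': "cmap R (obj Q n) (PC (n + 1)) (T (n + 1))" for n using T[of "n + 1"] by simp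
      have t: "t n \<in> chain_maps (module_cat \<kappa> R) (obj Q n) (obj P (n + 1))" for n
        unfolding t_def Pobj by (rule chain_mapsI[OF Qk E cmap_comp[OF T' I(2)]])
      have "f n m x = f' n m x \<oplus>\<^bsub>obj (obj P n) m\<^esub>
          (diff P (n + 1) m (t n m x) \<oplus>\<^bsub>obj (obj P n) m\<^esub> t (n - 1) m (diff Q n m x))"
        if x: "x \<in> carrier (obj (obj Q n) m)" for n m x
      proof -
        interpret N: left_module R "obj (PC n) m" by (rule cx_module[OF PC_cx])
        note c = cmap_closed[OF vf(1) x] cmap_closed[OF vf(2) x]
        have Tx: "T (n + 1) m x \<in> carrier (obj (PC (n + 1)) m)" by (rule cmap_closed[OF T' x])
        have dT: "dP (n + 1) m (T (n + 1) m x) \<in> carrier (obj (PC n) m)"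
          using cmap_closed[OF dP_cmap Tx] by simp
        have dx: "diff Q n m x \<in> carrier (obj (obj Q (n - 1)) m)" by (rule cmap_closed[OF Qd x])
        have Td: "T n m (diff Q n m x) \<in> carrier (obj (PC n) m)" by (rule cmap_closed[OF T dx])
        have "H n m x = dP (n + 1) m (T (n + 1) m x) \<oplus>\<^bsub>obj (PC n) m\<^esub> T n m (diff Q n m x)"
          using T1[of x "n + 1" m] x by simp
        moreover have "?v n m (f n m x) = ?v n m (f' n m x) \<oplus>\<^bsub>obj (PC n) m\<^esub> H n m x"
          unfolding H_def using c by (simp add: N.M.a_comm[of "?v n m (f n m x)"] N.M.a_assoc[symmetric] N.M.r_neg)
        ultimately have "?v n m (f n m x) = ?v n m (f' n m x) \<oplus>\<^bsub>obj (PC n) m\<^esub>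
            (dP (n + 1) m (T (n + 1) m x) \<oplus>\<^bsub>obj (PC n) m\<^esub> T n m (diff Q n m x))" by simp
        then have "e (?v n m (f n m x)) = e (?v n m (f' n m x)) \<oplus>\<^bsub>obj (?E n) m\<^esub>
            (e (dP (n + 1) m (T (n + 1) m x)) \<oplus>\<^bsub>obj (?E n) m\<^esub> e (T n m (diff Q n m x)))"
          using c dT Td by (simp add: cmap_add[OF I(2)])
        then show ?thesis
          unfolding v(2)[OF cmap_closed[OF fD(2) x]] v(2)[OF cmap_closed[OF f'D(2) x]]
          using x dx by (simp add: t_def de[OF Tx])
      qed
      then show "(f, f') \<in> homotopy_rel A Q P"
        unfolding A_def homotopic_apply using ff t by (auto simp: A_def simp del: Pobj Pdiff)
    }
  qed
qed

theorem corollary3p10: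
  fixes R :: "('r, 'z) ring_scheme" and \<kappa> :: "'u rel"
  assumes "ring R"
    and "universe_cardinal \<kappa>" and "|carrier R| <o \<kappa>"
  shows "has_right_adjoint
           (homotopy_cat (Prj (complex_cat (module_cat \<kappa> R))))
           (homotopy_cat (complex_cat (module_cat \<kappa> R)))
           inclusion_functor"
proof -
  let ?A = "complex_cat (module_cat \<kappa> R)"
  let ?D = "homotopy_cat ?A"
  interpret A: preadd ?A by (rule preadd.complexes_preadd[OF module_cat_preadd])
  \<comment> \<open>The source category is a full subcategory of the target, the form in which the
    criterion by universal arrows applies.\<close>
  have Prj: "homotopy_cat (Prj ?A) = ?D\<lparr>Ob := complexes (Prj ?A)\<rparr>"
    unfolding Prj_def by (rule homotopy_cat_restrict)
  have sub: "complexes (Prj ?A) \<subseteq> complexes ?A"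
    by (auto simp: complexes_Prj)
  show ?thesis
    unfolding Prj
  proof (rule right_adjoint_if_universal[OF A.homotopy_category])
    show "complexes (Prj ?A) \<subseteq> Ob ?D" using sub by (simp add: homotopy_cat_def)
    fix X assume "X \<in> Ob ?D"
    then have X: "X \<in> complexes ?A" by (simp add: homotopy_cat_def)
    obtain P p where P: "P \<in> complexes (Prj ?A)" and p: "p \<in> chain_maps ?A P X"
      and surj: "\<And>Q g. Q \<in> complexes (Prj ?A) \<Longrightarrow> g \<in> chain_maps ?A Q X \<Longrightarrow>
        \<exists>f\<in>chain_maps ?A Q P. comp_chain ?A Q P X p f = g"
      and inj: "\<And>Q f f'. Q \<in> complexes (Prj ?A) \<Longrightarrow> f \<in> chain_maps ?A Q P \<Longrightarrow> f' \<in> chain_maps ?A Q P \<Longrightarrow>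
        (comp_chain ?A Q P X p f, comp_chain ?A Q P X p f') \<in> homotopy_rel ?A Q X \<Longrightarrow> (f, f') \<in> homotopy_rel ?A Q P"
      using universal_map_exists[OF assms X] by blast
    have PA: "P \<in> complexes ?A" using P sub by blast
    let ?p = "homotopy_rel ?A P X `` {p}"
    have "bij_betw (Comp ?D Q P X ?p) (Hom ?D Q P) (Hom ?D Q X)" if Q: "Q \<in> complexes (Prj ?A)" for Q
    proof -
      have QA: "Q \<in> complexes ?A" using Q sub by blast
      have H: "Hom ?D Q Y = chain_maps ?A Q Y // homotopy_rel ?A Q Y" for Y by (simp add: homotopy_cat_def)
      note c = A.homotopy_comp[OF QA PA X _ p]
      note eP = A.homotopy_equiv[OF QA PA] and eX = A.homotopy_equiv[OF QA X]
      show ?thesis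
        unfolding bij_betw_def H
      proof (rule conjI[OF inj_onI Set.set_eqI[OF iffI]])
        fix F F' assume F: "F \<in> chain_maps ?A Q P // homotopy_rel ?A Q P" "F' \<in> chain_maps ?A Q P // homotopy_rel ?A Q P"
          and eq: "Comp ?D Q P X ?p F = Comp ?D Q P X ?p F'"
        obtain f f' where f: "f \<in> chain_maps ?A Q P" "F = homotopy_rel ?A Q P `` {f}"
          and f': "f' \<in> chain_maps ?A Q P" "F' = homotopy_rel ?A Q P `` {f'}"
          using F by (auto elim!: quotientE)
        have "homotopy_rel ?A Q X `` {comp_chain ?A Q P X p f} = homotopy_rel ?A Q X `` {comp_chain ?A Q P X p f'}"
          using eq unfolding f(2) f'(2) c[OF f(1)] c[OF f'(1)] .
        then have "(comp_chain ?A Q P X p f, comp_chain ?A Q P X p f') \<in> homotopy_rel ?A Q X"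
          by (rule eq_equiv_class[OF _ eX A.comp_chain_maps[OF QA PA X f'(1) p]])
        then show "F = F'"
          unfolding f(2) f'(2) by (intro equiv_class_eq[OF eP] inj[OF Q f(1) f'(1)])
      next
        fix G assume "G \<in> Comp ?D Q P X ?p ` (chain_maps ?A Q P // homotopy_rel ?A Q P)"
        then obtain f where f: "f \<in> chain_maps ?A Q P" "G = Comp ?D Q P X ?p (homotopy_rel ?A Q P `` {f})"
          by (auto elim!: quotientE)
        show "G \<in> chain_maps ?A Q X // homotopy_rel ?A Q X"
          unfolding f(2) c[OF f(1)] by (rule quotientI[OF A.comp_chain_maps[OF QA PA X f(1) p]])
      next
        fix G assume "G \<in> chain_maps ?A Q X // homotopy_rel ?A Q X"
        then obtain g where g: "g \<in> chain_maps ?A Q X" "G = homotopy_rel ?A Q X `` {g}"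
          by (auto elim: quotientE)
        \<comment> \<open>Surjectivity on classes uses the strict factorisation of one
          representative; injectivity was the statement up to homotopy.\<close>
        obtain f where f: "f \<in> chain_maps ?A Q P" "comp_chain ?A Q P X p f = g" using surj[OF Q g(1)] by blast
        show "G \<in> Comp ?D Q P X ?p ` (chain_maps ?A Q P // homotopy_rel ?A Q P)"
          by (rule image_eqI[OF _ quotientI[OF f(1)]]) (simp add: c[OF f(1)] f(2) g(2))
      qed
    qed
    moreover have "?p \<in> Hom ?D P X" using p by (simp add: homotopy_cat_def quotientI)
    ultimately show "\<exists>P\<in>complexes (Prj ?A). \<exists>p\<in>Hom ?D P X. \<forall>Q\<in>complexes (Prj ?A).
        bij_betw (Comp ?D Q P X p) (Hom ?D Q P) (Hom ?D Q X)"
      using P by blast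
  qed
qed

end
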